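(* At least $28$ of the $821$ triangulations (up to isomorphism) with exactly $11$ vertices (the minimal number) of the orientable closed surface $M_4$ of genus $4$ have polyhedral realizations in $\mathbb{R}^3$ with $2$-fold rotational symmetry.
   Context: $M_g$ denotes the orientable closed surface of genus $g$. A triangulation of a closed connected surface $S$ is a finite two-dimensional simplicial complex $\Delta$ whose underlying space $|\Delta|$ is homeomorphic to $S$; triangulations are counted up to combinatorial (simplicial) isomorphism. The minimal number of vertices of a triangulation of $M_4$ is $11$, and there are exactly $821$ triangulations of $M_4$ with $11$ vertices, from the known enumeration. Let $V$ be the vertex set of $\Delta$. Each map $\psi\colon V\to\mathbb{R}^3$ induces a simplexwise linear map $\phi_\psi\colon|\Delta|\to\mathbb{R}^3$. Since the surface is orientable, a polyhedral realization of $\Delta$ in $\mathbb{R}^3$ is a map $\phi_\psi$ that is injective (a simplexwise linear embedding). A geometric symmetry of a polyhedral realization $\phi_\psi$ is an isometry $g$ of $\mathbb{R}^3$ that maps $\phi_\psi(|\Delta|)$ to itself and is induced by an automorphism $\alpha$ of $\Delta$, i.e. $g\circ\phi_\psi=\phi_\psi\circ|\alpha|$. The realization has $2$-fold rotational symmetry if a rotation of order $2$ about a line is a geometric symmetry of it. *)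

theory Defs
  imports "HOL-Analysis.Analysis"
begin

section \<open>The closed orientable surfaces\<close>

definition quotient_topology :: "'a topology \<Rightarrow> ('a \<times> 'a) set \<Rightarrow> 'a set topology" where
  "quotient_topology X r =
     topology (\<lambda>U. U \<subseteq> topspace X // r \<and> openin X (\<Union>U))"

lemma openin_quotient_topology:
  assumes "equiv (topspace X) r"
  shows "openin (quotient_topology X r) U \<longleftrightarrow> U \<subseteq> topspace X // r \<and> openin X (\<Union>U)"
proof -
  have *: "\<Union>(A \<inter> B) = \<Union>A \<inter> \<Union>B"
    if "A \<subseteq> topspace X // r" "B \<subseteq> topspace X // r" for A B
    using that quotient_disj[OF assms] by blast
  have "istopology (\<lambda>U. U \<subseteq> topspace X // r \<and> openin X (\<Union>U))"
    unfolding istopology_def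
  proof (intro conjI allI impI)
    fix S T
    assume "S \<subseteq> topspace X // r \<and> openin X (\<Union>S)" "T \<subseteq> topspace X // r \<and> openin X (\<Union>T)"
    then show "openin X (\<Union>(S \<inter> T))" by (auto simp: *)
  next
    fix K
    assume K: "\<forall>V\<in>K. V \<subseteq> topspace X // r \<and> openin X (\<Union>V)"
    have "\<Union>(\<Union>K) = \<Union>((\<lambda>V. \<Union>V) ` K)" by blast
    then show "openin X (\<Union>(\<Union>K))" using K by auto
  qed blast+
  then show ?thesis by (simp add: quotient_topology_def)
qed

text \<open>
  For \<open>g \<ge> 1\<close>, the surface of genus \<open>g\<close> is the \<open>4g\<close>-gon with its sides identified
  according to the word
  \<open>a\<^sub>1 b\<^sub>1 a\<^sub>1\<inverse> b\<^sub>1\<inverse> \<dots> a\<^sub>g b\<^sub>g a\<^sub>g\<inverse> b\<^sub>g\<inverse>\<close>.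
  The polygon is the closed unit disc with its boundary circle divided into \<open>4g\<close> equal arcs,
  numbered counterclockwise from 0; \<open>s \<in> [0, 1]\<close> parametrizes each arc counterclockwise.
\<close>

definition side_point :: "nat \<Rightarrow> nat \<Rightarrow> real \<Rightarrow> complex" where
  "side_point g j s = cis (2 * pi * (real j + s) / (4 * real g))"

definition side_pairing :: "nat \<Rightarrow> complex \<Rightarrow> complex \<Rightarrow> bool" where
  "side_pairing g x y \<longleftrightarrow>
     (\<exists>j s. j < 4 * g \<and> j mod 4 \<in> {0, 1} \<and> 0 \<le> s \<and> s \<le> 1 \<and>
            x = side_point g j s \<and> y = side_point g (j + 2) (1 - s))"

definition surface_rel :: "nat \<Rightarrow> (complex \<times> complex) set" where
  "surface_rel g =
     {(x, y). x \<in> cball 0 1 \<and> y \<in> cball 0 1 \<and> equivclp (side_pairing g) x y}"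

lemma equiv_surface_rel: "equiv (cball 0 1) (surface_rel g)"
  unfolding equiv_def refl_on_def sym_on_def trans_on_def surface_rel_def
  by (auto intro: equivclp_sym equivclp_trans)

definition orientable_surface :: "nat \<Rightarrow> complex set topology" where
  "orientable_surface g = quotient_topology (top_of_set (cball 0 1)) (surface_rel g)"


section \<open>Triangulations\<close>

text \<open>
  Finite complexes are given by their nonempty faces, as sets of vertices.  Points of the
  underlying space are barycentric coordinates, extended by 0 off the vertex set.
\<close>

definition finite_complex :: "'v set set \<Rightarrow> bool" where
  "finite_complex \<Delta> \<longleftrightarrow>
     finite \<Delta> \<and> (\<forall>\<sigma>\<in>\<Delta>. finite \<sigma> \<and> \<sigma> \<noteq> {} \<and> (\<forall>\<tau>. \<tau> \<subseteq> \<sigma> \<and> \<tau> \<noteq> {} \<longrightarrow> \<tau> \<in> \<Delta>))"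

definition two_dimensional :: "'v set set \<Rightarrow> bool" where
  "two_dimensional \<Delta> \<longleftrightarrow> (\<forall>\<sigma>\<in>\<Delta>. card \<sigma> \<le> 3) \<and> (\<exists>\<sigma>\<in>\<Delta>. card \<sigma> = 3)"

abbreviation vertices :: "'v set set \<Rightarrow> 'v set" where
  "vertices \<Delta> \<equiv> \<Union>\<Delta>"

definition underlying_space :: "'v set set \<Rightarrow> ('v \<Rightarrow> real) set" where
  "underlying_space \<Delta> =
     {x. (\<forall>v. 0 \<le> x v) \<and> {v. x v \<noteq> 0} \<in> \<Delta> \<and> (\<Sum>v\<in>vertices \<Delta>. x v) = 1}"

definition triangulates :: "'v set set \<Rightarrow> 'a topology \<Rightarrow> bool" where
  "triangulates \<Delta> S \<longleftrightarrow>
     finite_complex \<Delta> \<and> two_dimensional \<Delta> \<and>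
     top_of_set (underlying_space \<Delta>) homeomorphic_space S"

definition simplicial_iso :: "('v \<Rightarrow> 'w) \<Rightarrow> 'v set set \<Rightarrow> 'w set set \<Rightarrow> bool" where
  "simplicial_iso \<alpha> \<Delta> \<Gamma> \<longleftrightarrow>
     bij_betw \<alpha> (vertices \<Delta>) (vertices \<Gamma>) \<and> (\<lambda>\<sigma>. \<alpha> ` \<sigma>) ` \<Delta> = \<Gamma>"

definition isomorphic_complexes :: "'v set set \<Rightarrow> 'w set set \<Rightarrow> bool" where
  "isomorphic_complexes \<Delta> \<Gamma> \<longleftrightarrow> (\<exists>\<alpha>. simplicial_iso \<alpha> \<Delta> \<Gamma>)"

definition induced_map :: "'v set set \<Rightarrow> ('v \<Rightarrow> 'w) \<Rightarrow> ('v \<Rightarrow> real) \<Rightarrow> ('w \<Rightarrow> real)" where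
  "induced_map \<Delta> \<alpha> x = (\<lambda>w. \<Sum>v\<in>{v \<in> vertices \<Delta>. \<alpha> v = w}. x v)"


section \<open>Polyhedral realizations and their symmetries\<close>

definition simplexwise_linear :: "'v set set \<Rightarrow> ('v \<Rightarrow> real^3) \<Rightarrow> ('v \<Rightarrow> real) \<Rightarrow> real^3" where
  "simplexwise_linear \<Delta> \<psi> x = (\<Sum>v\<in>vertices \<Delta>. x v *\<^sub>R \<psi> v)"

definition polyhedral_realization :: "'v set set \<Rightarrow> ('v \<Rightarrow> real^3) \<Rightarrow> bool" where
  "polyhedral_realization \<Delta> \<psi> \<longleftrightarrow> inj_on (simplexwise_linear \<Delta> \<psi>) (underlying_space \<Delta>)"

definition geometric_symmetry ::
    "'v set set \<Rightarrow> ('v \<Rightarrow> real^3) \<Rightarrow> (real^3 \<Rightarrow> real^3) \<Rightarrow> bool" where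
  "geometric_symmetry \<Delta> \<psi> g \<longleftrightarrow>
     (\<forall>p q. dist (g p) (g q) = dist p q) \<and>
     g ` simplexwise_linear \<Delta> \<psi> ` underlying_space \<Delta> =
       simplexwise_linear \<Delta> \<psi> ` underlying_space \<Delta> \<and>
     (\<exists>\<alpha>. simplicial_iso \<alpha> \<Delta> \<Delta> \<and>
        (\<forall>x\<in>underlying_space \<Delta>.
           g (simplexwise_linear \<Delta> \<psi> x) = simplexwise_linear \<Delta> \<psi> (induced_map \<Delta> \<alpha> x)))"

text \<open>The axis is the line through \<open>p\<close> with direction \<open>u\<close>.\<close>

definition rotation_about_line :: "real^3 \<Rightarrow> real^3 \<Rightarrow> (real^3 \<Rightarrow> real^3) \<Rightarrow> bool" where
  "rotation_about_line p u g \<longleftrightarrow>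
     u \<noteq> 0 \<and> (\<exists>Q :: real^3^3. rotation_matrix Q \<and> Q *v u = u \<and> (\<forall>x. g x = p + Q *v (x - p)))"

definition has_2fold_rotational_symmetry :: "'v set set \<Rightarrow> ('v \<Rightarrow> real^3) \<Rightarrow> bool" where
  "has_2fold_rotational_symmetry \<Delta> \<psi> \<longleftrightarrow>
     (\<exists>p u g. rotation_about_line p u g \<and> g \<noteq> id \<and> g \<circ> g = id \<and> geometric_symmetry \<Delta> \<psi> g)"

end

theory Submission
  imports Defs "HOL-Library.Code_Binary_Nat"
begin

text \<open>
  The underlying space of a complex does not change, up to homeomorphism, under a stellar
  subdivision, hence neither under bistellar flips, which are compositions of a subdivision and
  an inverse subdivision.  A triangulation of the 16-gon whose sides are subdivided into three
  segments induces a triangulation of the surface of genus 4, and explicit flips connect it with 28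
  triangulations on 11 vertices that admit an involution.  An integer-valued
  isomorphism invariant separates the 28 triangulations.

  They are realized by small integer coordinates on which the involution acts as a half-turn about
  the third axis.  If a simplexwise linear map is not injective, the difference of two points
  with the same image is an affine dependence among the images of the vertices, whose positive and negative
  parts are supported on two disjoint faces.  Reducing it to an edge and a triangle, one is left with
  finitely many sign conditions on determinants.
\<close>

section \<open>Stellar subdivisions\<close>

text \<open>The surface is defined as a quotient of a disc, and no classification of surfaces is
  invoked: a single homeomorphism onto that quotient is built, for a triangulation large enough to
  keep the gluing under control. The two ends of every side of the 16-gon become the same vertex, so
  one segment per side would give a loop and two segments a double edge; three are the least number
  that gives a simplicial complex. The ring of 48 vertices keeps the center away from the boundary,
  where the vertex 16 occurs sixteen times. The Euler characteristic -6 forces 34 triangles on 11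
  vertices. Each involution swaps five pairs of vertices and fixes one vertex, which must lie on the
  axis; most of the surfaces arise from one another by flips made in mirror pairs, which preserve
  the involution. General position (no vertex in the plane of a triangle that does not contain it)
  makes the side of every plane strict and excludes the degenerate intersections.\<close>

abbreviation polyhedron :: "'v set set \<Rightarrow> ('v \<Rightarrow> real) topology" where
  "polyhedron \<Delta> \<equiv> top_of_set (underlying_space \<Delta>)"

text \<open>Only the support contributes to the sum, so any finite set around it may be summed over.
  This matters because a complex and its subdivision have different vertex sets.\<close>

lemma underlying_space_alt:
  assumes "finite_complex \<Delta>"
  shows "x \<in> underlying_space \<Delta> \<longleftrightarrow>
    (\<forall>v. 0 \<le> x v) \<and> {v. x v \<noteq> 0} \<in> \<Delta> \<and> (\<Sum>v | x v \<noteq> 0. x v) = 1"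
proof -
  have "(\<Sum>v\<in>vertices \<Delta>. x v) = (\<Sum>v | x v \<noteq> 0. x v)" if "{v. x v \<noteq> 0} \<in> \<Delta>"
  proof (rule sum.mono_neutral_right)
    show "finite (vertices \<Delta>)" using assms by (simp add: finite_complex_def)
  qed (use that in auto)
  then show ?thesis by (auto simp: underlying_space_def)
qed

lemma underlying_spaceI:
  assumes "finite_complex \<Delta>" "\<And>v. 0 \<le> x v" "{v. x v \<noteq> 0} \<in> \<Delta>"
    and "finite A" "{v. x v \<noteq> 0} \<subseteq> A" "sum x A = 1"
  shows "x \<in> underlying_space \<Delta>"
proof -
  have "(\<Sum>v | x v \<noteq> 0. x v) = sum x A"
    using assms(4,5) by (intro sum.mono_neutral_left) auto
  then show ?thesis using assms by (simp add: underlying_space_alt)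
qed

lemma underlying_space_sum:
  assumes "finite_complex \<Delta>" "x \<in> underlying_space \<Delta>" "finite A" "{v. x v \<noteq> 0} \<subseteq> A"
  shows "sum x A = 1"
proof -
  have "sum x A = (\<Sum>v | x v \<noteq> 0. x v)"
    using assms(3,4) by (intro sum.mono_neutral_right) auto
  then show ?thesis using assms(1,2) by (simp add: underlying_space_alt)
qed

text \<open>The face \<open>\<sigma>\<close> is starred from a new vertex \<open>v\<close>; the set \<open>\<rho>\<close> may be empty.\<close>

definition stellar :: "'v set set \<Rightarrow> 'v set \<Rightarrow> 'v \<Rightarrow> 'v set set" where
  "stellar \<Delta> \<sigma> v = {\<tau>\<in>\<Delta>. \<not> \<sigma> \<subseteq> \<tau>} \<union> {insert v \<rho> |\<rho>. \<rho> \<union> \<sigma> \<in> \<Delta> \<and> \<not> \<sigma> \<subseteq> \<rho>}"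

lemma finite_complex_stellar:
  assumes "finite_complex \<Delta>" "\<sigma> \<in> \<Delta>"
  shows "finite_complex (stellar \<Delta> \<sigma> v)"
  unfolding finite_complex_def
proof (intro conjI ballI allI impI)
  have fin: "finite \<Delta>" and fin': "\<And>\<tau>. \<tau> \<in> \<Delta> \<Longrightarrow> finite \<tau>"
    and sub: "\<And>\<tau> \<tau>'. \<tau> \<in> \<Delta> \<Longrightarrow> \<tau>' \<subseteq> \<tau> \<Longrightarrow> \<tau>' \<noteq> {} \<Longrightarrow> \<tau>' \<in> \<Delta>"
    and ne: "\<And>\<tau>. \<tau> \<in> \<Delta> \<Longrightarrow> \<tau> \<noteq> {}"
    using assms(1) unfolding finite_complex_def by blast+
  have "stellar \<Delta> \<sigma> v \<subseteq> \<Delta> \<union> insert v ` Pow (vertices \<Delta>)"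
    by (auto simp: stellar_def)
  then show "finite (stellar \<Delta> \<sigma> v)"
    using fin fin' by (elim finite_subset) auto
  fix \<tau> assume \<tau>: "\<tau> \<in> stellar \<Delta> \<sigma> v"
  then show "finite \<tau>" "\<tau> \<noteq> {}" using fin' ne by (auto simp: stellar_def)
  fix \<tau>' assume \<tau>': "\<tau>' \<subseteq> \<tau> \<and> \<tau>' \<noteq> {}"
  from \<tau> consider "\<tau> \<in> \<Delta>" "\<not> \<sigma> \<subseteq> \<tau>" | \<rho> where "\<tau> = insert v \<rho>" "\<rho> \<union> \<sigma> \<in> \<Delta>" "\<not> \<sigma> \<subseteq> \<rho>"
    by (auto simp: stellar_def)
  then show "\<tau>' \<in> stellar \<Delta> \<sigma> v"
  proof cases
    case 1
    then show ?thesis using \<tau>' sub by (auto simp: stellar_def)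
  next
    case 2
    show ?thesis
    proof (cases "v \<in> \<tau>'")
      case True
      have "\<tau>' = insert v (\<tau>' \<inter> \<rho>)" using True 2(1) \<tau>' by blast
      moreover have "\<tau>' \<inter> \<rho> \<union> \<sigma> \<in> \<Delta>" using sub[OF 2(2), of "\<tau>' \<inter> \<rho> \<union> \<sigma>"] ne[OF assms(2)] by auto
      moreover have "\<not> \<sigma> \<subseteq> \<tau>' \<inter> \<rho>" using 2(3) by blast
      ultimately show ?thesis unfolding stellar_def by blast
    next
      case False
      then have "\<tau>' \<subseteq> \<rho>" using 2(1) \<tau>' by blast
      moreover have "\<tau>' \<in> \<Delta>" using sub[OF 2(2), of \<tau>'] \<tau>' \<open>\<tau>' \<subseteq> \<rho>\<close> by auto
      ultimately show ?thesis using 2(3) by (auto simp: stellar_def)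
    qed
  qed
qed

lemma continuous_on_Min_coordinates:
  assumes "finite \<sigma>" "\<sigma> \<noteq> {}"
  shows "continuous_on S (\<lambda>y :: 'v \<Rightarrow> real. Min (y ` \<sigma>))"
  using assms
proof (induction \<sigma> rule: finite_ne_induct)
  case (singleton w)
  have "continuous_on S (\<lambda>y :: 'v \<Rightarrow> real. y w)"
    by (rule continuous_on_subset[OF continuous_on_product_coordinates]) simp
  then show ?case by simp
next
  case (insert w \<sigma>)
  then have "(\<lambda>y :: 'v \<Rightarrow> real. Min (y ` insert w \<sigma>)) = (\<lambda>y. min (y w) (Min (y ` \<sigma>)))"
    by (intro ext) simp
  moreover have "continuous_on S (\<lambda>y :: 'v \<Rightarrow> real. y w)"
    by (rule continuous_on_subset[OF continuous_on_product_coordinates]) simp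
  ultimately show ?case using insert.IH by (simp only:) (rule continuous_on_min)
qed

text \<open>The coordinate of the new vertex is spread evenly over \<open>\<sigma>\<close>; conversely, the minimum of the
  coordinates over \<open>\<sigma>\<close> is taken away from all of them.\<close>

lemma stellar_homeomorphic:
  assumes \<Delta>: "finite_complex \<Delta>" and \<sigma>: "\<sigma> \<in> \<Delta>" and v: "v \<notin> vertices \<Delta>"
  shows "polyhedron (stellar \<Delta> \<sigma> v) homeomorphic_space
         polyhedron \<Delta>"
proof -
  define f where "f = (\<lambda>(x :: 'a \<Rightarrow> real) w. if w = v then 0 else x w + (if w \<in> \<sigma> then x v / card \<sigma> else 0))"
  define m where "m = (\<lambda>y :: 'a \<Rightarrow> real. Min (y ` \<sigma>))"
  define g where "g = (\<lambda>(y :: 'a \<Rightarrow> real) w. if w = v then card \<sigma> * m y else if w \<in> \<sigma> then y w - m y else y w)"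
  note st = finite_complex_stellar[OF \<Delta> \<sigma>, of v]
  have fin\<sigma>: "finite \<sigma>" and ne\<sigma>: "\<sigma> \<noteq> {}" using \<Delta> \<sigma> unfolding finite_complex_def by blast+
  have fin: "finite (vertices \<Delta>)" using \<Delta> by (simp add: finite_complex_def)
  have sub: "\<tau>' \<in> \<Delta>" if "\<tau> \<in> \<Delta>" "\<tau>' \<subseteq> \<tau>" "\<tau>' \<noteq> {}" for \<tau> \<tau>'
    using \<Delta> that unfolding finite_complex_def by blast
  have c0: "card \<sigma> > 0" using fin\<sigma> ne\<sigma> by (simp add: card_gt_0_iff)
  have v\<sigma>: "v \<notin> \<sigma>" using v \<sigma> by auto
  define V where "V = insert v (vertices \<Delta>)"
  have V: "finite V" "v \<in> V" "\<sigma> \<subseteq> V" using fin \<sigma> by (auto simp: V_def)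
  have suppV: "{w. x w \<noteq> 0} \<subseteq> V" if "x \<in> underlying_space (stellar \<Delta> \<sigma> v)" for x
  proof -
    have "{w. x w \<noteq> 0} \<in> stellar \<Delta> \<sigma> v" using that by (simp add: underlying_space_def)
    then show ?thesis by (auto simp: stellar_def V_def)
  qed
  have suppV': "{w. x w \<noteq> 0} \<subseteq> V" if "x \<in> underlying_space \<Delta>" for x
  proof -
    have "{w. x w \<noteq> 0} \<in> \<Delta>" using that by (simp add: underlying_space_def)
    then show ?thesis by (auto simp: V_def)
  qed
  \<comment> \<open>A face of the subdivision omits some vertex of \<open>\<sigma>\<close>. The
    minimum over \<open>\<sigma>\<close> is therefore 0 before the new coordinate is spread, and
    \<open>g\<close> recovers exactly the amount that \<open>f\<close> added.\<close>
  have zero: "\<exists>w\<in>\<sigma>. x w = 0" if "x \<in> underlying_space (stellar \<Delta> \<sigma> v)" for x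
  proof -
    have "{w. x w \<noteq> 0} \<in> stellar \<Delta> \<sigma> v" using that by (simp add: underlying_space_def)
    then show ?thesis using v\<sigma> by (auto simp: stellar_def)
  qed
  have nn: "0 \<le> x w" if "x \<in> underlying_space \<Gamma>" for x w and \<Gamma> :: "'a set set"
    using that by (simp add: underlying_space_def)
  have sum\<sigma>: "(\<Sum>w\<in>V. if w \<in> \<sigma> then r else 0) = card \<sigma> * r" for r :: real
    using V by (simp add: sum.If_cases Int_absorb1)
  have f_in: "f x \<in> underlying_space \<Delta>" if x: "x \<in> underlying_space (stellar \<Delta> \<sigma> v)" for x
  proof (rule underlying_spaceI[OF \<Delta> _ _ V(1)])
    note nn = nn[OF x]
    show "0 \<le> f x w" for w using nn by (simp add: f_def)
    have "{w. x w \<noteq> 0} \<in> stellar \<Delta> \<sigma> v" using x by (simp add: underlying_space_def)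
    then consider "{w. x w \<noteq> 0} \<in> \<Delta>"
      | \<rho> where "{w. x w \<noteq> 0} = insert v \<rho>" "\<rho> \<union> \<sigma> \<in> \<Delta>"
      by (auto simp: stellar_def)
    then show supp: "{w. f x w \<noteq> 0} \<in> \<Delta>"
    proof cases
      case 1
      then have "x v = 0" using v by blast
      then have "f x = x" by (auto simp: f_def)
      then show ?thesis using 1 by simp
    next
      case 2
      then have xv: "x v > 0" using nn[of v] by force
      have vr: "v \<notin> \<rho>" using 2(2) v by blast
      have pos: "x w + x v / card \<sigma> \<noteq> 0" for w
        using nn[of w] xv c0 by (metis add_nonneg_pos divide_pos_pos of_nat_0_less_iff less_irrefl)
      have "w \<in> \<rho> \<longleftrightarrow> w \<noteq> v \<and> x w \<noteq> 0" for w using 2(1) vr by auto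
      then have "{w. f x w \<noteq> 0} = \<rho> \<union> \<sigma>" using v\<sigma> vr pos by (auto simp: f_def)
      then show ?thesis using 2 by simp
    qed
    show "{w. f x w \<noteq> 0} \<subseteq> V" using supp by (auto simp: V_def)
    have "f x w = (if w \<in> V - {v} then x w else 0) + (if w \<in> \<sigma> then x v / card \<sigma> else 0)" if "w \<in> V" for w
      using v\<sigma> that by (auto simp: f_def)
    then have "sum (f x) V = (\<Sum>w\<in>V. if w \<in> V - {v} then x w else 0) + (\<Sum>w\<in>V. if w \<in> \<sigma> then x v / card \<sigma> else 0)"
      by (simp add: sum.distrib)
    also have "(\<Sum>w\<in>V. if w \<in> V - {v} then x w else 0) = sum x (V - {v})"
      by (subst sum.inter_restrict[symmetric, OF V(1)]) (rule arg_cong2[where f=sum], auto)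
    also have "sum x (V - {v}) + (\<Sum>w\<in>V. if w \<in> \<sigma> then x v / card \<sigma> else 0) = sum x V"
      using c0 V by (simp add: sum\<sigma> sum.remove[of V v])
    also have "\<dots> = 1" by (rule underlying_space_sum[OF st x V(1) suppV[OF x]])
    finally show "sum (f x) V = 1" .
  qed
  have g_in: "g y \<in> underlying_space (stellar \<Delta> \<sigma> v)" if y: "y \<in> underlying_space \<Delta>" for y
  proof (rule underlying_spaceI[OF st _ _ V(1)])
    note nn = nn[OF y]
    have mle: "m y \<le> y w" if "w \<in> \<sigma>" for w unfolding m_def using fin\<sigma> that by simp
    have "m y \<in> y ` \<sigma>" unfolding m_def using fin\<sigma> ne\<sigma> by (intro Min_in) auto
    then obtain w0 where w0: "w0 \<in> \<sigma>" "y w0 = m y" by auto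
    then have m0: "0 \<le> m y" using nn[of w0] by simp
    show "0 \<le> g y w" for w using nn m0 mle by (simp add: g_def)
    have yv: "y v = 0" using y v by (auto simp: underlying_space_def)
    have supp: "{w. y w \<noteq> 0} \<in> \<Delta>" using y by (simp add: underlying_space_def)
    show sg: "{w. g y w \<noteq> 0} \<in> stellar \<Delta> \<sigma> v"
    proof (cases "m y = 0")
      case True
      then have "g y = y" using yv by (auto simp: g_def)
      moreover have "\<not> \<sigma> \<subseteq> {w. y w \<noteq> 0}" using w0 True by auto
      ultimately show ?thesis using supp by (simp add: stellar_def)
    next
      case False
      then have mp: "m y > 0" using m0 by simp
      \<comment> \<open>The vertices of \<open>\<sigma>\<close> at which the minimum is attained
        lose their coordinate. There is at least one, so \<open>\<rho>\<close> does not contain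
        \<open>\<sigma>\<close>.\<close>
      define \<rho> where "\<rho> = {w. y w \<noteq> 0} - {w\<in>\<sigma>. y w = m y}"
      have ypos: "y w \<noteq> 0" if "w \<in> \<sigma>" for w using mle[OF that] mp by simp
      then have "\<sigma> \<subseteq> {w. y w \<noteq> 0}" by auto
      then have "\<rho> \<union> \<sigma> = {w. y w \<noteq> 0}" by (auto simp: \<rho>_def)
      moreover have "\<not> \<sigma> \<subseteq> \<rho>" using w0 by (auto simp: \<rho>_def)
      moreover have "{w. g y w \<noteq> 0} = insert v \<rho>"
        using mp c0 v\<sigma> ypos yv by (auto simp: g_def \<rho>_def)
      ultimately show ?thesis using supp unfolding stellar_def by auto
    qed
    show "{w. g y w \<noteq> 0} \<subseteq> V" using sg by (auto simp: stellar_def V_def)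
    \<comment> \<open>The correction has total 0: \<open>card \<sigma> * m y\<close> is gained at
      \<open>v\<close>, and \<open>m y\<close> is lost at each vertex of
      \<open>\<sigma>\<close>.\<close>
    have "g y w = y w + ((if w = v then card \<sigma> * m y else 0) - (if w \<in> \<sigma> then m y else 0))" for w
      using v\<sigma> yv by (auto simp: g_def)
    then have "sum (g y) V = sum y V"
      using V by (simp add: sum.distrib sum_subtractf sum\<sigma>)
    then show "sum (g y) V = 1" using underlying_space_sum[OF \<Delta> y V(1) suppV'[OF y]] by simp
  qed
  have gf: "g (f x) = x" if x: "x \<in> underlying_space (stellar \<Delta> \<sigma> v)" for x
  proof -
    note nn = nn[OF x]
    obtain w0 where w0: "w0 \<in> \<sigma>" "x w0 = 0" using zero[OF x] by auto
    have "f x ` \<sigma> = (\<lambda>w. x w + x v / card \<sigma>) ` \<sigma>"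
      using v\<sigma> by (intro image_cong) (auto simp: f_def)
    moreover have "Min ((\<lambda>w. x w + x v / card \<sigma>) ` \<sigma>) = x v / card \<sigma>"
      using fin\<sigma> w0 nn by (intro Min_eqI) (auto intro!: rev_image_eqI)
    ultimately have "m (f x) = x v / card \<sigma>" by (simp add: m_def)
    then show ?thesis using v\<sigma> c0 by (auto simp: g_def f_def)
  qed
  have fg: "f (g y) = y" if y: "y \<in> underlying_space \<Delta>" for y
  proof -
    have "y v = 0" using y v by (auto simp: underlying_space_def)
    then show ?thesis using v\<sigma> c0 by (auto simp: g_def f_def)
  qed
  have coord: "continuous_on S (\<lambda>x :: 'a \<Rightarrow> real. x w)" for S w
    by (rule continuous_on_subset[OF continuous_on_product_coordinates]) simp
  have "continuous_on S f" for S
    unfolding f_def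
  proof (rule continuous_on_coordinatewise_then_product)
    fix w show "continuous_on S (\<lambda>x :: 'a \<Rightarrow> real. if w = v then 0 else x w + (if w \<in> \<sigma> then x v / card \<sigma> else 0))"
      using c0 by (cases "w = v"; cases "w \<in> \<sigma>") (auto intro!: continuous_intros coord)
  qed
  moreover have "continuous_on S g" for S
    unfolding g_def
  proof (rule continuous_on_coordinatewise_then_product)
    have m: "continuous_on S m" unfolding m_def by (rule continuous_on_Min_coordinates[OF fin\<sigma> ne\<sigma>])
    fix w show "continuous_on S (\<lambda>y :: 'a \<Rightarrow> real. if w = v then card \<sigma> * m y else if w \<in> \<sigma> then y w - m y else y w)"
      by (cases "w = v"; cases "w \<in> \<sigma>") (auto intro!: continuous_intros coord m)
  qed
  ultimately have "homeomorphic_maps (polyhedron (stellar \<Delta> \<sigma> v)) (polyhedron \<Delta>) f g"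
    using f_in g_in gf fg unfolding homeomorphic_maps_def by auto
  then show ?thesis by (auto simp: homeomorphic_space_def)
qed

section \<open>Starring expressed on generating faces\<close>

definition generated_complex :: "'v set set \<Rightarrow> 'v set set" where
  "generated_complex M = {\<tau>. \<tau> \<noteq> {} \<and> (\<exists>\<sigma>\<in>M. \<tau> \<subseteq> \<sigma>)}"

lemma finite_complex_generated:
  assumes "finite M" "\<And>\<sigma>. \<sigma> \<in> M \<Longrightarrow> finite \<sigma>"
  shows "finite_complex (generated_complex M)"
proof -
  have "generated_complex M \<subseteq> (\<Union>\<sigma>\<in>M. Pow \<sigma>)" by (auto simp: generated_complex_def)
  moreover have "finite (\<Union>\<sigma>\<in>M. Pow \<sigma>)" using assms by auto
  ultimately have "finite (generated_complex M)" by (rule finite_subset)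
  then show ?thesis
    using assms(2) unfolding finite_complex_def generated_complex_def
    by (auto intro: finite_subset) (meson subset_trans)
qed

lemma vertices_generated_complex [simp]: "vertices (generated_complex M) = \<Union>M"
proof
  show "\<Union>M \<subseteq> vertices (generated_complex M)"
  proof
    fix v assume "v \<in> \<Union>M"
    then have "{v} \<in> generated_complex M" by (auto simp: generated_complex_def)
    then show "v \<in> vertices (generated_complex M)" by blast
  qed
qed (auto simp: generated_complex_def)

text \<open>A face that does not contain \<open>\<sigma>\<close> omits some \<open>w\<close> of it,
  and so survives in the piece \<open>insert v (\<tau> - {w})\<close> of every generating face
  \<open>\<tau>\<close> around it. Subdivisions can thus be computed on lists of triangles
  alone.\<close>

lemma stellar_generated_complex:
  assumes "\<sigma> \<noteq> {}" "v \<notin> \<Union>M"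
  shows "stellar (generated_complex M) \<sigma> v =
    generated_complex ({\<tau>\<in>M. \<not> \<sigma> \<subseteq> \<tau>} \<union> (\<Union>\<tau>\<in>{\<tau>\<in>M. \<sigma> \<subseteq> \<tau>}. (\<lambda>w. insert v (\<tau> - {w})) ` \<sigma>))"
    (is "?L = generated_complex (?A \<union> ?B)")
proof (intro set_eqI iffI)
  fix \<tau> assume "\<tau> \<in> ?L"
  then consider "\<tau> \<in> generated_complex M" "\<not> \<sigma> \<subseteq> \<tau>"
    | \<rho> where "\<tau> = insert v \<rho>" "\<rho> \<union> \<sigma> \<in> generated_complex M" "\<not> \<sigma> \<subseteq> \<rho>"
    by (auto simp: stellar_def)
  then show "\<tau> \<in> generated_complex (?A \<union> ?B)"
  proof cases
    case 1
    then obtain \<phi> where \<phi>: "\<phi> \<in> M" "\<tau> \<subseteq> \<phi>" "\<tau> \<noteq> {}" by (auto simp: generated_complex_def)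
    obtain w where w: "w \<in> \<sigma>" "w \<notin> \<tau>" using 1 by auto
    show ?thesis
    proof (cases "\<sigma> \<subseteq> \<phi>")
      case True
      then have "insert v (\<phi> - {w}) \<in> ?A \<union> ?B" using \<phi>(1) w(1) by blast
      moreover have "\<tau> \<subseteq> insert v (\<phi> - {w})" using \<phi>(2) w(2) by blast
      ultimately show ?thesis using \<phi>(3) unfolding generated_complex_def mem_Collect_eq by (intro conjI bexI)
    next
      case False
      then show ?thesis using \<phi> by (auto simp: generated_complex_def)
    qed
  next
    case 2
    then obtain \<phi> w where \<phi>: "\<phi> \<in> M" "\<rho> \<union> \<sigma> \<subseteq> \<phi>" and w: "w \<in> \<sigma>" "w \<notin> \<rho>"
      by (auto simp: generated_complex_def)
    then have "insert v (\<phi> - {w}) \<in> ?A \<union> ?B" by blast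
    moreover have "\<tau> \<subseteq> insert v (\<phi> - {w})" using 2(1) \<phi>(2) w(2) by blast
    ultimately show ?thesis using 2(1) unfolding generated_complex_def mem_Collect_eq by (intro conjI bexI) auto
  qed
next
  fix \<tau> assume "\<tau> \<in> generated_complex (?A \<union> ?B)"
  then have ne: "\<tau> \<noteq> {}" and "\<exists>\<phi>\<in>?A \<union> ?B. \<tau> \<subseteq> \<phi>" by (auto simp: generated_complex_def)
  then consider \<phi> where "\<phi> \<in> M" "\<not> \<sigma> \<subseteq> \<phi>" "\<tau> \<subseteq> \<phi>"
    | \<phi> w where "\<phi> \<in> M" "\<sigma> \<subseteq> \<phi>" "w \<in> \<sigma>" "\<tau> \<subseteq> insert v (\<phi> - {w})" by blast
  then show "\<tau> \<in> ?L"
  proof cases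
    case 1
    then show ?thesis using ne by (auto simp: stellar_def generated_complex_def)
  next
    case 2
    show ?thesis
    proof (cases "v \<in> \<tau>")
      case True
      then have "\<tau> = insert v (\<tau> - {v})" by blast
      moreover have "\<tau> - {v} \<union> \<sigma> \<subseteq> \<phi>" using 2(2,4) by blast
      then have "\<tau> - {v} \<union> \<sigma> \<in> generated_complex M"
        using 2(1) assms(1) unfolding generated_complex_def by blast
      moreover have "\<not> \<sigma> \<subseteq> \<tau> - {v}" using 2 assms(2) by blast
      ultimately show ?thesis unfolding stellar_def by blast
    next
      case False
      then have "\<tau> \<subseteq> \<phi> - {w}" using 2(4) by blast
      then have "\<tau> \<in> generated_complex M" "\<not> \<sigma> \<subseteq> \<tau>"
        using ne 2(1,3) unfolding generated_complex_def by blast+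
      then show ?thesis by (simp add: stellar_def)
    qed
  qed
qed

section \<open>Bistellar flips on lists of triangles\<close>

fun corners :: "'v \<times> 'v \<times> 'v \<Rightarrow> 'v set" where
  "corners (a, b, c) = {a, b, c}"

definition list_complex :: "('v \<times> 'v \<times> 'v) list \<Rightarrow> 'v set set" where
  "list_complex ts = generated_complex (corners ` set ts)"

lemma finite_corners [simp]: "finite (corners t)"
  by (cases t) auto

lemma finite_complex_list_complex: "finite_complex (list_complex ts)"
  unfolding list_complex_def by (rule finite_complex_generated) auto

text \<open>Starring \<open>{a, b}\<close> on one side and \<open>{c, d}\<close> on the other from
  the same fresh vertex yields the same four triangles. The conditions on \<open>R\<close> say that
  no further triangle contains the old edge and that the new edge is not yet present. The infinite
  type supplies the fresh vertex.\<close>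

lemma flip_homeomorphic:
  fixes R :: "'v set set"
  assumes inf: "infinite (UNIV :: 'v set)" and R: "finite R" "\<And>\<tau>. \<tau> \<in> R \<Longrightarrow> finite \<tau>"
    and d: "distinct [a, b, c, d]"
    and ab: "\<And>\<tau>. \<tau> \<in> R \<Longrightarrow> \<not> {a, b} \<subseteq> \<tau>" and cd: "\<And>\<tau>. \<tau> \<in> R \<Longrightarrow> \<not> {c, d} \<subseteq> \<tau>"
  shows "polyhedron (generated_complex ({{a, b, c}, {a, b, d}} \<union> R)) homeomorphic_space
         polyhedron (generated_complex ({{a, c, d}, {b, c, d}} \<union> R))"
    (is "polyhedron (generated_complex ?M) homeomorphic_space
         polyhedron (generated_complex ?N)")
proof -
  have "finite (\<Union>R \<union> {a, b, c, d})" using R by auto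
  then obtain v where v: "v \<notin> \<Union>R \<union> {a, b, c, d}" using inf by (meson ex_new_if_finite)
  have fin: "finite_complex (generated_complex ?M)" "finite_complex (generated_complex ?N)"
    using R by (auto intro!: finite_complex_generated)
  have "{\<tau>\<in>?M. \<not> {a, b} \<subseteq> \<tau>} = R" "{\<tau>\<in>?M. {a, b} \<subseteq> \<tau>} = {{a, b, c}, {a, b, d}}"
    using ab by auto
  moreover have "(\<Union>\<tau>\<in>{{a, b, c}, {a, b, d}}. (\<lambda>w. insert v (\<tau> - {w})) ` {a, b}) =
      {{v, b, c}, {v, a, c}, {v, b, d}, {v, a, d}}"
  proof -
    have "{a, b, c} - {a} = {b, c}" "{a, b, c} - {b} = {a, c}" "{a, b, d} - {a} = {b, d}" "{a, b, d} - {b} = {a, d}"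
      using d by auto
    then show ?thesis by (simp add: insert_commute)
  qed
  ultimately have 1: "stellar (generated_complex ?M) {a, b} v = generated_complex (R \<union> {{v, b, c}, {v, a, c}, {v, b, d}, {v, a, d}})"
    using stellar_generated_complex[of "{a, b}" v ?M] v by auto
  have "{\<tau>\<in>?N. \<not> {c, d} \<subseteq> \<tau>} = R" "{\<tau>\<in>?N. {c, d} \<subseteq> \<tau>} = {{a, c, d}, {b, c, d}}"
    using cd by auto
  moreover have "(\<Union>\<tau>\<in>{{a, c, d}, {b, c, d}}. (\<lambda>w. insert v (\<tau> - {w})) ` {c, d}) =
      {{v, b, c}, {v, a, c}, {v, b, d}, {v, a, d}}"
  proof -
    have "{a, c, d} - {c} = {a, d}" "{a, c, d} - {d} = {a, c}" "{b, c, d} - {c} = {b, d}" "{b, c, d} - {d} = {b, c}"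
      using d by auto
    then show ?thesis by (simp add: insert_commute)
  qed
  ultimately have 2: "stellar (generated_complex ?N) {c, d} v = generated_complex (R \<union> {{v, b, c}, {v, a, c}, {v, b, d}, {v, a, d}})"
    using stellar_generated_complex[of "{c, d}" v ?N] v by auto
  have "{a, b} \<in> generated_complex ?M" "{c, d} \<in> generated_complex ?N"
    by (auto simp: generated_complex_def)
  moreover have "v \<notin> vertices (generated_complex ?M)" "v \<notin> vertices (generated_complex ?N)"
    using v by auto
  ultimately show ?thesis
    using stellar_homeomorphic[OF fin(1), of "{a, b}" v] stellar_homeomorphic[OF fin(2), of "{c, d}" v]
    unfolding 1 2 by (meson homeomorphic_space_sym homeomorphic_space_trans)
qed

text \<open>This is the starring of a triangle itself. From left to right it removes a vertex with
  three triangles, from right to left it inserts one; both directions serve as moves.\<close>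

lemma cone_homeomorphic:
  assumes R: "finite R" "\<And>\<tau>. \<tau> \<in> R \<Longrightarrow> finite \<tau>"
    and d: "distinct [a, b, c, v]" and v: "v \<notin> \<Union>R"
    and abc: "\<And>\<tau>. \<tau> \<in> R \<Longrightarrow> \<not> {a, b, c} \<subseteq> \<tau>"
  shows "polyhedron (generated_complex ({{a, b, v}, {b, c, v}, {a, c, v}} \<union> R)) homeomorphic_space
         polyhedron (generated_complex ({{a, b, c}} \<union> R))"
    (is "_ homeomorphic_space polyhedron (generated_complex ?M)")
proof -
  have fin: "finite_complex (generated_complex ?M)"
    using R by (auto intro!: finite_complex_generated)
  have "{\<tau>\<in>?M. \<not> {a, b, c} \<subseteq> \<tau>} = R" "{\<tau>\<in>?M. {a, b, c} \<subseteq> \<tau>} = {{a, b, c}}"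
    using abc by auto
  moreover have "(\<Union>\<tau>\<in>{{a, b, c}}. (\<lambda>w. insert v (\<tau> - {w})) ` {a, b, c}) = {{a, b, v}, {b, c, v}, {a, c, v}}"
  proof -
    have "{a, b, c} - {a} = {b, c}" "{a, b, c} - {b} = {a, c}" "{a, b, c} - {c} = {a, b}"
      using d by auto
    then show ?thesis by (simp add: insert_commute)
  qed
  ultimately have "stellar (generated_complex ?M) {a, b, c} v = generated_complex (R \<union> {{a, b, v}, {b, c, v}, {a, c, v}})"
    using stellar_generated_complex[of "{a, b, c}" v ?M] v d by auto
  moreover have "{a, b, c} \<in> generated_complex ?M" by (auto simp: generated_complex_def)
  moreover have "v \<notin> vertices (generated_complex ?M)" using v d by auto
  ultimately show ?thesis
    using stellar_homeomorphic[OF fin, of "{a, b, c}" v] by (simp add: Un_commute)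
qed

section \<open>A triangulated quotient of the 16-gon\<close>

text \<open>
  The boundary circle is divided into 48 segments, three for each side of the 16-gon, with endpoints
  \<open>0, \<dots>, 47\<close>.  All corners are glued to the vertex 16, the two inner points of a pair of sides to
  \<open>2 m\<close> and \<open>2 m + 1\<close>.  The center of the disc is the vertex 17, and \<open>18, \<dots>, 65\<close> are the
  vertices of a concentric 48-gon.
\<close>

definition label :: "nat \<Rightarrow> nat" where
  "label k = (let j = k div 3; m = 2 * (j mod 16 div 4) + j mod 2 in
     if k mod 3 = 0 then 16 else if j mod 4 < 2 then 2 * m + k mod 3 - 1 else 2 * m + 2 - k mod 3)"

definition ring :: "nat \<Rightarrow> nat" where
  "ring k = 18 + k mod 48"

definition polygon_triangles :: "(nat \<times> nat \<times> nat) list" where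
  "polygon_triangles = concat (map (\<lambda>k. [(17, ring k, ring (Suc k)), (ring k, label k, label (Suc k)),
     (ring k, ring (Suc k), label (Suc k))]) [0..<48])"

text \<open>
  Barycentric coordinates of the point at distance \<open>r\<close> from the center and at the angle
  \<open>2 \<pi> (k + s) / 48\<close>: for \<open>r \<le> 1 / 2\<close> in the cone over the 48-gon, and
  for \<open>r \<ge> 1 / 2\<close> in a quadrangle divided by the diagonal from \<open>ring k\<close> to \<open>label (Suc k)\<close>.
\<close>

definition disc_coords :: "nat \<Rightarrow> real \<Rightarrow> real \<Rightarrow> nat \<Rightarrow> real" where
  "disc_coords k r s w =
     (if w = 17 then 1 - min 1 (2 * r) else 0) +
     (if w = ring k then min 1 (2 * r) * (1 - max (max 0 (2 * r - 1)) s) else 0) +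
     (if w = ring (Suc k) then min 1 (2 * r) * max (s - max 0 (2 * r - 1)) 0 else 0) +
     (if w = label k then min 1 (2 * r) * max (max 0 (2 * r - 1) - s) 0 else 0) +
     (if w = label (Suc k) then min 1 (2 * r) * min (max 0 (2 * r - 1)) s else 0)"

definition disc_point :: "nat \<Rightarrow> real \<Rightarrow> real \<Rightarrow> complex" where
  "disc_point k r s = r * cis (2 * pi * (k + s) / 48)"

text \<open>A disjoint union of 48 compact rectangles that maps onto the disc and onto the complex.
  Both are compared through it, since the sectors overlap only along their boundaries.\<close>

definition disc_params :: "(nat \<times> real \<times> real) set" where
  "disc_params = {..<48} \<times> {0..1} \<times> {0..1}"

section \<open>Labels on the boundary of the polygon\<close>

lemma label_properties:
  "list_all (\<lambda>k. label k < 17 \<and> label (Suc k) < 17 \<and> label k \<noteq> label (Suc k)) [0..<48]"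
  by code_simp

text \<open>The sides \<open>j\<close> and \<open>j + 2\<close> are glued with opposite directions:
  segment \<open>3 * j + i\<close> meets segment \<open>3 * j + 8 - i\<close> with its ends
  exchanged. The list contains the first side of each glued pair.\<close>

lemma label_pairing:
  "list_all (\<lambda>j. list_all (\<lambda>i. label (3 * j + 8 - i) = label (3 * j + i + 1) \<and>
     label (3 * j + 9 - i) = label (3 * j + i)) [0..<3]) [0,1,4,5,8,9,12,13]"
  by code_simp

definition label_table :: "(nat \<times> nat \<times> nat) list" where
  "label_table = map (\<lambda>k. (k, label k, label (Suc k))) [0..<48]"

text \<open>Reversed gluing keeps the sum of two positions constant: it is \<open>6 * j + 9\<close>
  for glued subdivision points and \<open>6 * j + 8\<close> for the indices of glued segments. The
  parameter \<open>c\<close> selects between the two, and \<open>j\<close> is the side of the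
  smaller index.\<close>

fun paired_sides :: "nat \<Rightarrow> nat \<Rightarrow> nat \<Rightarrow> bool" where
  "paired_sides c k l = (let j = (if k < l then k else l) div 3 in
     if k + l = 6 * j + c then j mod 4 < 2 else False)"

text \<open>The converse of the gluing: labels coincide only where the side pairing forces it. The
  clauses treat points, segments read in the same direction, and segments read in opposite
  directions.\<close>

fun label_check :: "nat \<times> nat \<times> nat \<Rightarrow> nat \<times> nat \<times> nat \<Rightarrow> bool" where
  "label_check (k, a, b) (l, c, d) =
     ((if a = c then if k = l then True else if a = 16 then k mod 3 = 0 \<and> l mod 3 = 0 else paired_sides 9 k l else True) \<and>
      (if a = c then if b = d then k = l else True else True) \<and>
      (if a = d then if b = c then paired_sides 8 k l else True else True))"

text \<open>The labels are evaluated once here, so that the check of all pairs works on literal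
  numbers.\<close>

lemma label_table_eq: "label_table =
  [(0, 16, 0), (1, 0, 1), (2, 1, 16), (3, 16, 2), (4, 2, 3), (5, 3, 16), (6, 16, 1), (7, 1, 0), (8, 0, 16), (9, 16, 3), (10, 3, 2), (11, 2, 16), (12, 16, 4), (13, 4, 5), (14, 5, 16), (15, 16, 6), (16, 6, 7), (17, 7, 16), (18, 16, 5), (19, 5, 4), (20, 4, 16), (21, 16, 7), (22, 7, 6), (23, 6, 16), (24, 16, 8), (25, 8, 9), (26, 9, 16), (27, 16, 10), (28, 10, 11), (29, 11, 16), (30, 16, 9), (31, 9, 8), (32, 8, 16), (33, 16, 11), (34, 11, 10), (35, 10, 16), (36, 16, 12), (37, 12, 13), (38, 13, 16), (39, 16, 14), (40, 14, 15), (41, 15, 16), (42, 16, 13), (43, 13, 12), (44, 12, 16), (45, 16, 15), (46, 15, 14), (47, 14, 16)]"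
  by code_simp

lemma label_table_check: "list_all (\<lambda>p. list_all (label_check p) label_table) label_table"
  unfolding label_table_eq by code_simp

lemma label_checkD:
  assumes "k < 48" "l < 48"
  shows "label_check (k, label k, label (Suc k)) (l, label l, label (Suc l))"
proof -
  have "(k, label k, label (Suc k)) \<in> set label_table" if "k < 48" for k
    unfolding label_table_def set_map set_upt by (rule image_eqI[OF refl]) (use that in simp)
  then show ?thesis using label_table_check assms unfolding list_all_iff by blast
qed

lemma label_less: "k < 48 \<Longrightarrow> label k < 17" "k < 48 \<Longrightarrow> label (Suc k) < 17"
  and label_neq_Suc: "k < 48 \<Longrightarrow> label k \<noteq> label (Suc k)"
  using label_properties unfolding list_all_iff by auto

lemma label_48: "label 48 = label 0"
  by code_simp

lemma ring_bounds: "18 \<le> ring k" "ring k < 66"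
  by (auto simp: ring_def)

lemma ring_eq_iff: "ring k = ring l \<longleftrightarrow> k mod 48 = l mod 48"
  by (simp add: ring_def)

lemma ring_neq_Suc: "k < 48 \<Longrightarrow> ring k \<noteq> ring (Suc k)"
  by (simp add: ring_eq_iff mod_Suc)

lemma vertices_distinct:
  assumes "k < 48"
  shows "label k \<noteq> 17" "label (Suc k) \<noteq> 17" "ring l \<noteq> 17" "17 \<noteq> ring l"
    "17 \<noteq> label k" "17 \<noteq> label (Suc k)"
    "label k \<noteq> ring l" "label (Suc k) \<noteq> ring l" "ring l \<noteq> label k" "ring l \<noteq> label (Suc k)"
  using label_less[OF assms] ring_bounds[of l] by auto

section \<open>Barycentric coordinates of points of the disc\<close>

lemma disc_coords_center: "k < 48 \<Longrightarrow> disc_coords k r s 17 = 1 - min 1 (2 * r)"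
  by (simp add: disc_coords_def vertices_distinct)

lemma disc_coords_ring:
  "k < 48 \<Longrightarrow> disc_coords k r s (ring l) =
     (if l mod 48 = k then min 1 (2 * r) * (1 - max (max 0 (2 * r - 1)) s) else 0) +
     (if l mod 48 = Suc k mod 48 then min 1 (2 * r) * max (s - max 0 (2 * r - 1)) 0 else 0)"
  by (simp add: disc_coords_def vertices_distinct ring_eq_iff)

lemma disc_coords_label:
  assumes "k < 48"
  shows "disc_coords k r s (label k) = min 1 (2 * r) * max (max 0 (2 * r - 1) - s) 0"
    and "disc_coords k r s (label (Suc k)) = min 1 (2 * r) * min (max 0 (2 * r - 1)) s"
  using label_neq_Suc[OF assms] assms by (auto simp: disc_coords_def vertices_distinct)

text \<open>Glued labels cannot tell the sectors apart, but their total weight does not depend on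
  \<open>k\<close> and \<open>s\<close>. Together with the coordinate of the center it determines
  \<open>r\<close>.\<close>

lemma disc_coords_label_sum:
  assumes "k < 48" "0 \<le> s"
  shows "(\<Sum>w<17. disc_coords k r s w) = min 1 (2 * r) * max 0 (2 * r - 1)"
proof -
  have "(\<Sum>w<17. disc_coords k r s w) =
      (\<Sum>w<17. if w = label k then min 1 (2 * r) * max (max 0 (2 * r - 1) - s) 0 else 0) +
      (\<Sum>w<17. if w = label (Suc k) then min 1 (2 * r) * min (max 0 (2 * r - 1)) s else 0)"
    unfolding sum.distrib[symmetric]
  proof (rule sum.cong)
    fix w :: nat assume "w \<in> {..<17}"
    then show "disc_coords k r s w =
      (if w = label k then min 1 (2 * r) * max (max 0 (2 * r - 1) - s) 0 else 0) +
      (if w = label (Suc k) then min 1 (2 * r) * min (max 0 (2 * r - 1)) s else 0)"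
      using ring_bounds(1)[of k] ring_bounds(1)[of "Suc k"] by (auto simp: disc_coords_def)
  qed simp
  also have "\<dots> = min 1 (2 * r) * (max (max 0 (2 * r - 1) - s) 0 + min (max 0 (2 * r - 1)) s)"
    using label_less[OF assms(1)] by (simp add: algebra_simps)
  also have "max (max 0 (2 * r - 1) - s) 0 + min (max 0 (2 * r - 1)) s = max 0 (2 * r - 1)"
    using assms(2) by (auto simp: max_def min_def)
  finally show ?thesis .
qed

lemma disc_coords_sum:
  assumes "k < 48" "0 \<le> s"
  shows "(\<Sum>w<66. disc_coords k r s w) = 1"
proof -
  have "(\<Sum>w<66. disc_coords k r s w) = (1 - min 1 (2 * r)) +
     min 1 (2 * r) * (1 - max (max 0 (2 * r - 1)) s) +
     min 1 (2 * r) * max (s - max 0 (2 * r - 1)) 0 +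
     min 1 (2 * r) * max (max 0 (2 * r - 1) - s) 0 +
     min 1 (2 * r) * min (max 0 (2 * r - 1)) s"
    using label_less[OF assms(1)] ring_bounds[of k] ring_bounds[of "Suc k"]
    by (simp add: disc_coords_def sum.distrib)
  also have "\<dots> = 1 - min 1 (2 * r) + min 1 (2 * r) *
     ((1 - max (max 0 (2 * r - 1)) s) + max (s - max 0 (2 * r - 1)) 0 +
      max (max 0 (2 * r - 1) - s) 0 + min (max 0 (2 * r - 1)) s)"
    by (simp add: algebra_simps)
  also have "(1 - max (max 0 (2 * r - 1)) s) + max (s - max 0 (2 * r - 1)) 0 +
      max (max 0 (2 * r - 1) - s) 0 + min (max 0 (2 * r - 1)) s = 1"
    using assms(2) by (auto simp: max_def min_def)
  finally show ?thesis by simp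
qed

lemma polygon_complex_iff:
  "\<tau> \<in> list_complex polygon_triangles \<longleftrightarrow> \<tau> \<noteq> {} \<and>
    (\<exists>k<48. \<tau> \<subseteq> {17, ring k, ring (Suc k)} \<or> \<tau> \<subseteq> {ring k, label k, label (Suc k)} \<or>
      \<tau> \<subseteq> {ring k, ring (Suc k), label (Suc k)})"
  unfolding list_complex_def generated_complex_def polygon_triangles_def
  by (simp add: image_UN Bex_def) blast

lemma disc_coords_in_space:
  assumes "k < 48" "0 \<le> r" "r \<le> 1" "0 \<le> s" "s \<le> 1"
  shows "disc_coords k r s \<in> underlying_space (list_complex polygon_triangles)"
proof (rule underlying_spaceI[OF finite_complex_list_complex, where A = "{..<66}"])
  show "0 \<le> disc_coords k r s w" for w
    using assms unfolding disc_coords_def by (intro add_nonneg_nonneg) auto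
  have ne: "{w. disc_coords k r s w \<noteq> 0} \<noteq> {}"
    using disc_coords_sum[OF assms(1,4), of r] by (metis (mono_tags, lifting) empty_Collect_eq sum.neutral zero_neq_one)
  have "{w. disc_coords k r s w \<noteq> 0} \<subseteq> {17, ring k, ring (Suc k)} \<or>
    {w. disc_coords k r s w \<noteq> 0} \<subseteq> {ring k, label k, label (Suc k)} \<or>
    {w. disc_coords k r s w \<noteq> 0} \<subseteq> {ring k, ring (Suc k), label (Suc k)}"
  proof -
    \<comment> \<open>These ranges are the three triangles of sector \<open>k\<close>: the one at
      the center, and the two halves of the outer quadrangle, separated by the diagonal
      \<open>s = 2 * r - 1\<close>.\<close>
    consider "2 * r \<le> 1" | "2 * r > 1" "s \<le> 2 * r - 1" | "2 * r > 1" "s > 2 * r - 1" by linarith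
    then show ?thesis
    proof cases
      case 1
      then have "max 0 (2 * r - 1) = 0" "max (0 - s) 0 = 0" "min 0 s = 0" using assms by auto
      then have "disc_coords k r s w = 0" if "w \<notin> {17, ring k, ring (Suc k)}" for w
        using that by (simp add: disc_coords_def)
      then show ?thesis by blast
    next
      case 2
      then have "min 1 (2 * r) = 1" "max 0 (2 * r - 1) = 2 * r - 1" "max (s - (2 * r - 1)) 0 = 0" by auto
      then have "disc_coords k r s w = 0" if "w \<notin> {ring k, label k, label (Suc k)}" for w
        using that by (simp add: disc_coords_def)
      then show ?thesis by blast
    next
      case 3
      then have "min 1 (2 * r) = 1" "max 0 (2 * r - 1) = 2 * r - 1" "max (2 * r - 1 - s) 0 = 0" by auto
      then have "disc_coords k r s w = 0" if "w \<notin> {ring k, ring (Suc k), label (Suc k)}" for w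
        using that by (simp add: disc_coords_def)
      then show ?thesis by blast
    qed
  qed
  then show "{w. disc_coords k r s w \<noteq> 0} \<in> list_complex polygon_triangles"
    using ne assms(1) unfolding polygon_complex_iff by blast
  have "disc_coords k r s w = 0" if "\<not> w < 66" for w
    using that label_less[OF assms(1)] ring_bounds[of k] ring_bounds[of "Suc k"]
    by (simp add: disc_coords_def)
  then show "{w. disc_coords k r s w \<noteq> 0} \<subseteq> {..<66}" by blast
  show "(\<Sum>w<66. disc_coords k r s w) = 1" by (rule disc_coords_sum[OF assms(1,4)])
qed auto

lemma disc_coords_surj:
  assumes "x \<in> underlying_space (list_complex polygon_triangles)"
  shows "\<exists>k r s. k < 48 \<and> 0 \<le> r \<and> r \<le> 1 \<and> 0 \<le> s \<and> s \<le> 1 \<and> disc_coords k r s = x"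
proof -
  have nn: "0 \<le> x w" for w using assms by (simp add: underlying_space_def)
  have "{w. x w \<noteq> 0} \<in> list_complex polygon_triangles" using assms by (simp add: underlying_space_def)
  then obtain k where k: "k < 48" and supp: "{w. x w \<noteq> 0} \<subseteq> {17, ring k, ring (Suc k)} \<or>
    {w. x w \<noteq> 0} \<subseteq> {ring k, label k, label (Suc k)} \<or> {w. x w \<noteq> 0} \<subseteq> {ring k, ring (Suc k), label (Suc k)}"
    unfolding polygon_complex_iff by blast
  note dist = vertices_distinct[OF k] ring_neq_Suc[OF k] ring_neq_Suc[OF k, symmetric]
    label_neq_Suc[OF k] label_neq_Suc[OF k, symmetric]
  note sum1 = underlying_space_sum[OF finite_complex_list_complex assms]
  from supp consider "{w. x w \<noteq> 0} \<subseteq> {17, ring k, ring (Suc k)}"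
    | "{w. x w \<noteq> 0} \<subseteq> {ring k, label k, label (Suc k)}"
    | "{w. x w \<noteq> 0} \<subseteq> {ring k, ring (Suc k), label (Suc k)}" by blast
  then show ?thesis
  proof cases
    case 1
    then have zero: "x w = 0" if "w \<noteq> 17" "w \<noteq> ring k" "w \<noteq> ring (Suc k)" for w using that by blast
    have sum: "x 17 + x (ring k) + x (ring (Suc k)) = 1"
      using sum1[OF _ 1] by (simp add: dist)
    \<comment> \<open>At the center every angle is admissible; the value 0 is chosen there to avoid
      a division by 0.\<close>
    define s where "s = (if x 17 = 1 then 0 else x (ring (Suc k)) / (1 - x 17))"
    have s: "0 \<le> s" "s \<le> 1" "(1 - x 17) * s = x (ring (Suc k))"
      using sum nn[of "ring k"] nn[of "ring (Suc k)"] nn[of 17] by (auto simp: s_def field_simps)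
    have s': "(1 - x 17) * (1 - s) = x (ring k)" using s(3) sum by (simp add: algebra_simps)
    have h: "0 \<le> 1 - x 17" "1 - x 17 \<le> 1" using sum nn[of "ring k"] nn[of "ring (Suc k)"] nn[of 17] by auto
    define r where "r = (1 - x 17) / 2"
    then have r: "2 * r = 1 - x 17" by simp
    have "disc_coords k r s = x"
    proof
      fix w
      have "min 1 (2 * r) = 1 - x 17" "max 0 (2 * r - 1) = 0" "max 0 s = s" "max (s - 0) 0 = s"
        "max (0 - s) 0 = 0" "min 0 s = 0"
        using h r s by auto
      then show "disc_coords k r s w = x w"
        using s s' zero[of w] unfolding disc_coords_def by (auto simp: dist)
    qed
    moreover have "0 \<le> r" "r \<le> 1" using h r by auto
    ultimately show ?thesis using k s by blast
  next
    case 2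
    then have zero: "x w = 0" if "w \<noteq> label k" "w \<noteq> ring k" "w \<noteq> label (Suc k)" for w using that by blast
    have sum: "x (ring k) + x (label k) + x (label (Suc k)) = 1"
      using sum1[OF _ 2] by (simp add: dist)
    \<comment> \<open>In this triangle \<open>s \<le> \<rho>\<close>, so the ring coordinate is
      \<open>1 - \<rho>\<close> and that of \<open>label (Suc k)\<close> is \<open>s\<close>; the
      parameters are read off backwards.\<close>
    define \<rho> where "\<rho> = 1 - x (ring k)"
    have \<rho>: "0 \<le> \<rho>" "\<rho> \<le> 1" "x (label (Suc k)) \<le> \<rho>" "\<rho> - x (label (Suc k)) = x (label k)"
      using sum nn[of "ring k"] nn[of "label k"] nn[of "label (Suc k)"] by (auto simp: \<rho>_def)
    define r s where "r = (1 + \<rho>) / 2" and "s = x (label (Suc k))"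
    then have r: "2 * r = 1 + \<rho>" by simp
    have s: "0 \<le> s" "s \<le> \<rho>" "\<rho> - s = x (label k)" using \<rho> nn by (simp_all add: s_def)
    have "disc_coords k r s = x"
    proof
      fix w
      have "min 1 (2 * r) = 1" "max 0 (2 * r - 1) = \<rho>" using r \<rho> by auto
      moreover have "max \<rho> s = \<rho>" "max (s - \<rho>) 0 = 0" "max (\<rho> - s) 0 = \<rho> - s" "min \<rho> s = s"
        using s by auto
      ultimately show "disc_coords k r s w = x w"
        using s(3) zero[of w] unfolding disc_coords_def by (auto simp: dist \<rho>_def s_def)
    qed
    moreover have "0 \<le> r" "r \<le> 1" "s \<le> 1" using \<rho> r s by auto
    ultimately show ?thesis using k s by blast
  next
    case 3
    then have zero: "x w = 0" if "w \<noteq> ring (Suc k)" "w \<noteq> ring k" "w \<noteq> label (Suc k)" for w using that by blast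
    have sum: "x (ring k) + x (ring (Suc k)) + x (label (Suc k)) = 1"
      using sum1[OF _ 3] by (simp add: dist)
    \<comment> \<open>Beyond the diagonal the roles are exchanged: maximum and minimum of the two
      parameters are now \<open>s\<close> and \<open>\<rho>\<close>.\<close>
    define \<rho> s where "\<rho> = x (label (Suc k))" and "s = 1 - x (ring k)"
    have \<rho>: "0 \<le> \<rho>" "\<rho> \<le> 1" "\<rho> \<le> s" "s \<le> 1" "s - \<rho> = x (ring (Suc k))"
      using sum nn[of "ring k"] nn[of "ring (Suc k)"] nn[of "label (Suc k)"] by (auto simp: \<rho>_def s_def)
    define r where "r = (1 + \<rho>) / 2"
    then have r: "2 * r = 1 + \<rho>" by simp
    have "disc_coords k r s = x"
    proof
      fix w
      have "min 1 (2 * r) = 1" "max 0 (2 * r - 1) = \<rho>" using r \<rho> by auto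
      moreover have "max \<rho> s = s" "max (s - \<rho>) 0 = s - \<rho>" "max (\<rho> - s) 0 = 0" "min \<rho> s = \<rho>"
        using \<rho> by auto
      ultimately show "disc_coords k r s w = x w"
        using \<rho>(5) zero[of w] unfolding disc_coords_def by (auto simp: dist \<rho>_def s_def)
    qed
    moreover have "0 \<le> r" "r \<le> 1" "0 \<le> s" using \<rho> r by auto
    ultimately show ?thesis using k \<rho> by blast
  qed
qed

text \<open>Neighbouring sectors agree on their common ray. After sector 47 this closes up because
  \<open>ring\<close> is taken modulo 48 and \<open>label 48 = label 0\<close>.\<close>

lemma disc_coords_wrap:
  assumes k: "k < 48" and r: "r \<le> 1"
  shows "disc_coords k r 1 = disc_coords (Suc k mod 48) r 0"
proof
  fix w
  have "label (Suc k mod 48) = label (Suc k)" "ring (Suc k mod 48) = ring (Suc k)"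
    using k label_48 by (cases "k = 47"; simp add: ring_def)+
  moreover have "max (max 0 (2 * r - 1)) 1 = 1" "max (0 - max 0 (2 * r - 1)) 0 = 0"
    "max (max 0 (2 * r - 1) - 1) 0 = 0" "min (max 0 (2 * r - 1)) 1 = max 0 (2 * r - 1)"
    "min (max 0 (2 * r - 1)) 0 = 0" "max (max 0 (2 * r - 1)) 0 = max 0 (2 * r - 1)"
    "max (max 0 (2 * r - 1) - 0) 0 = max 0 (2 * r - 1)" "max (1 - max 0 (2 * r - 1)) 0 = 1 - max 0 (2 * r - 1)"
    using r by auto
  ultimately show "disc_coords k r 1 w = disc_coords (Suc k mod 48) r 0 w"
    by (simp only: disc_coords_def mult_zero_right diff_self if_cancel add_0_right)
qed

lemma disc_point_wrap:
  assumes "k < 48"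
  shows "disc_point k r 1 = disc_point (Suc k mod 48) r 0"
proof (cases "k = 47")
  case True
  then show ?thesis by (simp add: disc_point_def)
next
  case False
  then have "Suc k mod 48 = Suc k" using assms by simp
  then show ?thesis by (simp add: disc_point_def add.commute)
qed

text \<open>With \<open>s < 1\<close> the sector is the integer part of \<open>k + s\<close>, so
  that it can be recovered from the argument of the point.\<close>

lemma disc_params_normal:
  assumes "k < 48" "0 \<le> s" "s \<le> 1" "r \<le> 1"
  obtains l t where "l < 48" "0 \<le> t" "t < 1" "disc_coords l r t = disc_coords k r s"
    "disc_point l r t = disc_point k r s"
proof (cases "s = 1")
  case True
  then show ?thesis
    using that[of "Suc k mod 48" 0] assms disc_coords_wrap[of k r] disc_point_wrap[of k r] by simp
next
  case False
  then show ?thesis using that[of k s] assms by simp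
qed

lemma disc_point_zero [simp]: "disc_point k 0 s = 0"
  by (simp add: disc_point_def)

lemma norm_disc_point: "0 \<le> r \<Longrightarrow> norm (disc_point k r s) = r"
  by (simp add: disc_point_def norm_mult)

lemma Arg2pi_disc_point:
  assumes "k < 48" "0 \<le> s" "s < 1" "0 < r"
  shows "Arg2pi (disc_point k r s) = 2 * pi * (k + s) / 48"
proof (rule Arg2pi_unique)
  show "of_real r * exp (\<i> * of_real (2 * pi * (k + s) / 48)) = disc_point k r s"
    by (simp add: disc_point_def cis_conv_exp)
  have "real k \<le> 47" using assms(1) by simp
  then have "k + s < 48" using assms by linarith
  then show "2 * pi * (k + s) / 48 < 2 * pi" by simp
qed (use assms in auto)

lemma disc_coords_zero: "disc_coords k 0 s = (\<lambda>w. if w = 17 then 1 else 0)"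
  by (rule ext) (simp add: disc_coords_def)

text \<open>The modulus gives \<open>r\<close>, and for \<open>r > 0\<close> the argument gives
  \<open>k + s\<close>. At the origin all sectors have the coordinates of the center. Hence the
  coordinates are a function on the disc.\<close>

lemma disc_coords_cong:
  assumes "k < 48" "0 \<le> r" "r \<le> 1" "0 \<le> s" "s \<le> 1"
    and "k' < 48" "0 \<le> r'" "r' \<le> 1" "0 \<le> s'" "s' \<le> 1"
    and eq: "disc_point k r s = disc_point k' r' s'"
  shows "disc_coords k r s = disc_coords k' r' s'"
proof -
  have r: "r' = r" using eq norm_disc_point[of r k s] norm_disc_point[of r' k' s'] assms by simp
  show ?thesis
  proof (cases "r = 0")
    case True
    then show ?thesis using r by (simp add: disc_coords_zero)
  next
    case False
    obtain l t where l: "l < 48" "0 \<le> t" "t < 1" "disc_coords l r t = disc_coords k r s"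
      "disc_point l r t = disc_point k r s"
      using disc_params_normal[of k s r] assms by blast
    obtain l' t' where l': "l' < 48" "0 \<le> t'" "t' < 1" "disc_coords l' r t' = disc_coords k' r s'"
      "disc_point l' r t' = disc_point k' r s'"
      using disc_params_normal[of k' s' r] assms by blast
    have "disc_point l r t = disc_point l' r t'" using l l' eq r by simp
    then have "2 * pi * (l + t) / 48 = 2 * pi * (l' + t') / 48"
      using Arg2pi_disc_point[of l t r] Arg2pi_disc_point[of l' t' r] l l' False assms by simp
    then have sum: "l + t = l' + t'" by simp
    have "l = l'"
    proof -
      have "\<lfloor>l + t\<rfloor> = int l" "\<lfloor>l' + t'\<rfloor> = int l'" using l l' by (simp_all add: floor_eq_iff)
      then show ?thesis using sum by simp
    qed
    then show ?thesis using sum l(4) l'(4) r by simp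
  qed
qed

section \<open>The glued boundary circle, measured in segments\<close>

definition circle_point :: "real \<Rightarrow> complex" where
  "circle_point t = cis (2 * pi * t / 48)"

lemma disc_point_1: "disc_point k 1 s = circle_point (k + s)"
  by (simp add: disc_point_def circle_point_def)

text \<open>A side has length 3 in these units, so \<open>u = 3 * s\<close>. The positions of two
  paired points add up to \<open>6 * j + 9\<close>, the sum tested by
  \<open>paired_sides\<close>.\<close>

lemma side_pairing_iff:
  "side_pairing 4 x y \<longleftrightarrow> (\<exists>(j::nat) u. j < 16 \<and> j mod 4 < 2 \<and> 0 \<le> u \<and> u \<le> 3 \<and>
     x = circle_point (3 * real j + u) \<and> y = circle_point (3 * real j + 9 - u))" (is "?L \<longleftrightarrow> ?R")
proof
  assume ?L
  then obtain j s where j: "j < 16" "j mod 4 \<in> {0, 1}" and s: "0 \<le> s" "s \<le> 1"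
    and x: "x = side_point 4 j s" and y: "y = side_point 4 (j + 2) (1 - s)"
    unfolding side_pairing_def by auto
  have "x = circle_point (3 * real j + 3 * s)" "y = circle_point (3 * real j + 9 - 3 * s)"
    unfolding x y side_point_def circle_point_def by (rule arg_cong[where f = cis], simp add: field_simps)+
  moreover have "j mod 4 < 2" using j by auto
  ultimately show ?R using j s by (intro exI[of _ j] exI[of _ "3 * s"]) auto
next
  assume ?R
  then obtain j :: nat and u where j: "j < 16" "j mod 4 < 2" and u: "0 \<le> u" "u \<le> 3"
    and x: "x = circle_point (3 * real j + u)" and y: "y = circle_point (3 * real j + 9 - u)" by auto
  have "x = side_point 4 j (u / 3)" "y = side_point 4 (j + 2) (1 - u / 3)"
    unfolding x y side_point_def circle_point_def by (rule arg_cong[where f = cis], simp add: field_simps)+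
  moreover have "j mod 4 \<in> {0, 1}" using j by auto
  ultimately show ?L using j u unfolding side_pairing_def by (intro exI[of _ j] exI[of _ "u / 3"]) auto
qed

lemma disc_coords_boundary:
  assumes "k < 48" "0 \<le> s" "s \<le> 1"
  shows "disc_coords k 1 s w = (if w = label k then 1 - s else 0) + (if w = label (Suc k) then s else 0)"
proof -
  have "max 1 s = 1" "max (s - 1) 0 = 0" "max (1 - s) 0 = 1 - s" "min 1 s = s" using assms by auto
  then show ?thesis by (simp add: disc_coords_def)
qed

text \<open>With \<open>u = i + s\<close> the partner lies in segment \<open>3 * j + 8 - i\<close>
  at parameter \<open>1 - s\<close>. The ends of that segment carry the same two labels in reverse
  order, so the weights match.\<close>

lemma side_pairing_coords:
  assumes "side_pairing 4 x y"
  obtains k s k' s' where "k < 48" "0 \<le> s" "s \<le> 1" "k' < 48" "0 \<le> s'" "s' \<le> 1"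
    "x = disc_point k 1 s" "y = disc_point k' 1 s'" "disc_coords k 1 s = disc_coords k' 1 s'"
proof -
  from assms obtain j :: nat and u where j: "j < 16" "j mod 4 < 2" and u: "0 \<le> u" "u \<le> 3"
    and x: "x = circle_point (3 * real j + u)" and y: "y = circle_point (3 * real j + 9 - u)"
    unfolding side_pairing_iff by blast
  obtain i :: nat and s :: real where i: "i < 3" and s: "0 \<le> s" "s \<le> 1" "u = i + s"
  proof (cases "u = 3")
    \<comment> \<open>The far end of the side belongs to its last segment, with parameter 1;
      rounding down would give the segment 3, which is on the next side.\<close>
    case True
    then show ?thesis using that[of 2 1] by simp
  next
    case False
    define i where "i = nat \<lfloor>u\<rfloor>"
    have "i < 3" using u False unfolding i_def by (simp add: nat_less_iff floor_less_iff)
    moreover have "real i = of_int \<lfloor>u\<rfloor>" using u unfolding i_def by simp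
    then have "0 \<le> u - i" "u - i \<le> 1" by linarith+
    ultimately show ?thesis using that[of i "u - i"] by simp
  qed
  define k k' where "k = 3 * j + i" and "k' = 3 * j + 8 - i"
  have "j = 0 \<or> j = 1 \<or> j = 4 \<or> j = 5 \<or> j = 8 \<or> j = 9 \<or> j = 12 \<or> j = 13"
    using j by presburger
  then have j13: "j \<le> 13" and j': "j \<in> set [0,1,4,5,8,9,12,13]" by auto
  have lab: "label k' = label (Suc k)" "label (Suc k') = label k"
  proof -
    have "i \<in> set [0..<3]" using i by simp
    then have "label (3 * j + 8 - i) = label (3 * j + i + 1)" "label (3 * j + 9 - i) = label (3 * j + i)"
      using label_pairing j' unfolding list_all_iff by blast+
    moreover have "Suc k' = 3 * j + 9 - i" using i by (simp add: k'_def)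
    ultimately show "label k' = label (Suc k)" "label (Suc k') = label k" by (simp_all add: k_def k'_def)
  qed
  have k: "k < 48" "k' < 48" using j13 i by (auto simp: k_def k'_def)
  have "x = disc_point k 1 s" unfolding x disc_point_1 by (simp add: k_def s add.assoc)
  moreover have "real k' = 3 * real j + 8 - real i" using i by (simp add: k'_def of_nat_diff)
  then have "3 * real j + 9 - u = real k' + (1 - s)" using s by simp
  then have "y = disc_point k' 1 (1 - s)" unfolding y disc_point_1 by (simp only:)
  moreover have "disc_coords k 1 s = disc_coords k' 1 (1 - s)"
    using k s by (intro ext) (simp add: disc_coords_boundary lab)
  ultimately show ?thesis using that[of k s k' "1 - s"] k s by simp
qed


text \<open>Within a block of four sides the pairings link the corners in the order 0, 3, 2, 1, 4.
  Corner 4 begins the next block, so the blocks form one chain and all corners are a single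
  class.\<close>

lemma corners_equiv: "n \<le> 16 \<Longrightarrow> equivclp (side_pairing 4) (circle_point 0) (circle_point (3 * real n))"
proof -
  have step: "side_pairing 4 (circle_point (3 * real j + u)) (circle_point (3 * real j + 9 - u))"
    if "j < 16" "j mod 4 < 2" "0 \<le> u" "u \<le> 3" for j u
    using that unfolding side_pairing_iff by blast
  have block: "equivclp (side_pairing 4) (circle_point (3 * real (4 * i))) (circle_point (3 * real (4 * i + m)))"
    if "i < 4" "m \<le> 4" for i m
  proof -
    have s1: "side_pairing 4 (circle_point (3 * real (4 * i))) (circle_point (3 * real (4 * i + 3)))"
      using step[of "4 * i" 0] that by (simp add: algebra_simps)
    have s2: "side_pairing 4 (circle_point (3 * real (4 * i + 1))) (circle_point (3 * real (4 * i + 2)))"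
      using step[of "4 * i" 3] that by (simp add: algebra_simps)
    have s3: "side_pairing 4 (circle_point (3 * real (4 * i + 1))) (circle_point (3 * real (4 * i + 4)))"
      using step[of "4 * i + 1" 0] that by (simp add: algebra_simps mod_Suc)
    have s4: "side_pairing 4 (circle_point (3 * real (4 * i + 2))) (circle_point (3 * real (4 * i + 3)))"
      using step[of "4 * i + 1" 3] that by (simp add: algebra_simps mod_Suc)
    have e3: "equivclp (side_pairing 4) (circle_point (3 * real (4 * i))) (circle_point (3 * real (4 * i + 3)))"
      using s1 by (rule r_into_equivclp)
    have e2: "equivclp (side_pairing 4) (circle_point (3 * real (4 * i))) (circle_point (3 * real (4 * i + 2)))"
      using equivclp_into_equivclp[OF e3 disjI2[OF s4]] .
    have e1: "equivclp (side_pairing 4) (circle_point (3 * real (4 * i))) (circle_point (3 * real (4 * i + 1)))"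
      using equivclp_into_equivclp[OF e2 disjI2[OF s2]] .
    have e4: "equivclp (side_pairing 4) (circle_point (3 * real (4 * i))) (circle_point (3 * real (4 * i + 4)))"
      using equivclp_into_equivclp[OF e1 disjI1[OF s3]] .
    have "m = 0 \<or> m = 1 \<or> m = 2 \<or> m = 3 \<or> m = 4" using that(2) by auto
    then show ?thesis by (elim disjE; simp only: e1 e2 e3 e4 add_0_right equivclp_refl)
  qed
  have blocks: "equivclp (side_pairing 4) (circle_point 0) (circle_point (3 * real (4 * i)))" if "i \<le> 4" for i
    using that
  proof (induction i)
    case (Suc i)
    then have "equivclp (side_pairing 4) (circle_point 0) (circle_point (3 * real (4 * i)))" by simp
    also have "equivclp (side_pairing 4) (circle_point (3 * real (4 * i))) (circle_point (3 * real (4 * i + 4)))"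
      using block[of i 4] Suc.prems by simp
    finally show ?case by (simp add: algebra_simps)
  qed simp
  assume n: "n \<le> 16"
  show ?thesis
  proof (cases "n = 16")
    case True
    then show ?thesis using blocks[of 4] by simp
  next
    case False
    then have "n div 4 < 4" "n = 4 * (n div 4) + n mod 4" "n mod 4 \<le> 4" using n by auto
    then show ?thesis using blocks[of "n div 4"] block[of "n div 4" "n mod 4"] equivclp_trans
      by (metis less_imp_le)
  qed
qed

text \<open>The smaller segment lies on side \<open>j\<close> at offset
  \<open>u = k + s - 3 * j\<close>. The condition on the sum then puts the other point at
  \<open>3 * j + 9 - u\<close>.\<close>

lemma side_pairing_double:
  fixes s :: real
  assumes "paired_sides 8 k l" "k < 48" "l < 48" "0 \<le> s" "s \<le> 1" "k < l"
  shows "side_pairing 4 (circle_point (k + s)) (circle_point (l + (1 - s)))"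
proof -
  define j where "j = k div 3"
  have kl: "k + l = 6 * j + 8" "j mod 4 < 2"
    using assms(1,6) by (simp_all add: Let_def j_def split: if_splits)
  have "real l = 6 * real j + 8 - real k" using arg_cong[OF kl(1), of real] by simp
  moreover have "3 * j \<le> k" "k \<le> 3 * j + 2" by (simp_all add: j_def)
  then have "3 * real j \<le> real k" "real k \<le> 3 * real j + 2" by linarith+
  ultimately have "0 \<le> k + s - 3 * real j" "k + s - 3 * real j \<le> 3"
    "l + (1 - s) = 3 * real j + 9 - (k + s - 3 * real j)" "k + s = 3 * real j + (k + s - 3 * real j)"
    using assms(4,5) by linarith+
  moreover have "j < 16" using assms(2) by (simp add: j_def)
  ultimately show ?thesis unfolding side_pairing_iff using kl(2) by metis
qed

lemma side_pairing_vertex: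
  assumes "paired_sides 9 k l" "k < 48" "l < 48" "k < l"
  shows "side_pairing 4 (circle_point k) (circle_point l)"
proof -
  define j where "j = k div 3"
  have kl: "k + l = 6 * j + 9" "j mod 4 < 2"
    using assms(1,4) by (simp_all add: Let_def j_def split: if_splits)
  have "real l = 6 * real j + 9 - real k" using arg_cong[OF kl(1), of real] by simp
  moreover have "3 * j \<le> k" "k \<le> 3 * j + 2" by (simp_all add: j_def)
  then have "3 * real j \<le> real k" "real k \<le> 3 * real j + 2" by linarith+
  ultimately have "0 \<le> k - 3 * real j" "k - 3 * real j \<le> 3"
    "l = 3 * real j + 9 - (k - 3 * real j)" "k = 3 * real j + (k - 3 * real j)"
    by linarith+
  moreover have "j < 16" using assms(2) by (simp add: j_def)
  ultimately show ?thesis unfolding side_pairing_iff using kl(2) by metis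
qed


text \<open>No identifications arise beyond the prescribed ones. Boundary coordinates reveal one or
  two labels with their weights, and \<open>label_check\<close> lists every pair of positions that
  can share them.\<close>

lemma boundary_coords_imp_equivclp:
  assumes k: "k < 48" "0 \<le> s" "s < 1" and l: "l < 48" "0 \<le> t" "t < 1"
    and eq: "disc_coords k 1 s = disc_coords l 1 t"
  shows "equivclp (side_pairing 4) (disc_point k 1 s) (disc_point l 1 t)"
proof -
  have val: "(if w = label k then 1 - s else 0) + (if w = label (Suc k) then s else 0) =
    (if w = label l then 1 - t else 0) + (if w = label (Suc l) then t else 0)" for w
    using fun_cong[OF eq, of w] k l by (simp add: disc_coords_boundary)
  note neq = label_neq_Suc[OF k(1)] label_neq_Suc[OF l(1)]
  note check = label_checkD[OF k(1) l(1)]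
  show ?thesis
  \<comment> \<open>For \<open>s = 0\<close> the support is one label, that of a subdivision point;
    otherwise it consists of the two ends of a segment.\<close>
  proof (cases "s = 0")
    case True
    have lab: "label k = label l"
      using val[of "label l"] neq l True by (auto split: if_splits)
    then have t: "t = 0" using val[of "label (Suc l)"] neq True by (auto split: if_splits)
    have "k = l \<or> k mod 3 = 0 \<and> l mod 3 = 0 \<or> paired_sides 9 k l"
      using check lab by (auto simp del: paired_sides.simps split: if_splits)
    then consider "k = l" | "k mod 3 = 0" "l mod 3 = 0" | "paired_sides 9 k l" "k < l" | "paired_sides 9 k l" "l < k"
      by linarith
    then have "equivclp (side_pairing 4) (circle_point k) (circle_point l)"
    proof cases
      case 1
      then show ?thesis by simp
    next
      case 2
      then have "real k = 3 * real (k div 3)" "real l = 3 * real (l div 3)"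
        by (metis mult.commute of_nat_mult of_nat_numeral mod_0_imp_dvd dvd_div_mult_self dvd_eq_mod_eq_0)+
      moreover have "k div 3 \<le> 16" "l div 3 \<le> 16" using k l by auto
      ultimately show ?thesis
        using corners_equiv[of "k div 3"] corners_equiv[of "l div 3"]
        by (metis equivclp_sym equivclp_trans)
    next
      case 3
      then show ?thesis using side_pairing_vertex[of k l] k l by blast
    next
      case 4
      then have "paired_sides 9 l k" by (auto simp: Let_def add.commute split: if_splits)
      then show ?thesis using side_pairing_vertex[of l k] k l 4 by (blast intro: equivclp_sym)
    qed
    then show ?thesis by (simp add: disc_point_1 True t)
  next
    case False
    then have t: "t \<noteq> 0"
      using val[of "label l"] val[of "label k"] val[of "label (Suc k)"] neq k l by (auto split: if_splits)
    have "label k \<in> {label l, label (Suc l)}" "label (Suc k) \<in> {label l, label (Suc l)}"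
      using val[of "label k"] val[of "label (Suc k)"] neq k False by (auto split: if_splits)
    then consider "label k = label l" "label (Suc k) = label (Suc l)"
      | "label k = label (Suc l)" "label (Suc k) = label l"
      using neq by auto
    then show ?thesis
    proof cases
      case 1
      then have "k = l" using check by (auto simp del: paired_sides.simps split: if_splits)
      moreover have "s = t" using val[of "label (Suc l)"] 1 neq by (auto split: if_splits)
      ultimately show ?thesis by simp
    next
      case 2
      then have p: "paired_sides 8 k l" using check by (auto simp del: paired_sides.simps split: if_splits)
      have st: "t = 1 - s" using val[of "label k"] 2 neq by (auto split: if_splits)
      have "k \<noteq> l" using 2 neq by auto
      then consider "k < l" | "l < k" by linarith
      then show ?thesis
      proof cases
        case 1
        then show ?thesis using side_pairing_double[OF p k(1) l(1) k(2) _ 1] k st by (auto simp: disc_point_1)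
      next
        case 2
        then have "paired_sides 8 l k" using p by (auto simp: Let_def add.commute split: if_splits)
        then have "side_pairing 4 (circle_point (l + t)) (circle_point (k + s))"
          using side_pairing_double[OF _ l(1) k(1) l(2) _ 2] l st by (auto simp: disc_point_1)
        then show ?thesis by (auto simp: disc_point_1 intro: equivclp_sym)
      qed
    qed
  qed
qed

text \<open>For \<open>r < 1\<close> the vertex \<open>ring k\<close> has positive weight, and ring
  vertices are never glued. Different sectors would each have to be the successor of the other,
  which is impossible among 48. Within a sector the weights determine the maximum and the minimum of
  \<open>s\<close> and the radial parameter, hence \<open>s\<close>.\<close>

lemma interior_coords_inj:
  assumes k: "k < 48" "0 \<le> s" "s < 1" and l: "l < 48" "0 \<le> t" "t < 1" and r: "0 < r" "r < 1"
    and eq: "disc_coords k r s = disc_coords l r t"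
  shows "k = l \<and> s = t"
proof -
  define h \<rho> where "h = min 1 (2 * r)" and "\<rho> = max 0 (2 * r - 1)"
  have h: "h > 0" and \<rho>: "0 \<le> \<rho>" "\<rho> < 1" using r by (auto simp: h_def \<rho>_def)
  have kl: "k mod 48 = k" "l mod 48 = l" using k l by auto
  have kS: "Suc k mod 48 \<noteq> k" "Suc l mod 48 \<noteq> l" using k l by (auto simp: mod_Suc)
  have "k = l"
  proof (rule ccontr)
    assume "k \<noteq> l"
    have "h * (1 - max \<rho> s) > 0" "h * (1 - max \<rho> t) > 0" using h \<rho> k l by auto
    then have kl': "k = Suc l mod 48" "l = Suc k mod 48"
      using fun_cong[OF eq, of "ring k"] fun_cong[OF eq, of "ring l"] \<open>k \<noteq> l\<close> k(1) l(1) kl kS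
      by (auto simp: disc_coords_ring h_def[symmetric] \<rho>_def[symmetric] split: if_splits)
    have "Suc l mod 48 = (if l = 47 then 0 else Suc l)" "Suc k mod 48 = (if k = 47 then 0 else Suc k)"
      using k(1) l(1) by auto
    then have "l = 47 \<and> k = 0 \<or> k = Suc l" "k = 47 \<and> l = 0 \<or> l = Suc k" using kl' by metis+
    then show False by linarith
  qed
  have "h * (1 - max \<rho> s) = h * (1 - max \<rho> t)"
    using fun_cong[OF eq, of "ring k"] \<open>k = l\<close> k(1) kl kS
    by (auto simp: disc_coords_ring h_def[symmetric] \<rho>_def[symmetric])
  then have m: "max \<rho> s = max \<rho> t" using h by simp
  have "h * min \<rho> s = h * min \<rho> t"
    using fun_cong[OF eq, of "label (Suc k)"] \<open>k = l\<close> k(1)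
    by (simp add: disc_coords_label h_def[symmetric] \<rho>_def[symmetric])
  then have "min \<rho> s = min \<rho> t" using h by simp
  then have "s = t" using m by (auto simp: max_def min_def split: if_splits)
  then show ?thesis using \<open>k = l\<close> by simp
qed

text \<open>The coordinate of the center determines \<open>r\<close> up to 1/2, and the total weight
  of the labels determines it beyond. With equal radii the boundary and interior cases
  apply.\<close>

lemma disc_coords_imp_equivclp:
  assumes k: "k < 48" "0 \<le> s" "s \<le> 1" and r: "0 \<le> r" "r \<le> 1"
    and l: "l < 48" "0 \<le> t" "t \<le> 1" and q: "0 \<le> q" "q \<le> 1"
    and eq: "disc_coords k r s = disc_coords l q t"
  shows "equivclp (side_pairing 4) (disc_point k r s) (disc_point l q t)"
proof -
  have h: "min 1 (2 * r) = min 1 (2 * q)"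
    using fun_cong[OF eq, of 17] k l by (simp add: disc_coords_center)
  have "min 1 (2 * r) * max 0 (2 * r - 1) = min 1 (2 * q) * max 0 (2 * q - 1)"
    using disc_coords_label_sum[of k s r] disc_coords_label_sum[of l t q] k l eq by simp
  then have "r = q"
    using h r q by (cases "2 * r \<le> 1"; cases "2 * q \<le> 1") (auto simp: min_def max_def split: if_splits)
  show ?thesis
  proof (cases "r = 0")
    case True
    then show ?thesis using \<open>r = q\<close> by simp
  next
    case False
    obtain k' s' where k': "k' < 48" "0 \<le> s'" "s' < 1" "disc_coords k' r s' = disc_coords k r s"
      "disc_point k' r s' = disc_point k r s"
      using disc_params_normal[of k s r] k r by blast
    obtain l' t' where l': "l' < 48" "0 \<le> t'" "t' < 1" "disc_coords l' r t' = disc_coords l r t"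
      "disc_point l' r t' = disc_point l r t"
      using disc_params_normal[of l t r] l r by blast
    have eq': "disc_coords k' r s' = disc_coords l' r t'" using k'(4) l'(4) eq \<open>r = q\<close> by simp
    have "equivclp (side_pairing 4) (disc_point k' r s') (disc_point l' r t')"
    proof (cases "r = 1")
      case True
      then show ?thesis using boundary_coords_imp_equivclp[OF k'(1-3) l'(1-3)] eq' by simp
    next
      case ne1: False
      then have "k' = l' \<and> s' = t'" using interior_coords_inj[OF k'(1-3) l'(1-3) _ _ eq'] False r by simp
      then show ?thesis by simp
    qed
    then show ?thesis using k'(5) l'(5) \<open>r = q\<close> by simp
  qed
qed

lemma disc_point_surj:
  assumes "norm z \<le> 1"
  shows "\<exists>k s. k < 48 \<and> 0 \<le> s \<and> s \<le> 1 \<and> disc_point k (norm z) s = z"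
proof -
  define t where "t = 48 * Arg2pi z / (2 * pi)"
  have t: "0 \<le> t" "t < 48" using Arg2pi[of z] by (auto simp: t_def field_simps)
  define k where "k = nat \<lfloor>t\<rfloor>"
  have k: "real k = of_int \<lfloor>t\<rfloor>" "k < 48"
    using t unfolding k_def by (simp_all add: nat_less_iff floor_less_iff)
  have "2 * pi * (real k + (t - real k)) / 48 = Arg2pi z" by (simp add: t_def)
  then have "disc_point k (norm z) (t - k) = z"
    unfolding disc_point_def using Arg2pi_eq[of z] by (simp add: cis_conv_exp mult.commute)
  moreover have "0 \<le> t - k" "t - k \<le> 1" unfolding k(1) by linarith+
  ultimately show ?thesis using k(2) by blast
qed

section \<open>Two quotients of the parameter space with the same fibres\<close>

lemma quotient_maps_homeomorphic:
  assumes f: "quotient_map X A f" and g: "quotient_map X B g"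
    and eq: "\<And>x y. x \<in> topspace X \<Longrightarrow> y \<in> topspace X \<Longrightarrow> f x = f y \<longleftrightarrow> g x = g y"
  shows "A homeomorphic_space B"
proof -
  obtain p where p: "continuous_map A B p" "\<And>x. x \<in> topspace X \<Longrightarrow> p (f x) = g x"
    using quotient_map_lift_exists[OF f quotient_imp_continuous_map[OF g]] eq by metis
  obtain q where q: "continuous_map B A q" "\<And>x. x \<in> topspace X \<Longrightarrow> q (g x) = f x"
    using quotient_map_lift_exists[OF g quotient_imp_continuous_map[OF f]] eq by metis
  have "\<forall>a\<in>topspace A. q (p a) = a" "\<forall>b\<in>topspace B. p (q b) = b"
    using p(2) q(2) quotient_imp_surjective_map[OF f, symmetric] quotient_imp_surjective_map[OF g, symmetric] by auto
  then have "homeomorphic_maps A B p q" using p q by (auto simp: homeomorphic_maps_def)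
  then show ?thesis by (auto simp: homeomorphic_space_def)
qed

lemma quotient_map_quotient_topology:
  assumes "equiv (topspace X) r"
  shows "quotient_map X (quotient_topology X r) (\<lambda>x. r `` {x})"
proof -
  have top: "topspace (quotient_topology X r) = topspace X // r"
  proof
    show "topspace (quotient_topology X r) \<subseteq> topspace X // r"
      using openin_quotient_topology[OF assms] openin_topspace by blast
    have "openin (quotient_topology X r) (topspace X // r)"
      using Union_quotient[OF assms] by (simp add: openin_quotient_topology[OF assms])
    then show "topspace X // r \<subseteq> topspace (quotient_topology X r)" by (rule openin_subset)
  qed
  have "{x \<in> topspace X. r `` {x} \<in> U} = \<Union>U" if U: "U \<subseteq> topspace X // r" for U
  proof (intro set_eqI iffI)
    fix x assume "x \<in> {x \<in> topspace X. r `` {x} \<in> U}"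
    then show "x \<in> \<Union>U" using equiv_class_self[OF assms, of x] by blast
  next
    fix x assume "x \<in> \<Union>U"
    then obtain C where C: "C \<in> U" "x \<in> C" by blast
    then obtain y where y: "y \<in> topspace X" "C = r `` {y}" using U by (auto elim: quotientE)
    then have "(y, x) \<in> r" using C by simp
    then have "r `` {y} = r `` {x}" "x \<in> topspace X"
      using assms by (auto simp: equiv_class_eq_iff)
    then show "x \<in> {x \<in> topspace X. r `` {x} \<in> U}" using C y by simp
  qed
  then show ?thesis
    unfolding quotient_map_def top openin_quotient_topology[OF assms]
    by (auto simp: quotient_def)
qed

lemma Hausdorff_space_functions: "Hausdorff_space (top_of_set (S :: ('v \<Rightarrow> real) set))"
  by (simp add: Hausdorff_space_subtopology Hausdorff_space_product_topology
      flip: euclidean_product_topology)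

text \<open>A continuous surjection from the compact parameter space onto a Hausdorff space is a
  quotient map. This applies to the polyhedron and to the disc, and the disc is followed by the
  projection to the surface. What remains is that both composites identify the same
  parameters.\<close>

theorem polygon_complex_homeomorphic:
  "polyhedron (list_complex polygon_triangles) homeomorphic_space orientable_surface 4"
proof -
  define F where "F = (\<lambda>(k, r, s). disc_coords k r s)"
  define G where "G = (\<lambda>(k, r, s). disc_point k r s)"
  let ?X = "top_of_set disc_params" and ?C = "top_of_set (cball (0::complex) 1)"
  have params: "(k, r, s) \<in> disc_params \<longleftrightarrow> k < 48 \<and> 0 \<le> r \<and> r \<le> 1 \<and> 0 \<le> s \<and> s \<le> 1" for k r s
    by (auto simp: disc_params_def)
  have "compact disc_params"
    unfolding disc_params_def by (intro compact_Times compact_Icc finite_imp_compact) simp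
  then have comp: "compact_space ?X" by (simp add: compact_space_subtopology)
  have nat: "continuous_on S (\<lambda>x :: nat \<times> real \<times> real. \<phi> (fst x))" for S and \<phi> :: "nat \<Rightarrow> real"
    by (intro continuous_on_compose2[OF Topological_Spaces.continuous_on_discrete[of UNIV \<phi>]] continuous_intros) auto
  have contF: "continuous_on disc_params F"
  proof (rule continuous_on_coordinatewise_then_product)
    fix w
    \<comment> \<open>As a factor, a condition on \<open>k\<close> is a function on a discrete space
      and hence continuous.\<close>
    have ind: "(if P then c else 0) = of_bool P * c" for P and c :: real by simp
    show "continuous_on disc_params (\<lambda>x. F x w)"
      unfolding F_def disc_coords_def case_prod_beta ind
      by (intro continuous_intros nat)
  qed
  have contG: "continuous_on disc_params G"
  proof -
    have "G = (\<lambda>x. of_real (fst (snd x)) * cis (2 * pi * (real (fst x) + snd (snd x)) / 48))"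
      by (auto simp: G_def disc_point_def)
    then show ?thesis by (auto intro!: continuous_intros nat)
  qed
  have imF: "F ` disc_params = underlying_space (list_complex polygon_triangles)"
  proof
    show "F ` disc_params \<subseteq> underlying_space (list_complex polygon_triangles)"
      by (auto simp: F_def params disc_coords_in_space)
    show "underlying_space (list_complex polygon_triangles) \<subseteq> F ` disc_params"
    proof
      fix x assume "x \<in> underlying_space (list_complex polygon_triangles)"
      then obtain k r s where "(k, r, s) \<in> disc_params" "disc_coords k r s = x"
        using disc_coords_surj unfolding params by metis
      then show "x \<in> F ` disc_params" by (intro image_eqI[of _ _ "(k, r, s)"]) (auto simp: F_def)
    qed
  qed
  have imG: "G ` disc_params = cball 0 1"
  proof
    show "G ` disc_params \<subseteq> cball 0 1"
      by (auto simp: G_def params norm_disc_point)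
    show "cball 0 1 \<subseteq> G ` disc_params"
    proof
      fix z :: complex assume "z \<in> cball 0 1"
      then have "norm z \<le> 1" by simp
      then obtain k s where "(k, norm z, s) \<in> disc_params" "disc_point k (norm z) s = z"
        using disc_point_surj unfolding params by (metis norm_ge_zero)
      then show "z \<in> G ` disc_params" by (intro image_eqI[of _ _ "(k, norm z, s)"]) (auto simp: G_def)
    qed
  qed
  have qF: "quotient_map ?X (polyhedron (list_complex polygon_triangles)) F"
    using contF imF comp by (intro continuous_imp_quotient_map) (auto simp: Hausdorff_space_functions)
  have "quotient_map ?X ?C G"
    using contG imG comp by (intro continuous_imp_quotient_map) (auto simp: Hausdorff_space_subtopology)
  moreover have "quotient_map ?C (orientable_surface 4) (\<lambda>z. surface_rel 4 `` {z})"
    unfolding orientable_surface_def by (rule quotient_map_quotient_topology) (simp add: equiv_surface_rel)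
  ultimately have qG: "quotient_map ?X (orientable_surface 4) ((\<lambda>z. surface_rel 4 `` {z}) \<circ> G)"
    by (rule quotient_map_compose)
  have FG: "F x = F y \<longleftrightarrow> G x = G y \<or> equivclp (side_pairing 4) (G x) (G y)"
    if "x \<in> disc_params" "y \<in> disc_params" for x y
  proof
    assume "F x = F y"
    then show "G x = G y \<or> equivclp (side_pairing 4) (G x) (G y)"
      using that by (cases x; cases y) (simp add: F_def G_def params disc_coords_imp_equivclp)
  next
    assume GG: "G x = G y \<or> equivclp (side_pairing 4) (G x) (G y)"
    have FcongG: "F x = F y" if "x \<in> disc_params" "y \<in> disc_params" "G x = G y" for x y
      using that by (cases x; cases y) (auto simp: F_def G_def params intro: disc_coords_cong)
    \<comment> \<open>\<open>F\<close> factors through \<open>G\<close>, by an arbitrary choice of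
      preimages. Equality of the values of \<open>H\<close> is an equivalence relation, so it passes
      from single pairings to the generated equivalence.\<close>
    define H where "H = (\<lambda>z. F (SOME x. x \<in> disc_params \<and> G x = z))"
    have H: "H (G x) = F x" if "x \<in> disc_params" for x
      unfolding H_def using someI[of "\<lambda>y. y \<in> disc_params \<and> G y = G x" x] that FcongG by blast
    have sp: "H a = H b" if ab: "side_pairing 4 a b" for a b
    proof -
      obtain k s k' s' where "k < 48" "0 \<le> s" "s \<le> 1" "k' < 48" "0 \<le> s'" "s' \<le> 1"
        and ab: "a = disc_point k 1 s" "b = disc_point k' 1 s'" "disc_coords k 1 s = disc_coords k' 1 s'"
        using side_pairing_coords[OF ab] .
      then have "(k, 1, s) \<in> disc_params" "(k', 1, s') \<in> disc_params" by (simp_all add: params)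
      then show ?thesis using H[of "(k, 1, s)"] H[of "(k', 1, s')"] ab by (simp add: F_def G_def)
    qed
    have "H a = H b" if "equivclp (side_pairing 4) a b" for a b
      using that by (induction rule: equivclp_induct) (auto dest: sp)
    then have "H (G x) = H (G y)" using GG by auto
    then show "F x = F y" using H that by simp
  qed
  have "F x = F y \<longleftrightarrow> ((\<lambda>z. surface_rel 4 `` {z}) \<circ> G) x = ((\<lambda>z. surface_rel 4 `` {z}) \<circ> G) y"
    if "x \<in> disc_params" "y \<in> disc_params" for x y
  proof -
    have "G x \<in> cball 0 1" "G y \<in> cball 0 1" using that imG by blast+
    then have "surface_rel 4 `` {G x} = surface_rel 4 `` {G y} \<longleftrightarrow> equivclp (side_pairing 4) (G x) (G y)"
      using eq_equiv_class_iff[OF equiv_surface_rel, of "G x" "G y" 4] by (simp add: surface_rel_def)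
    then show ?thesis using FG[OF that] by auto
  qed
  then show ?thesis by (intro quotient_maps_homeomorphic[OF qF qG]) auto
qed

section \<open>Certified sequences of flips\<close>

datatype 'v move = Flip 'v 'v 'v 'v | Cone 'v 'v 'v 'v | Uncone 'v 'v 'v 'v

text \<open>The checks use conditionals instead of connectives: the simplifier then evaluates only the
  branch that is needed.\<close>

fun has_corner :: "'v \<Rightarrow> 'v \<times> 'v \<times> 'v \<Rightarrow> bool" where
  "has_corner v (x, y, z) = (if x = v then True else if y = v then True else z = v)"

definition has_edge :: "'v \<Rightarrow> 'v \<Rightarrow> 'v \<times> 'v \<times> 'v \<Rightarrow> bool" where
  "has_edge a b t = (if has_corner a t then has_corner b t else False)"

definition has_triangle :: "'v \<Rightarrow> 'v \<Rightarrow> 'v \<Rightarrow> 'v \<times> 'v \<times> 'v \<Rightarrow> bool" where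
  "has_triangle a b c t = (if has_edge a b t then has_corner c t else False)"

definition distinct4 :: "'v \<Rightarrow> 'v \<Rightarrow> 'v \<Rightarrow> 'v \<Rightarrow> bool" where
  "distinct4 a b c d =
     (if has_corner a (b, c, d) then False else if has_corner b (a, c, d) then False else c \<noteq> d)"

fun exists :: "('a \<Rightarrow> bool) \<Rightarrow> 'a list \<Rightarrow> bool" where
  "exists P [] = False"
| "exists P (x # xs) = (if P x then True else exists P xs)"

fun separate :: "('a \<Rightarrow> bool) \<Rightarrow> 'a list \<Rightarrow> 'a list \<times> 'a list" where
  "separate P [] = ([], [])"
| "separate P (x # xs) = (case separate P xs of (ys, zs) \<Rightarrow> if P x then (x # ys, zs) else (ys, x # zs))"

text \<open>A result \<open>Some\<close> certifies the hypotheses of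
  \<open>flip_homeomorphic\<close> or \<open>cone_homeomorphic\<close>. The pattern on the separated
  list counts the affected triangles: two at an edge, one to be starred, three at a vertex to be
  removed.\<close>

fun apply_move :: "('v \<times> 'v \<times> 'v) list \<Rightarrow> 'v move \<Rightarrow> ('v \<times> 'v \<times> 'v) list option" where
  "apply_move ts (Flip a b c d) = (case separate (has_edge a b) ts of
     ([s, t], rs) \<Rightarrow>
       if (if distinct4 a b c d then if has_corner c s then has_corner d t else if has_corner d s then has_corner c t else False else False)
       then if exists (has_edge c d) rs then None else Some ((a, c, d) # (b, c, d) # rs)
       else None
   | _ \<Rightarrow> None)"
| "apply_move ts (Cone a b c v) = (case separate (has_triangle a b c) ts of
     ([s], rs) \<Rightarrow>
       if (if distinct4 a b c v then exists (has_corner v) rs else True) then None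
       else Some ((a, b, v) # (b, c, v) # (a, c, v) # rs)
   | _ \<Rightarrow> None)"
| "apply_move ts (Uncone a b c v) = (case separate (has_corner v) ts of
     ([s, t, u], rs) \<Rightarrow>
       if (if distinct4 a b c v then
             if exists (has_edge a b) [s, t, u] then
             if exists (has_edge b c) [s, t, u] then
             if exists (has_edge a c) [s, t, u] then exists (has_triangle a b c) rs else True else True else True else True)
       then None else Some ((a, b, c) # rs)
   | _ \<Rightarrow> None)"

fun apply_moves :: "('v \<times> 'v \<times> 'v) list \<Rightarrow> 'v move list \<Rightarrow> ('v \<times> 'v \<times> 'v) list option" where
  "apply_moves ts [] = Some ts"
| "apply_moves ts (m # ms) = (case apply_move ts m of None \<Rightarrow> None | Some us \<Rightarrow> apply_moves us ms)"

lemma has_corner_iff: "has_corner v t \<longleftrightarrow> v \<in> corners t"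
  by (cases t) auto

lemma has_edge_iff: "has_edge a b t \<longleftrightarrow> {a, b} \<subseteq> corners t"
  by (simp add: has_edge_def has_corner_iff)

lemma has_triangle_iff: "has_triangle a b c t \<longleftrightarrow> {a, b, c} \<subseteq> corners t"
  by (auto simp: has_triangle_def has_edge_iff has_corner_iff)

lemma distinct4_iff: "distinct4 a b c d \<longleftrightarrow> distinct [a, b, c, d]"
  by (auto simp: distinct4_def)

lemma exists_iff: "exists P xs \<longleftrightarrow> (\<exists>x\<in>set xs. P x)"
  by (induction xs) auto

lemma separateD:
  "separate P xs = (ys, zs) \<Longrightarrow> set ys = {x \<in> set xs. P x} \<and> set zs = {x \<in> set xs. \<not> P x}"
proof (induction xs arbitrary: ys zs)
  case (Cons x xs)
  obtain ys' zs' where rec: "separate P xs = (ys', zs')" by fastforce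
  have "ys = (if P x then x # ys' else ys')" "zs = (if P x then zs' else x # zs')"
    using Cons.prems rec by (auto split: if_splits)
  then show ?case using Cons.IH[OF rec] by auto
qed simp

text \<open>A triple may repeat an entry, so equality is obtained by counting corners.\<close>

lemma corners_eqI:
  assumes "{a, b, c} \<subseteq> corners t" "distinct [a, b, c]"
  shows "corners t = {a, b, c}"
proof -
  have "card (corners t) \<le> 3" by (cases t) (auto simp: card_insert_if)
  moreover have "card {a, b, c} = 3" using assms(2) by auto
  ultimately show ?thesis using card_seteq[OF finite_corners assms(1)] by simp
qed

lemma apply_move_homeomorphic:
  fixes ts :: "('v \<times> 'v \<times> 'v) list"
  assumes inf: "infinite (UNIV :: 'v set)" and "apply_move ts m = Some us"
  shows "polyhedron (list_complex ts) homeomorphic_space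
         polyhedron (list_complex us)"
proof (cases m)
  case (Flip a b c d)
  then obtain s t rs where sep: "separate (has_edge a b) ts = ([s, t], rs)" and d: "distinct [a, b, c, d]"
    and st: "c \<in> corners s \<and> d \<in> corners t \<or> d \<in> corners s \<and> c \<in> corners t"
    and rs: "\<And>r. r \<in> set rs \<Longrightarrow> \<not> {c, d} \<subseteq> corners r" and us: "us = (a, c, d) # (b, c, d) # rs"
    using assms(2) by (auto simp: distinct4_iff has_corner_iff exists_iff has_edge_iff
        split: prod.splits list.splits if_splits)
  have ts: "set ts = {s, t} \<union> set rs" and ab: "{a, b} \<subseteq> corners s" "{a, b} \<subseteq> corners t"
    and nab: "\<And>r. r \<in> set rs \<Longrightarrow> \<not> {a, b} \<subseteq> corners r"
    using separateD[OF sep] unfolding has_edge_iff by auto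
  have pair: "{corners s, corners t} = {{a, b, c}, {a, b, d}}"
    using st
  proof
    assume "c \<in> corners s \<and> d \<in> corners t"
    then have "corners s = {a, b, c}" "corners t = {a, b, d}" using ab d by (auto intro!: corners_eqI)
    then show ?thesis by simp
  next
    assume "d \<in> corners s \<and> c \<in> corners t"
    then have "corners s = {a, b, d}" "corners t = {a, b, c}" using ab d by (auto intro!: corners_eqI)
    then show ?thesis by auto
  qed
  have "corners ` set ts = {corners s, corners t} \<union> corners ` set rs" unfolding ts by simp
  then have "corners ` set ts = {{a, b, c}, {a, b, d}} \<union> corners ` set rs" unfolding pair .
  moreover have "corners ` set us = {{a, c, d}, {b, c, d}} \<union> corners ` set rs" unfolding us by simp
  moreover have "polyhedron (generated_complex ({{a, b, c}, {a, b, d}} \<union> corners ` set rs))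
    homeomorphic_space polyhedron (generated_complex ({{a, c, d}, {b, c, d}} \<union> corners ` set rs))"
  proof (rule flip_homeomorphic[OF inf _ _ d])
    show "\<not> {a, b} \<subseteq> \<tau>" "\<not> {c, d} \<subseteq> \<tau>" if "\<tau> \<in> corners ` set rs" for \<tau>
      using that nab rs by blast+
  qed auto
  ultimately show ?thesis unfolding list_complex_def by simp
next
  case (Cone a b c v)
  then obtain s rs where sep: "separate (has_triangle a b c) ts = ([s], rs)" and d: "distinct [a, b, c, v]"
    and rs: "\<And>r. r \<in> set rs \<Longrightarrow> v \<notin> corners r" and us: "us = (a, b, v) # (b, c, v) # (a, c, v) # rs"
    using assms(2) by (auto simp: distinct4_iff has_corner_iff exists_iff
        split: prod.splits list.splits if_splits)
  have ts: "set ts = {s} \<union> set rs" and abc: "{a, b, c} \<subseteq> corners s"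
    and nabc: "\<And>r. r \<in> set rs \<Longrightarrow> \<not> {a, b, c} \<subseteq> corners r"
    using separateD[OF sep] unfolding has_triangle_iff by auto
  have "corners s = {a, b, c}" using abc d by (intro corners_eqI) auto
  then have "corners ` set ts = {{a, b, c}} \<union> corners ` set rs" unfolding ts by simp
  moreover have "corners ` set us = {{a, b, v}, {b, c, v}, {a, c, v}} \<union> corners ` set rs" unfolding us by simp
  moreover have "polyhedron (generated_complex ({{a, b, v}, {b, c, v}, {a, c, v}} \<union> corners ` set rs))
    homeomorphic_space polyhedron (generated_complex ({{a, b, c}} \<union> corners ` set rs))"
  proof (rule cone_homeomorphic[OF _ _ d])
    show "\<not> {a, b, c} \<subseteq> \<tau>" if "\<tau> \<in> corners ` set rs" for \<tau>
      using that nabc by blast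
    show "v \<notin> \<Union> (corners ` set rs)" using rs by blast
  qed auto
  ultimately show ?thesis unfolding list_complex_def by (metis homeomorphic_space_sym)
next
  case (Uncone a b c v)
  then obtain s t u rs where sep: "separate (has_corner v) ts = ([s, t, u], rs)" and d: "distinct [a, b, c, v]"
    and ex: "exists (has_edge a b) [s, t, u]" "exists (has_edge b c) [s, t, u]" "exists (has_edge a c) [s, t, u]"
    and nex: "\<not> exists (has_triangle a b c) rs" and us: "us = (a, b, c) # rs"
    using assms(2) by (auto simp: distinct4_iff simp del: exists.simps
        split: prod.splits list.splits if_splits)
  have rs: "\<And>r. r \<in> set rs \<Longrightarrow> \<not> {a, b, c} \<subseteq> corners r"
    using nex unfolding exists_iff has_triangle_iff by blast
  have ts: "set ts = {s, t, u} \<union> set rs" and v: "v \<in> corners s" "v \<in> corners t" "v \<in> corners u"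
    and nv: "\<And>r. r \<in> set rs \<Longrightarrow> v \<notin> corners r"
    using separateD[OF sep] unfolding has_corner_iff by auto
  have star: "corners r = {x, y, v}" if "r \<in> {s, t, u}" "{x, y} \<subseteq> corners r" "distinct [x, y, v]" for r x y
    using that v by (intro corners_eqI) auto
  have in_star: "{x, y, v} \<in> {corners s, corners t, corners u}"
    if "exists (has_edge x y) [s, t, u]" "distinct [x, y, v]" for x y
  proof -
    have "\<exists>r\<in>set [s, t, u]. {x, y} \<subseteq> corners r"
      using that(1) unfolding exists_iff has_edge_iff .
    then obtain r where "r \<in> set [s, t, u]" and xy: "{x, y} \<subseteq> corners r" by (rule bexE)
    then have r: "r \<in> {s, t, u}" by simp
    then have "corners r = {x, y, v}" using xy that(2) by (rule star)
    then show ?thesis using r by blast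
  qed
  \<comment> \<open>Three different sets inside a family of at most three exhaust it, so the
    triangles at \<open>v\<close> are exactly the cone over the boundary of
    \<open>{a, b, c}\<close>, in whatever order they were listed.\<close>
  have "{{a, b, v}, {b, c, v}, {a, c, v}} \<subseteq> {corners s, corners t, corners u}"
    using in_star[OF ex(1)] in_star[OF ex(2)] in_star[OF ex(3)] d by simp
  moreover have "card {{a, b, v}, {b, c, v}, {a, c, v}} = 3"
  proof -
    have "{a, b, v} \<noteq> {b, c, v}" "{a, b, v} \<noteq> {a, c, v}" "{b, c, v} \<noteq> {a, c, v}" using d by auto
    then show ?thesis by simp
  qed
  moreover have "card {corners s, corners t, corners u} \<le> 3" by (simp add: card_insert_if)
  ultimately have triple: "{corners s, corners t, corners u} = {{a, b, v}, {b, c, v}, {a, c, v}}"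
    by (metis card_seteq finite.emptyI finite.insertI)
  have "corners ` set ts = {corners s, corners t, corners u} \<union> corners ` set rs" unfolding ts by simp
  then have "corners ` set ts = {{a, b, v}, {b, c, v}, {a, c, v}} \<union> corners ` set rs" unfolding triple .
  moreover have "corners ` set us = {{a, b, c}} \<union> corners ` set rs" unfolding us by simp
  moreover have "polyhedron (generated_complex ({{a, b, v}, {b, c, v}, {a, c, v}} \<union> corners ` set rs))
    homeomorphic_space polyhedron (generated_complex ({{a, b, c}} \<union> corners ` set rs))"
  proof (rule cone_homeomorphic[OF _ _ d])
    show "\<not> {a, b, c} \<subseteq> \<tau>" if "\<tau> \<in> corners ` set rs" for \<tau>
      using that rs by blast
    show "v \<notin> \<Union> (corners ` set rs)" using nv by blast
  qed auto
  ultimately show ?thesis unfolding list_complex_def by simp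
qed

lemma apply_moves_homeomorphic:
  fixes ts :: "('v \<times> 'v \<times> 'v) list"
  assumes inf: "infinite (UNIV :: 'v set)" and "apply_moves ts ms = Some us"
  shows "polyhedron (list_complex ts) homeomorphic_space
         polyhedron (list_complex us)"
  using assms(2)
proof (induction ms arbitrary: ts)
  case (Cons m ms)
  then obtain vs where vs: "apply_move ts m = Some vs" "apply_moves vs ms = Some us"
    by (auto split: option.splits)
  then show ?case
    using homeomorphic_space_trans[OF apply_move_homeomorphic[OF inf vs(1)] Cons.IH[OF vs(2)]] by simp
qed (simp add: homeomorphic_space_refl)

section \<open>An isomorphism invariant\<close>

definition facets :: "'v set set \<Rightarrow> 'v set set" where
  "facets \<Delta> = {\<sigma> \<in> \<Delta>. card \<sigma> = 3}"

text \<open>A numerical form of colour refinement. One round gives the number of triangles at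
  \<open>v\<close>, and each further round takes in a larger neighbourhood. Only incidences enter,
  so isomorphisms preserve the values.\<close>

fun weight :: "'v set set \<Rightarrow> nat \<Rightarrow> 'v \<Rightarrow> nat" where
  "weight \<Delta> 0 v = 1"
| "weight \<Delta> (Suc n) v = (\<Sum>\<sigma>\<in>{\<sigma> \<in> facets \<Delta>. v \<in> \<sigma>}. \<Prod>u\<in>\<sigma> - {v}. weight \<Delta> n u)"

definition total_weight :: "'v set set \<Rightarrow> nat \<Rightarrow> nat" where
  "total_weight \<Delta> n = (\<Sum>\<sigma>\<in>facets \<Delta>. \<Prod>u\<in>\<sigma>. weight \<Delta> n u)"

lemma facets_iso:
  assumes "simplicial_iso \<alpha> \<Delta> \<Gamma>"
  shows "facets \<Gamma> = (`) \<alpha> ` facets \<Delta>" and "inj_on ((`) \<alpha>) (facets \<Delta>)"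
proof -
  have inj: "inj_on \<alpha> (vertices \<Delta>)" and \<Gamma>: "(`) \<alpha> ` \<Delta> = \<Gamma>"
    using assms by (auto simp: simplicial_iso_def bij_betw_def)
  have "card (\<alpha> ` \<sigma>) = card \<sigma>" if "\<sigma> \<in> \<Delta>" for \<sigma>
    using inj_on_subset[OF inj, of \<sigma>] that by (intro card_image) blast
  then show "facets \<Gamma> = (`) \<alpha> ` facets \<Delta>" unfolding facets_def \<Gamma>[symmetric] by force
  show "inj_on ((`) \<alpha>) (facets \<Delta>)"
  proof (rule inj_onI)
    fix \<sigma> \<tau> assume "\<sigma> \<in> facets \<Delta>" "\<tau> \<in> facets \<Delta>" "\<alpha> ` \<sigma> = \<alpha> ` \<tau>"
    then show "\<sigma> = \<tau>" using inj_on_image_eq_iff[OF inj, of \<sigma> \<tau>] by (auto simp: facets_def)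
  qed
qed

lemma weight_iso:
  assumes iso: "simplicial_iso \<alpha> \<Delta> \<Gamma>" and "v \<in> vertices \<Delta>"
  shows "weight \<Gamma> n (\<alpha> v) = weight \<Delta> n v"
  using assms(2)
proof (induction n arbitrary: v)
  case (Suc n)
  have inj: "inj_on \<alpha> (vertices \<Delta>)" using iso by (auto simp: simplicial_iso_def bij_betw_def)
  have sub: "\<sigma> \<subseteq> vertices \<Delta>" if "\<sigma> \<in> facets \<Delta>" for \<sigma> using that by (auto simp: facets_def)
  have "\<alpha> v \<in> \<alpha> ` \<sigma> \<longleftrightarrow> v \<in> \<sigma>" if "\<sigma> \<in> facets \<Delta>" for \<sigma>
    using inj_on_image_mem_iff[OF inj Suc.prems sub[OF that]] .
  then have "{\<sigma> \<in> facets \<Gamma>. \<alpha> v \<in> \<sigma>} = (`) \<alpha> ` {\<sigma> \<in> facets \<Delta>. v \<in> \<sigma>}"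
    unfolding facets_iso(1)[OF iso] by auto
  then have "weight \<Gamma> (Suc n) (\<alpha> v) =
      (\<Sum>\<sigma>\<in>{\<sigma> \<in> facets \<Delta>. v \<in> \<sigma>}. \<Prod>u\<in>\<alpha> ` \<sigma> - {\<alpha> v}. weight \<Gamma> n u)"
    using inj_on_subset[OF facets_iso(2)[OF iso], of "{\<sigma> \<in> facets \<Delta>. v \<in> \<sigma>}"]
    by (simp add: sum.reindex)
  also have "\<dots> = weight \<Delta> (Suc n) v"
    unfolding weight.simps
  proof (rule sum.cong)
    fix \<sigma> assume \<sigma>: "\<sigma> \<in> {\<sigma> \<in> facets \<Delta>. v \<in> \<sigma>}"
    then have s: "\<sigma> - {v} \<subseteq> vertices \<Delta>" using sub by blast
    have "\<alpha> ` \<sigma> - {\<alpha> v} = \<alpha> ` (\<sigma> - {v})"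
      using inj_on_image_set_diff[OF inj, of \<sigma> "{v}"] \<sigma> sub Suc.prems by auto
    then have "(\<Prod>u\<in>\<alpha> ` \<sigma> - {\<alpha> v}. weight \<Gamma> n u) = (\<Prod>u\<in>\<sigma> - {v}. weight \<Gamma> n (\<alpha> u))"
      using inj_on_subset[OF inj s] by (simp add: prod.reindex)
    also have "\<dots> = (\<Prod>u\<in>\<sigma> - {v}. weight \<Delta> n u)" using s Suc.IH by (intro prod.cong) auto
    finally show "(\<Prod>u\<in>\<alpha> ` \<sigma> - {\<alpha> v}. weight \<Gamma> n u) = (\<Prod>u\<in>\<sigma> - {v}. weight \<Delta> n u)" .
  qed simp
  finally show ?case .
qed simp

lemma total_weight_iso:
  assumes "isomorphic_complexes \<Delta> \<Gamma>"
  shows "total_weight \<Gamma> n = total_weight \<Delta> n"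
proof -
  obtain \<alpha> where iso: "simplicial_iso \<alpha> \<Delta> \<Gamma>" using assms by (auto simp: isomorphic_complexes_def)
  have inj: "inj_on \<alpha> (vertices \<Delta>)" using iso by (auto simp: simplicial_iso_def bij_betw_def)
  have "total_weight \<Gamma> n = (\<Sum>\<sigma>\<in>facets \<Delta>. \<Prod>u\<in>\<alpha> ` \<sigma>. weight \<Gamma> n u)"
    unfolding total_weight_def facets_iso(1)[OF iso] by (simp add: sum.reindex[OF facets_iso(2)[OF iso]])
  also have "\<dots> = total_weight \<Delta> n"
    unfolding total_weight_def
  proof (rule sum.cong)
    fix \<sigma> assume "\<sigma> \<in> facets \<Delta>"
    then have s: "\<sigma> \<subseteq> vertices \<Delta>" by (auto simp: facets_def)
    have "(\<Prod>u\<in>\<alpha> ` \<sigma>. weight \<Gamma> n u) = (\<Prod>u\<in>\<sigma>. weight \<Gamma> n (\<alpha> u))"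
      using inj_on_subset[OF inj s] by (simp add: prod.reindex)
    also have "\<dots> = (\<Prod>u\<in>\<sigma>. weight \<Delta> n u)" using s by (intro prod.cong refl weight_iso[OF iso]) blast
    finally show "(\<Prod>u\<in>\<alpha> ` \<sigma>. weight \<Gamma> n u) = (\<Prod>u\<in>\<sigma>. weight \<Delta> n u)" .
  qed simp
  finally show ?thesis .
qed

section \<open>Evaluation of the invariant on lists\<close>

fun proper :: "('v \<times> 'v \<times> 'v) list \<Rightarrow> bool" where
  "proper [] = True"
| "proper ((a, b, c) # ts) = (if a = b then False else if a = c then False else if b = c then False else
     if exists (has_triangle a b c) ts then False else proper ts)"

fun lookup :: "('v \<times> 'b) list \<Rightarrow> 'v \<Rightarrow> 'b" where
  "lookup ((u, x) # xs) v = (if u = v then x else lookup xs v)"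

fun vertex_weight :: "('v \<times> nat) list \<Rightarrow> 'v \<Rightarrow> ('v \<times> 'v \<times> 'v) list \<Rightarrow> nat" where
  "vertex_weight ws v [] = 0"
| "vertex_weight ws v ((a, b, c) # ts) =
     (if a = v then lookup ws b * lookup ws c + vertex_weight ws v ts
      else if b = v then lookup ws a * lookup ws c + vertex_weight ws v ts
      else if c = v then lookup ws a * lookup ws b + vertex_weight ws v ts
      else vertex_weight ws v ts)"

definition next_weights :: "('v \<times> 'v \<times> 'v) list \<Rightarrow> ('v \<times> nat) list \<Rightarrow> ('v \<times> nat) list" where
  "next_weights ts ws = map (\<lambda>(v, _). (v, vertex_weight ws v ts)) ws"

fun list_weight :: "('v \<times> nat) list \<Rightarrow> ('v \<times> 'v \<times> 'v) list \<Rightarrow> nat" where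
  "list_weight ws [] = 0"
| "list_weight ws ((a, b, c) # ts) = lookup ws a * lookup ws b * lookup ws c + list_weight ws ts"

lemma card_corners: "card (corners (a, b, c)) = 3 \<longleftrightarrow> distinct [a, b, c]"
  by (auto simp: card_insert_if)

text \<open>With neither degenerate nor repeated triangles the list enumerates the facets without
  multiplicity, and sums over facets become sums over the list.\<close>

lemma properD:
  assumes "proper ts"
  shows "\<And>t. t \<in> set ts \<Longrightarrow> card (corners t) = 3" "distinct ts" "inj_on corners (set ts)"
proof -
  have *: "(\<forall>t\<in>set ts. card (corners t) = 3) \<and> distinct ts \<and> inj_on corners (set ts)"
    using assms
  proof (induction ts rule: proper.induct)
    case (2 a b c ts)
    have d: "distinct [a, b, c]" and p: "proper ts" and n: "\<not> exists (has_triangle a b c) ts"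
      using 2(2) by (auto simp del: exists.simps split: if_splits)
    have IH: "(\<forall>t\<in>set ts. card (corners t) = 3) \<and> distinct ts \<and> inj_on corners (set ts)"
      using 2(1) d p n by auto
    have c3: "card (corners (a, b, c)) = 3" using d by (simp only: card_corners)
    have new: "corners (a, b, c) \<noteq> corners t" if "t \<in> set ts" for t
      using n that unfolding exists_iff has_triangle_iff by auto
    then have "(a, b, c) \<notin> set ts" by blast
    moreover have "corners (a, b, c) \<notin> corners ` (set ts - {(a, b, c)})" using new by blast
    ultimately show ?case using IH c3 by (simp del: corners.simps)
  qed simp
  then show "\<And>t. t \<in> set ts \<Longrightarrow> card (corners t) = 3" "distinct ts" "inj_on corners (set ts)" by blast+
qed

lemma facets_list_complex:
  assumes "proper ts"
  shows "facets (list_complex ts) = corners ` set ts"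
proof (intro equalityI subsetI)
  fix \<sigma> assume "\<sigma> \<in> facets (list_complex ts)"
  then obtain t where t: "t \<in> set ts" "\<sigma> \<subseteq> corners t" and c: "card \<sigma> = 3"
    by (auto simp: facets_def list_complex_def generated_complex_def)
  then have "\<sigma> = corners t" using properD(1)[OF assms t(1)] by (intro card_subset_eq) auto
  then show "\<sigma> \<in> corners ` set ts" using t by blast
next
  fix \<sigma> assume "\<sigma> \<in> corners ` set ts"
  then obtain t where t: "t \<in> set ts" "\<sigma> = corners t" by blast
  moreover have "corners t \<noteq> {}" by (cases t) auto
  ultimately show "\<sigma> \<in> facets (list_complex ts)"
    using properD(1)[OF assms t(1)] by (auto simp: facets_def list_complex_def generated_complex_def)
qed

lemma sum_facets_list_complex:
  assumes "proper ts"
  shows "(\<Sum>\<sigma>\<in>facets (list_complex ts). h \<sigma>) = (\<Sum>t\<leftarrow>ts. h (corners t))"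
  using properD[OF assms] by (simp add: facets_list_complex[OF assms] sum.reindex sum_list_distinct_conv_sum_set)

lemma vertex_weight_correct:
  assumes ts: "proper ts" and ws: "\<And>u. u \<in> vertices (list_complex ts) \<Longrightarrow> lookup ws u = weight (list_complex ts) n u"
  shows "vertex_weight ws v ts = weight (list_complex ts) (Suc n) v"
proof -
  let ?w = "weight (list_complex ts) n"
  \<comment> \<open>The induction runs over a shorter list \<open>us\<close>, while the weights
    remain those of the whole complex \<open>ts\<close>.\<close>
  have "vertex_weight ws v us = (\<Sum>t\<leftarrow>us. if v \<in> corners t then \<Prod>u\<in>corners t - {v}. ?w u else 0)"
    if "set us \<subseteq> set ts" for us
    using that
  proof (induction us)
    case (Cons t us)
    obtain a b c where t: "t = (a, b, c)" by (cases t)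
    then have "(a, b, c) \<in> set ts" using Cons.prems by simp
    then have d: "distinct [a, b, c]" using properD(1)[OF ts] card_corners by metis
    have "u \<in> vertices (list_complex ts)" if "u \<in> {a, b, c}" for u
      using that \<open>(a, b, c) \<in> set ts\<close> by (force simp: list_complex_def)
    then have w: "lookup ws a = ?w a" "lookup ws b = ?w b" "lookup ws c = ?w c" using ws by simp_all
    have IH: "vertex_weight ws v us = (\<Sum>t\<leftarrow>us. if v \<in> corners t then \<Prod>u\<in>corners t - {v}. ?w u else 0)"
      using Cons by simp
    consider "v = a" | "v = b" | "v = c" | "v \<noteq> a" "v \<noteq> b" "v \<noteq> c" by blast
    then show ?case
    proof cases
      case 1
      have "{a, b, c} - {a} = {b, c}" using d by auto
      then show ?thesis using d IH w unfolding t 1 by simp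
    next
      case 2
      have "{a, b, c} - {b} = {a, c}" using d by auto
      then show ?thesis using d IH w unfolding t 2 by simp
    next
      case 3
      have "{a, b, c} - {c} = {a, b}" using d by auto
      then show ?thesis using d IH w unfolding t 3 by simp
    next
      case 4
      then show ?thesis by (simp add: t IH)
    qed
  qed simp
  then have "vertex_weight ws v ts = (\<Sum>\<sigma>\<in>facets (list_complex ts). if v \<in> \<sigma> then \<Prod>u\<in>\<sigma> - {v}. ?w u else 0)"
    unfolding sum_facets_list_complex[OF ts] by simp
  also have "\<dots> = weight (list_complex ts) (Suc n) v"
    using finite_corners by (simp add: facets_list_complex[OF ts] sum.inter_filter)
  finally show ?thesis .
qed

lemma next_weights_correct:
  assumes ts: "proper ts" and ws: "\<And>u. u \<in> vertices (list_complex ts) \<Longrightarrow> lookup ws u = weight (list_complex ts) n u"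
    and dom: "vertices (list_complex ts) \<subseteq> set (map fst ws)" and u: "u \<in> vertices (list_complex ts)"
  shows "lookup (next_weights ts ws) u = weight (list_complex ts) (Suc n) u"
proof -
  have *: "lookup (map (\<lambda>(v, _). (v, g v)) xs) u = g u" if "u \<in> set (map fst xs)" for g :: "'a \<Rightarrow> nat" and xs :: "('a \<times> nat) list"
    using that by (induction xs) (force simp: image_iff)+
  have "u \<in> set (map fst ws)" using u dom by blast
  from *[OF this, of "\<lambda>v. vertex_weight ws v ts"] show ?thesis
    unfolding next_weights_def by (simp only: vertex_weight_correct[OF ts ws])
qed

lemma map_fst_next_weights [simp]: "map fst (next_weights ts ws) = map fst ws"
  by (induction ws) (auto simp: next_weights_def)

lemma list_weight_correct:
  assumes ts: "proper ts" and ws: "\<And>u. u \<in> vertices (list_complex ts) \<Longrightarrow> lookup ws u = weight (list_complex ts) n u"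
  shows "list_weight ws ts = total_weight (list_complex ts) n"
proof -
  have "list_weight ws us = (\<Sum>t\<leftarrow>us. \<Prod>u\<in>corners t. weight (list_complex ts) n u)"
    if "set us \<subseteq> set ts" for us
    using that
  proof (induction us)
    case (Cons t us)
    obtain a b c where t: "t = (a, b, c)" by (cases t)
    then have "(a, b, c) \<in> set ts" using Cons.prems by simp
    then have d: "distinct [a, b, c]" using properD(1)[OF ts] card_corners by metis
    have "u \<in> vertices (list_complex ts)" if "u \<in> {a, b, c}" for u
      using that \<open>(a, b, c) \<in> set ts\<close> by (force simp: list_complex_def)
    then have w: "lookup ws u = weight (list_complex ts) n u" if "u \<in> {a, b, c}" for u using ws that by simp
    have "list_weight ws us = (\<Sum>t\<leftarrow>us. \<Prod>u\<in>corners t. weight (list_complex ts) n u)"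
      using Cons by simp
    then show ?case using d by (simp add: t w mult.assoc)
  qed simp
  then show ?thesis unfolding total_weight_def sum_facets_list_complex[OF ts] by simp
qed

text \<open>Three rounds are enough: the resulting values on the 28 complexes are pairwise
  different.\<close>

definition invariant :: "('v \<times> 'v \<times> 'v) list \<Rightarrow> 'v list \<Rightarrow> nat" where
  "invariant ts vs = list_weight (next_weights ts (next_weights ts (next_weights ts (map (\<lambda>v. (v, 1)) vs)))) ts"

lemma invariant_correct:
  assumes ts: "proper ts" and vs: "vertices (list_complex ts) = set vs"
  shows "invariant ts vs = total_weight (list_complex ts) 3"
proof -
  have 0: "lookup (map (\<lambda>v. (v, 1)) vs) u = weight (list_complex ts) 0 u" if "u \<in> vertices (list_complex ts)" for u
  proof -
    have "lookup (map (\<lambda>v. (v, 1::nat)) vs) u = 1" if "u \<in> set vs" using that by (induction vs) auto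
    then show ?thesis using that vs by simp
  qed
  define W where "W = map (\<lambda>v. (v, 1::nat)) vs"
  have dom: "vertices (list_complex ts) \<subseteq> set (map fst W)" by (simp add: vs W_def comp_def)
  have 1: "lookup (next_weights ts W) u = weight (list_complex ts) (Suc 0) u"
    if "u \<in> vertices (list_complex ts)" for u
    using next_weights_correct[OF ts 0[folded W_def] dom that] .
  have 2: "lookup (next_weights ts (next_weights ts W)) u = weight (list_complex ts) (Suc (Suc 0)) u"
    if "u \<in> vertices (list_complex ts)" for u
    by (rule next_weights_correct[OF ts 1 _ that]) (simp_all only: map_fst_next_weights dom)
  have 3: "lookup (next_weights ts (next_weights ts (next_weights ts W))) u = weight (list_complex ts) 3 u"
    if "u \<in> vertices (list_complex ts)" for u
    unfolding numeral_3_eq_3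
    by (rule next_weights_correct[OF ts 2 _ that]) (simp_all only: map_fst_next_weights dom)
  show ?thesis unfolding invariant_def W_def[symmetric] by (rule list_weight_correct[OF ts 3])
qed

section \<open>Polyhedral realizations with integer coordinates\<close>

type_synonym point = "int \<times> int \<times> int"

fun diff :: "point \<Rightarrow> point \<Rightarrow> point" where
  "diff (a, b, c) (d, e, f) = (a - d, b - e, c - f)"

fun cross_prod :: "point \<Rightarrow> point \<Rightarrow> point" where
  "cross_prod (a, b, c) (d, e, f) = (b * f - c * e, c * d - a * f, a * e - b * d)"

fun scalar_prod :: "point \<Rightarrow> point \<Rightarrow> int" where
  "scalar_prod (a, b, c) (d, e, f) = a * d + b * e + c * f"

fun vec_of :: "point \<Rightarrow> real^3" where
  "vec_of (x, y, z) = vector [real_of_int x, real_of_int y, real_of_int z]"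

text \<open>Six times the signed volume of the tetrahedron, kept integral so that its sign is
  decided exactly.\<close>

definition orient :: "point \<Rightarrow> point \<Rightarrow> point \<Rightarrow> point \<Rightarrow> int" where
  "orient A B C P = scalar_prod (cross_prod (diff B A) (diff C A)) (diff P A)"

text \<open>If the determinants do not all have the same weak sign, then the line through \<open>U\<close> and \<open>W\<close>
  misses the triangle \<open>A B C\<close>.\<close>

definition straddles :: "point \<Rightarrow> point \<Rightarrow> point \<Rightarrow> point \<Rightarrow> point \<Rightarrow> bool" where
  "straddles A B C U W \<longleftrightarrow>
     (0 < orient U A B W \<or> 0 < orient U B C W \<or> 0 < orient U C A W) \<and>
     (orient U A B W < 0 \<or> orient U B C W < 0 \<or> orient U C A W < 0)"

lemma orient_self [simp]: "orient A B C A = 0" "orient A B C B = 0" "orient A B C C = 0"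
  by (cases A; cases B; cases C; simp add: orient_def algebra_simps)+

lemma orient_swap: "orient A B D C = - orient A B C D" "orient A C B D = - orient A B C D" "orient B A C D = - orient A B C D"
  by (cases A; cases B; cases C; cases D; simp add: orient_def algebra_simps)+

text \<open>Being affine in the last point, the determinant is annihilated by every affine
  dependence. Each plane spanned by vertices thus yields one linear equation for the
  coefficients.\<close>

lemma orient_affine:
  obtains k l m n where "\<And>x y z. orient A B C (x, y, z) = k * x + l * y + m * z + n"
proof -
  obtain k l m where n: "cross_prod (diff B A) (diff C A) = (k, l, m)" by (metis prod_cases3)
  obtain a b c where A: "A = (a, b, c)" by (metis prod_cases3)
  have "orient A B C (x, y, z) = k * x + l * y + m * z + - (k * a + l * b + m * c)" for x y z
    unfolding orient_def n by (simp add: A algebra_simps)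
  then show ?thesis by (rule that)
qed

text \<open>Expansion of a 5-by-5 determinant with a repeated row: the alternating volumes of the
  five tetrahedra on five points are the coefficients of an affine dependence. This is the row of
  ones; \<open>orient_relation_coord\<close> treats the coordinate rows.\<close>

lemma orient_relation:
  "orient B C D E - orient A C D E + orient A B D E - orient A B C E + orient A B C D = 0"
  by (cases A; cases B; cases C; cases D; cases E; simp add: orient_def algebra_simps)

text \<open>Cramer's rule for four vectors in space, read in one coordinate. They will be the
  differences from the first of five points.\<close>

lemma cramer_relation:
  assumes "f = fst \<or> f = fst \<circ> snd \<or> f = snd \<circ> snd"
  shows "scalar_prod (cross_prod b d) e * f c + scalar_prod (cross_prod b c) d * f e =
    scalar_prod (cross_prod c d) e * f b + scalar_prod (cross_prod b c) e * f d"
  using assms by (cases b; cases c; cases d; cases e; elim disjE; simp add: algebra_simps)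

lemma orient_relation_coord:
  assumes f: "f = fst \<or> f = fst \<circ> snd \<or> f = snd \<circ> snd"
  shows "orient B C D E * f A - orient A C D E * f B + orient A B D E * f C - orient A B C E * f D + orient A B C D * f E = 0"
proof -
  have fd: "f (diff X A) = f X - f A" for X using f by (cases X; cases A; elim disjE; simp)
  have "orient A B D E * (f C - f A) + orient A B C D * (f E - f A) =
      orient A C D E * (f B - f A) + orient A B C E * (f D - f A)"
    using cramer_relation[OF f, of "diff B A" "diff D A" "diff E A" "diff C A"] unfolding orient_def fd .
  moreover have *: "orient B C D E = orient A C D E - orient A B D E + orient A B C E - orient A B C D"
    using orient_relation[of B C D E A] by linarith
  ultimately show ?thesis unfolding * by (simp add: algebra_simps)
qed

section \<open>Affine dependences supported on two triangles\<close>

definition dependence :: "'v set \<Rightarrow> ('v \<Rightarrow> point) \<Rightarrow> ('v \<Rightarrow> real) \<Rightarrow> bool" where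
  "dependence V p z \<longleftrightarrow> (\<Sum>v\<in>V. z v) = 0 \<and> (\<Sum>v\<in>V. z v * fst (p v)) = 0 \<and>
     (\<Sum>v\<in>V. z v * fst (snd (p v))) = 0 \<and> (\<Sum>v\<in>V. z v * snd (snd (p v))) = 0"

lemma dependence_orient:
  assumes "dependence V p z"
  shows "(\<Sum>v\<in>V. z v * orient A B C (p v)) = 0"
proof -
  obtain k l m n where o: "\<And>x y z. orient A B C (x, y, z) = k * x + l * y + m * z + n"
    using orient_affine by blast
  have "z v * orient A B C (p v) = k * (z v * fst (p v)) + l * (z v * fst (snd (p v))) + m * (z v * snd (snd (p v))) + n * z v" for v
    using o[of "fst (p v)" "fst (snd (p v))" "snd (snd (p v))"] by (simp add: algebra_simps)
  then have "(\<Sum>v\<in>V. z v * orient A B C (p v)) = k * (\<Sum>v\<in>V. z v * fst (p v)) + l * (\<Sum>v\<in>V. z v * fst (snd (p v))) +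
      m * (\<Sum>v\<in>V. z v * snd (snd (p v))) + n * (\<Sum>v\<in>V. z v)"
    by (simp add: sum.distrib sum_distrib_left)
  then show ?thesis using assms by (simp add: dependence_def)
qed

lemma dependence_uminus: "dependence V p z \<Longrightarrow> dependence V p (\<lambda>v. - z v)"
  by (simp add: dependence_def sum_negf)

lemma dependence_diff_scale:
  assumes "dependence V p z" "dependence V p w"
  shows "dependence V p (\<lambda>v. z v - t * w v)"
proof -
  have "(\<Sum>v\<in>V. (z v - t * w v) * c v) = (\<Sum>v\<in>V. z v * c v) - t * (\<Sum>v\<in>V. w v * c v)" for c :: "'a \<Rightarrow> real"
    by (simp add: left_diff_distrib sum_subtractf sum_distrib_left mult.assoc)
  from this[of "\<lambda>_. 1"] this show ?thesis using assms by (simp add: dependence_def)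
qed

text \<open>The finite test behind embeddedness. An edge has to be examined only when its ends lie
  on opposite sides of the plane of the triangle. Four vertices guarantee one outside each triangle,
  and \<open>plane\<close> then makes the triangle non-degenerate.\<close>

locale generic_position =
  fixes V :: "'v set" and p :: "'v \<Rightarrow> point" and ts :: "('v \<times> 'v \<times> 'v) list"
  assumes finV: "finite V" and V4: "card V \<ge> 4"
    and ts_V: "t \<in> set ts \<Longrightarrow> corners t \<subseteq> V" and ts_3: "t \<in> set ts \<Longrightarrow> card (corners t) = 3"
    and plane: "(a, b, c) \<in> set ts \<Longrightarrow> v \<in> V \<Longrightarrow> v \<notin> {a, b, c} \<Longrightarrow> orient (p a) (p b) (p c) (p v) \<noteq> 0"
    and edge: "(a, b, c) \<in> set ts \<Longrightarrow> s \<in> set ts \<Longrightarrow> {u, w} \<subseteq> corners s \<Longrightarrow> {u, w} \<inter> {a, b, c} = {} \<Longrightarrow>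
        0 < orient (p a) (p b) (p c) (p u) \<Longrightarrow> orient (p a) (p b) (p c) (p w) < 0 \<Longrightarrow>
        straddles (p a) (p b) (p c) (p u) (p w)"
begin

lemma supported_sum:
  assumes "S \<subseteq> V" "\<And>v. v \<in> V \<Longrightarrow> v \<notin> S \<Longrightarrow> z v = 0"
  shows "(\<Sum>v\<in>V. z v * c v) = (\<Sum>v\<in>S. z v * (c v :: real))"
  using assms finV by (intro sum.mono_neutral_right) auto

text \<open>Some vertex \<open>g\<close> lies off the plane of the triangle. The plane through
  \<open>g\<close> and two corners annihilates these corners, so the coefficient of the third corner
  times a non-zero volume is 0.\<close>

lemma triangle_independent:
  assumes t: "t \<in> set ts" and dep: "dependence V p z" and supp: "\<And>v. v \<in> V \<Longrightarrow> v \<notin> corners t \<Longrightarrow> z v = 0"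
  shows "\<forall>v\<in>V. z v = 0"
proof -
  obtain a b c where abc: "t = (a, b, c)" by (cases t)
  have d: "distinct [a, b, c]" using ts_3[OF t] card_corners unfolding abc by metis
  have sub: "{a, b, c} \<subseteq> V" using ts_V[OF t] abc by simp
  have "card {a, b, c} \<le> 3" by (simp add: card_insert_if)
  then have "V \<noteq> {a, b, c}" using V4 by auto
  then obtain g where g: "g \<in> V" "g \<notin> {a, b, c}" using sub by blast
  have D: "orient (p a) (p b) (p c) (p g) \<noteq> 0" using plane g t abc by blast
  have expand: "z a * orient A B C (p a) + z b * orient A B C (p b) + z c * orient A B C (p c) = 0" for A B C
    using dependence_orient[OF dep, of A B C] supported_sum[OF sub, of z "\<lambda>v. orient A B C (p v)"] supp d abc
    by (simp add: add.assoc)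
  have "z a = 0" using expand[of "p b" "p c" "p g"] D orient_swap by (metis add.right_neutral mult_eq_0_iff neg_0_equal_iff_equal of_int_eq_0_iff orient_self(1,2) of_int_0 mult_zero_right)
  moreover have "z b = 0" using expand[of "p a" "p c" "p g"] D orient_swap \<open>z a = 0\<close> by (metis add.right_neutral add.left_neutral mult_eq_0_iff neg_0_equal_iff_equal of_int_eq_0_iff orient_self(1,2) of_int_0 mult_zero_right)
  moreover have "z c = 0" using expand[of "p a" "p b" "p g"] D orient_swap calculation by (metis add.right_neutral add.left_neutral mult_eq_0_iff neg_0_equal_iff_equal of_int_eq_0_iff orient_self(1,2) of_int_0 mult_zero_right)
  ultimately show ?thesis using supp abc by auto
qed

text \<open>The plane of the triangle forces the ends of the edge onto opposite sides, unless their
  coefficients vanish. Planes through the edge and one corner show that the coefficients of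
  \<open>a\<close>, \<open>b\<close>, \<open>c\<close> are proportional to the three determinants of
  \<open>straddles\<close>. Coefficients of one weak sign contradict determinants of both
  signs.\<close>

lemma edge_triangle:
  assumes t: "t \<in> set ts" and s: "s \<in> set ts" "{u, w} \<subseteq> corners s" "u \<noteq> w" and disj: "u \<notin> corners t" "w \<notin> corners t"
    and dep: "dependence V p z" and pos: "0 \<le> z u" "0 \<le> z w" and neg: "\<And>v. v \<in> corners t \<Longrightarrow> z v \<le> 0"
    and supp: "\<And>v. v \<in> V \<Longrightarrow> v \<notin> corners t \<Longrightarrow> v \<notin> {u, w} \<Longrightarrow> z v = 0"
  shows "\<forall>v\<in>V. z v = 0"
proof -
  obtain a b c where abc: "t = (a, b, c)" by (cases t)
  have d: "distinct [a, b, c]" using ts_3[OF t] card_corners unfolding abc by metis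
  have d': "u \<noteq> a" "u \<noteq> b" "u \<noteq> c" "w \<noteq> a" "w \<noteq> b" "w \<noteq> c" using disj abc by auto
  have uV: "u \<in> V" "w \<in> V" using ts_V[OF s(1)] s(2) by auto
  have sub: "{u, w, a, b, c} \<subseteq> V" using ts_V[OF t] abc uV by auto
  have supp': "z v = 0" if "v \<in> V" "v \<notin> {u, w, a, b, c}" for v using supp that abc by auto
  have neg': "z a \<le> 0" "z b \<le> 0" "z c \<le> 0" using neg abc by auto
  have expand: "z u * orient A B C (p u) + z w * orient A B C (p w) + z a * orient A B C (p a) +
      z b * orient A B C (p b) + z c * orient A B C (p c) = 0" for A B C
    using dependence_orient[OF dep, of A B C] supported_sum[OF sub, of z "\<lambda>v. orient A B C (p v)"] supp' d d' s(3)
    by (simp add: add.assoc)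
  have total: "z u + z w + z a + z b + z c = 0"
    using dep supported_sum[OF sub, of z "\<lambda>_. 1"] supp' d d' s(3) by (simp add: dependence_def add.assoc)
  have t': "(a, b, c) \<in> set ts" using t abc by simp
  define f where "f = orient (p a) (p b) (p c)"
  have f0: "f (p u) \<noteq> 0" "f (p w) \<noteq> 0" using plane[OF t'] uV disj abc by (auto simp: f_def)
  have f: "z u * f (p u) + z w * f (p w) = 0" using expand[of "p a" "p b" "p c"] by (simp add: f_def)
  have "z u = 0 \<and> z w = 0"
  proof (rule ccontr)
    assume nz: "\<not> (z u = 0 \<and> z w = 0)"
    have zu: "z u > 0" "z w > 0"
      using nz f f0 pos by (metis add.left_neutral add.right_neutral less_eq_real_def mult_eq_0_iff of_int_eq_0_iff)+
    have "f (p u) > 0 \<and> f (p w) < 0 \<or> f (p w) > 0 \<and> f (p u) < 0"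
    proof (rule ccontr)
      assume "\<not> ?thesis"
      then consider "f (p u) > 0" "f (p w) > 0" | "f (p u) < 0" "f (p w) < 0" using f0 by linarith
      then show False
      proof cases
        case 1
        then have "z u * f (p u) > 0" "z w * f (p w) > 0" using zu by auto
        then show False using f by linarith
      next
        case 2
        then have "z u * f (p u) < 0" "z w * f (p w) < 0" using zu by (auto simp: mult_pos_neg)
        then show False using f by linarith
      qed
    qed
    \<comment> \<open>The ends are renamed so that \<open>x\<close> is on the positive side, the
      form in which \<open>edge\<close> is assumed.\<close>
    then obtain x y where xy: "{x, y} = {u, w}" "f (p x) > 0" "f (p y) < 0" by (metis insert_commute)
    have "straddles (p a) (p b) (p c) (p x) (p y)"
      using edge[OF t' s(1), of x y] xy s(2) disj abc by (auto simp: f_def)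
    moreover have z3: "z x * orient A B C (p x) + z y * orient A B C (p y) = z u * orient A B C (p u) + z w * orient A B C (p w)" for A B C
      using xy(1) by (auto simp: doubleton_eq_iff)
    define da db dc where "da = orient (p x) (p b) (p c) (p y)" and "db = orient (p x) (p c) (p a) (p y)"
      and "dc = orient (p x) (p a) (p b) (p y)"
    have o: "orient (p x) (p y) (p a) (p b) = dc" "orient (p x) (p y) (p b) (p a) = - dc"
      "orient (p x) (p y) (p b) (p c) = da" "orient (p x) (p y) (p c) (p b) = - da"
      "orient (p x) (p y) (p c) (p a) = db" "orient (p x) (p y) (p a) (p c) = - db"
      unfolding da_def db_def dc_def using orient_swap by (metis add.inverse_inverse)+
    have e: "z b * dc = z c * db" "z c * da = z a * dc" "z a * db = z b * da"
      using expand[of "p x" "p y" "p a"] expand[of "p x" "p y" "p b"] expand[of "p x" "p y" "p c"]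
        z3[of "p x" "p y" "p a"] z3[of "p x" "p y" "p b"] z3[of "p x" "p y" "p c"] o by simp_all
    have lt: "z a + z b + z c < 0" using total zu by linarith
    \<comment> \<open>Two determinants of opposite sign force the two corresponding coefficients to
      vanish, and then the third as well, against the negative sum. Cyclic rotation covers the other
      pairs.\<close>
    have key: False if "z1 * d3 = z2 * (d2::int)" "z2 * d1 = z0 * d3" "z0 * d2 = z1 * d1"
      "z0 \<le> 0" "z1 \<le> 0" "z2 \<le> 0" "z0 + z1 + z2 < 0" "(0 < d1 \<and> d2 < 0) \<or> (0 < d2 \<and> d1 < 0)" for z0 z1 z2 :: real and d1 d2 d3 :: int
    proof -
      have "z0 * d2 * d1 = z1 * d1 * d1" using that(3) by simp
      have "z0 = 0 \<and> z1 = 0"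
        using that(3,4,5,8) by (smt (verit, ccfv_SIG) mult_neg_neg mult_neg_pos of_int_0_less_iff of_int_less_0_iff mult_eq_0_iff)
      then show False using that by auto
    qed
    ultimately show False
      unfolding straddles_def da_def[symmetric] db_def[symmetric] dc_def[symmetric]
      using key[OF e neg' lt] key[OF e(2,3,1) neg'(2,3,1)] key[OF e(3,1,2) neg'(3,1,2)] lt by smt
  qed
  then have "z v = 0" if "v \<in> V" "v \<notin> corners t" for v using that supp by blast
  then show ?thesis using triangle_independent[OF t dep] by blast
qed

end

lemma vec_of_nth: "vec_of P $ 1 = fst P" "vec_of P $ 2 = fst (snd P)" "vec_of P $ 3 = snd (snd P)"
  by (cases P; simp)+

lemma remaining_two:
  assumes "card A = 3" "x \<in> A"
  shows "\<exists>j k. {j, k} = A - {x} \<and> j \<noteq> k"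
proof -
  have "card (A - {x}) = 2" using assms by simp
  then show ?thesis unfolding card_2_iff by blast
qed

context generic_position
begin

lemma triangle_edge:
  assumes t: "t \<in> set ts" and s: "s \<in> set ts" "{u, w} \<subseteq> corners s" "u \<noteq> w" and disj: "u \<notin> corners t" "w \<notin> corners t"
    and dep: "dependence V p z" and neg: "z u \<le> 0" "z w \<le> 0" and pos: "\<And>v. v \<in> corners t \<Longrightarrow> 0 \<le> z v"
    and supp: "\<And>v. v \<in> V \<Longrightarrow> v \<notin> corners t \<Longrightarrow> v \<notin> {u, w} \<Longrightarrow> z v = 0"
  shows "\<forall>v\<in>V. z v = 0"
  using edge_triangle[OF t s disj dependence_uminus[OF dep]] neg pos supp by simp

text \<open>If the images of two disjoint triangles met, one could subtract a multiple of the affine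
  dependence among five of the six vertices until an edge of one triangle meets the other.\<close>

lemma disjoint_triangles:
  assumes s: "s \<in> set ts" and t: "t \<in> set ts" and disj: "corners s \<inter> corners t = {}"
    and dep: "dependence V p z" and pos: "\<And>v. v \<in> V \<Longrightarrow> v \<notin> corners s \<Longrightarrow> z v \<le> 0"
    and neg: "\<And>v. v \<in> V \<Longrightarrow> v \<notin> corners t \<Longrightarrow> 0 \<le> z v"
  shows "\<forall>v\<in>V. z v = 0"
proof -
  obtain a b g where abg: "s = (a, b, g)" by (cases s)
  obtain c d e where cde: "t = (c, d, e)" by (cases t)
  have d1: "distinct [a, b, g]" "distinct [c, d, e]"
    using ts_3[OF s] ts_3[OF t] card_corners unfolding abg cde by metis+
  have d2: "distinct [a, b, c, d, e]" "g \<notin> {a, b, c, d, e}" using d1 disj abg cde by auto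
  have V: "{a, b, g, c, d, e} \<subseteq> V" using ts_V[OF s] ts_V[OF t] abg cde by auto
  have supp: "z v = 0" if "v \<in> V" "v \<notin> corners s" "v \<notin> corners t" for v
    using pos[OF that(1,2)] neg[OF that(1,3)] by simp
  \<comment> \<open>The dependence among five points from \<open>orient_relation\<close>; it leaves
    out the corner \<open>g\<close>.\<close>
  define w :: "'v \<Rightarrow> real" where "w = (\<lambda>v.
     if v = a then orient (p b) (p c) (p d) (p e) else if v = b then - orient (p a) (p c) (p d) (p e)
     else if v = c then orient (p a) (p b) (p d) (p e) else if v = d then - orient (p a) (p b) (p c) (p e)
     else if v = e then orient (p a) (p b) (p c) (p d) else 0)"
  have w_sum: "(\<Sum>v\<in>V. w v * f v) = w a * f a + w b * f b + w c * f c + w d * f d + w e * f e" for f :: "'v \<Rightarrow> real"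
  proof -
    have "(\<Sum>v\<in>V. w v * f v) = (\<Sum>v\<in>{a, b, c, d, e}. w v * f v)"
      using V by (intro supported_sum) (auto simp: w_def)
    then show ?thesis using d2 by (simp add: add.assoc)
  qed
  have w_val: "w a = orient (p b) (p c) (p d) (p e)" "w b = - orient (p a) (p c) (p d) (p e)"
    "w c = orient (p a) (p b) (p d) (p e)" "w d = - orient (p a) (p b) (p c) (p e)" "w e = orient (p a) (p b) (p c) (p d)"
    using d2(1) by (auto simp: w_def)
  have wdep: "dependence V p w"
  proof -
    have "(\<Sum>v\<in>V. w v * of_int (f (p v))) = 0" if "f = fst \<or> f = fst \<circ> snd \<or> f = snd \<circ> snd" for f
      using arg_cong[OF orient_relation_coord[OF that, of "p b" "p c" "p d" "p e" "p a"], of real_of_int]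
      unfolding w_sum w_val by simp
    from this[of fst] this[of "fst \<circ> snd"] this[of "snd \<circ> snd"] show ?thesis
      using w_sum[of "\<lambda>_. 1"] arg_cong[OF orient_relation[of "p b" "p c" "p d" "p e" "p a"], of real_of_int]
      unfolding dependence_def w_val by simp
  qed
  have wg: "w g = 0" using d2(2) by (auto simp: w_def)
  \<comment> \<open>Up to sign this coefficient is the volume spanned by the triangle
    \<open>t\<close> and \<open>a\<close>, non-zero by general position. Hence the minimum below is
    over a non-empty set.\<close>
  have wb: "w b \<noteq> 0"
  proof -
    have "orient (p c) (p d) (p e) (p a) \<noteq> 0" using plane[of c d e a] t V d2 cde by auto
    then show ?thesis unfolding w_val using orient_swap by (metis neg_equal_0_iff_equal of_int_eq_0_iff)
  qed
  show ?thesis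
  proof (cases "z g = 0")
    case True
    show ?thesis
    proof (rule edge_triangle[OF t s, of a b])
      show "z v = 0" if "v \<in> V" "v \<notin> corners t" "v \<notin> {a, b}" for v
        using that True supp[of v] abg by auto
      show "z v \<le> 0" if "v \<in> corners t" for v using pos[of v] that disj V cde by auto
    qed (use neg[of a] neg[of b] d2 V dep abg cde in auto)
  next
    case False
    define I where "I = {v \<in> {a, b, c, d, e}. w v \<noteq> 0}"
    have "finite I" "b \<in> I" using wb by (auto simp: I_def)
    \<comment> \<open>As in Caratheodory's theorem, a smallest ratio is taken: subtracting
      \<open>r * w\<close> makes the coefficient of \<open>i\<close> vanish and reverses no sign.
      The coefficient of \<open>g\<close> is unchanged, so the vanishing of \<open>y\<close>
      contradicts \<open>z g \<noteq> 0\<close>.\<close>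
    then obtain i where i: "i \<in> I" and min: "\<And>v. v \<in> I \<Longrightarrow> \<bar>z i\<bar> / \<bar>w i\<bar> \<le> \<bar>z v\<bar> / \<bar>w v\<bar>"
      using ex_min_if_finite[of "(\<lambda>v. \<bar>z v\<bar> / \<bar>w v\<bar>) ` I"] by (fastforce simp: not_less)
    have wi: "w i \<noteq> 0" using i by (simp add: I_def)
    define r where "r = z i / w i"
    define y where "y = (\<lambda>v. z v - r * w v)"
    have ydep: "dependence V p y" unfolding y_def by (rule dependence_diff_scale[OF dep wdep])
    have yi: "y i = 0" using wi by (simp add: y_def r_def)
    have yg: "y g = z g" by (simp add: y_def wg)
    have le: "\<bar>r * w v\<bar> \<le> \<bar>z v\<bar>" if "v \<in> {a, b, c, d, e, g}" for v
    proof (cases "w v = 0")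
      case False
      then have "v \<in> I" using that wg by (auto simp: I_def)
      then have "\<bar>r\<bar> \<le> \<bar>z v\<bar> / \<bar>w v\<bar>" using min[of v] by (simp add: r_def)
      then show ?thesis using False by (simp add: abs_mult pos_le_divide_eq)
    qed simp
    have y_pos: "0 \<le> y v" if "v \<in> corners s" for v
    proof -
      have "0 \<le> z v" using neg[of v] that disj V abg by auto
      then show ?thesis using le[of v] that abg by (auto simp: y_def)
    qed
    have y_neg: "y v \<le> 0" if "v \<in> corners t" for v
    proof -
      have "z v \<le> 0" using pos[of v] that disj V cde by auto
      then show ?thesis using le[of v] that cde by (auto simp: y_def)
    qed
    have y_supp: "y v = 0" if "v \<in> V" "v \<notin> corners s" "v \<notin> corners t" for v
    proof -
      have "w v = 0" using that abg cde by (auto simp: w_def)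
      then show ?thesis using supp[OF that] by (simp add: y_def)
    qed
    have "\<forall>v\<in>V. y v = 0"
    \<comment> \<open>Without \<open>i\<close>, one of the two triangles is reduced to an
      edge.\<close>
    proof (cases "i \<in> corners t")
      case True
      then obtain j k where jk: "{j, k} = corners t - {i}" "j \<noteq> k"
        using remaining_two[OF ts_3[OF t]] by blast
      show ?thesis
      proof (rule triangle_edge[OF s t _ jk(2)])
        show "y v = 0" if "v \<in> V" "v \<notin> corners s" "v \<notin> {j, k}" for v
          using that y_supp[of v] yi jk(1) by (cases "v = i") auto
        show "0 \<le> y v" if "v \<in> corners s" for v by (rule y_pos[OF that])
        show "y j \<le> 0" "y k \<le> 0" using y_neg jk(1) by blast+
        show "{j, k} \<subseteq> corners t" "j \<notin> corners s" "k \<notin> corners s" using jk(1) disj by blast+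
      qed (rule ydep)
    next
      case False
      then have "i \<in> corners s" using i abg cde by (auto simp: I_def)
      then obtain j k where jk: "{j, k} = corners s - {i}" "j \<noteq> k"
        using remaining_two[OF ts_3[OF s]] by blast
      show ?thesis
      proof (rule edge_triangle[OF t s _ jk(2)])
        show "y v = 0" if "v \<in> V" "v \<notin> corners t" "v \<notin> {j, k}" for v
          using that y_supp[of v] yi jk(1) by (cases "v = i") auto
        show "y v \<le> 0" if "v \<in> corners t" for v by (rule y_neg[OF that])
        show "0 \<le> y j" "0 \<le> y k" using y_pos jk(1) by blast+
        show "{j, k} \<subseteq> corners s" "j \<notin> corners t" "k \<notin> corners t" using jk(1) disj by blast+
      qed (rule ydep)
    qed
    then have "z g = 0" using yg V by auto
    then show ?thesis using False by simp
  qed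
qed

text \<open>A single common corner is assigned to one of the triangles by the sign of its
  coefficient, which leaves an edge of the other. If two corners are shared, \<open>t\<close> has at
  most one corner outside \<open>s\<close>; the plane of \<open>s\<close> makes its coefficient
  vanish, and the independence of one triangle finishes the argument.\<close>

lemma dependence_between_triangles:
  assumes s: "s \<in> set ts" and t: "t \<in> set ts"
    and dep: "dependence V p z" and pos: "\<And>v. v \<in> V \<Longrightarrow> v \<notin> corners s \<Longrightarrow> z v \<le> 0"
    and neg: "\<And>v. v \<in> V \<Longrightarrow> v \<notin> corners t \<Longrightarrow> 0 \<le> z v"
  shows "\<forall>v\<in>V. z v = 0"
proof (cases "corners s \<inter> corners t = {}")
  case True
  then show ?thesis using disjoint_triangles[OF s t _ dep] pos neg by blast
next
  case False
  then obtain x where x: "x \<in> corners s" "x \<in> corners t" by blast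
  have V: "corners s \<subseteq> V" "corners t \<subseteq> V" using ts_V s t by auto
  have supp: "z v = 0" if "v \<in> V" "v \<notin> corners s" "v \<notin> corners t" for v
    using pos[OF that(1,2)] neg[OF that(1,3)] by simp
  obtain j k where jk: "{j, k} = corners s - {x}" "j \<noteq> k" using remaining_two[OF ts_3[OF s] x(1)] by blast
  obtain l m where lm: "{l, m} = corners t - {x}" "l \<noteq> m" using remaining_two[OF ts_3[OF t] x(2)] by blast
  show ?thesis
  proof (cases "corners s \<inter> corners t = {x}")
    case True
    show ?thesis
    proof (cases "0 \<le> z x")
      case zx: True
      show ?thesis
      proof (rule triangle_edge[OF s t _ lm(2)])
        show "z v = 0" if "v \<in> V" "v \<notin> corners s" "v \<notin> {l, m}" for v
          using supp that x lm(1) by blast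
        show "z l \<le> 0" "z m \<le> 0" using pos lm(1) True V by blast+
        show "0 \<le> z v" if "v \<in> corners s" for v
          using that neg[of v] V True zx by (cases "v = x") blast+
      qed (use dep lm(1) True in blast)+
    next
      case zx: False
      then have zx: "z x \<le> 0" by simp
      show ?thesis
      proof (rule edge_triangle[OF t s _ jk(2)])
        show "z v = 0" if "v \<in> V" "v \<notin> corners t" "v \<notin> {j, k}" for v
          using supp that x jk(1) by blast
        show "0 \<le> z j" "0 \<le> z k" using neg jk(1) True V by blast+
        show "z v \<le> 0" if "v \<in> corners t" for v
          using that pos[of v] V True zx by (cases "v = x") blast+
      qed (use dep jk(1) True in blast)+
    qed
  next
    case False
    then obtain x' where x': "x' \<in> corners s" "x' \<in> corners t" "x' \<noteq> x" using x by blast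
    have ct: "corners t = {x, l, m}" using lm(1) x(2) by blast
    then have "x' = l \<or> x' = m" using x' by blast
    then obtain b where ct': "corners t = {x, x', b}" using ct by (metis insert_commute)
    then have b: "corners t \<subseteq> corners s \<union> {b}" using x x' by auto
    have "z v = 0" if v: "v \<in> V" "v \<notin> corners s" for v
    proof (cases "v \<in> corners t")
      case False
      then show ?thesis using supp v by blast
    next
      case True
      then have "v = b" using v b by auto
      obtain a1 a2 a3 where a: "s = (a1, a2, a3)" by (cases s)
      define f where "f = (\<lambda>v. orient (p a1) (p a2) (p a3) (p v))"
      have "f v \<noteq> 0" using plane[of a1 a2 a3 v] s v a by (auto simp: f_def)
      moreover have "(\<Sum>u\<in>V. z u * f u) = (\<Sum>u\<in>{v}. z u * f u)"
      proof (intro sum.mono_neutral_right ballI)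
        fix u assume u: "u \<in> V - {v}"
        show "z u * f u = 0"
        proof (cases "u \<in> corners s")
          case True
          then show ?thesis by (auto simp: f_def a)
        next
          case False
          then have "u \<notin> corners t" using u b \<open>v = b\<close> by blast
          then show ?thesis using supp False u by simp
        qed
      qed (use finV v in auto)
      ultimately show ?thesis using dependence_orient[OF dep, of "p a1" "p a2" "p a3"] by (simp add: f_def)
    qed
    then show ?thesis using triangle_independent[OF s dep] by blast
  qed
qed

lemma polyhedral:
  assumes V: "vertices (list_complex ts) = V"
  shows "polyhedral_realization (list_complex ts) (\<lambda>v. vec_of (p v))"
  unfolding polyhedral_realization_def
proof (rule inj_onI)
  fix x y assume x: "x \<in> underlying_space (list_complex ts)" and y: "y \<in> underlying_space (list_complex ts)"
    and eq: "simplexwise_linear (list_complex ts) (\<lambda>v. vec_of (p v)) x = simplexwise_linear (list_complex ts) (\<lambda>v. vec_of (p v)) y"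
  have support: "\<exists>s\<in>set ts. {v. q v \<noteq> 0} \<subseteq> corners s" if "q \<in> underlying_space (list_complex ts)" for q
    using that by (auto simp: underlying_space_def list_complex_def generated_complex_def)
  obtain s where s: "s \<in> set ts" "{v. x v \<noteq> 0} \<subseteq> corners s" using support[OF x] by blast
  obtain t where t: "t \<in> set ts" "{v. y v \<noteq> 0} \<subseteq> corners t" using support[OF y] by blast
  have x0: "0 \<le> x v" and y0: "0 \<le> y v" for v using x y by (auto simp: underlying_space_def)
  have "(\<Sum>v\<in>V. x v *\<^sub>R vec_of (p v)) $ i = (\<Sum>v\<in>V. y v *\<^sub>R vec_of (p v)) $ i" for i
    using eq by (simp add: simplexwise_linear_def V)
  then have "(\<Sum>v\<in>V. (x v - y v) * vec_of (p v) $ i) = 0" for i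
    by (simp add: left_diff_distrib sum_subtractf)
  from this[of 1] this[of 2] this[of 3] have "dependence V p (\<lambda>v. x v - y v)"
    using x y unfolding dependence_def vec_of_nth by (simp add: underlying_space_def V sum_subtractf)
  then have "\<forall>v\<in>V. x v - y v = 0"
  proof (rule dependence_between_triangles[OF s(1) t(1)])
    show "x v - y v \<le> 0" if "v \<notin> corners s" for v
    proof -
      have "x v = 0" using that s(2) by blast
      then show ?thesis using y0[of v] by simp
    qed
    show "0 \<le> x v - y v" if "v \<notin> corners t" for v
    proof -
      have "y v = 0" using that t(2) by blast
      then show ?thesis using x0[of v] by simp
    qed
  qed
  moreover have "x v = 0 \<and> y v = 0" if "v \<notin> V" for v
    using that s t ts_V by blast
  ultimately show "x = y" by (intro ext) (metis eq_iff_diff_eq_0)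
qed

end

section \<open>Certificates that can be evaluated\<close>

text \<open>An entry \<open>(v, w, x, y, z)\<close> places \<open>v\<close> at \<open>(x, y, z)\<close> and \<open>w\<close> at its image under the half-turn;
  \<open>c\<close> is the only vertex on the axis.\<close>

fun point_table :: "('v \<times> 'v \<times> int \<times> int \<times> int) list \<Rightarrow> 'v \<Rightarrow> ('v \<times> point) list" where
  "point_table [] c = [(c, (0, 0, 0))]"
| "point_table ((v, w, x, y, z) # qs) c = (v, (x, y, z)) # (w, (- x, - y, z)) # point_table qs c"

fun mirror_table :: "('v \<times> 'v \<times> int \<times> int \<times> int) list \<Rightarrow> 'v \<Rightarrow> ('v \<times> 'v) list" where
  "mirror_table [] c = [(c, c)]"
| "mirror_table ((v, w, q) # qs) c = (v, w) # (w, v) # mirror_table qs c"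

fun for_all :: "('a \<Rightarrow> bool) \<Rightarrow> 'a list \<Rightarrow> bool" where
  "for_all P [] = True"
| "for_all P (x # xs) = (if P x then for_all P xs else False)"

text \<open>A vertex in the plane of the triangle makes the result \<open>None\<close>, so a
  successful split also certifies general position.\<close>

fun split_sides :: "'v \<times> 'v \<times> 'v \<Rightarrow> point \<Rightarrow> point \<Rightarrow> ('v \<times> point) list \<Rightarrow> (('v \<times> point) list \<times> ('v \<times> point) list) option" where
  "split_sides t n A [] = Some ([], [])"
| "split_sides t n A ((v, P) # ps) = (case split_sides t n A ps of None \<Rightarrow> None | Some (us, ws) \<Rightarrow>
     if has_corner v t then Some (us, ws) else
     let d = scalar_prod n (diff P A) in
     if 0 < d then Some ((v, P) # us, ws) else if d < 0 then Some (us, (v, P) # ws) else None)"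

text \<open>Two of the determinants of \<open>straddles\<close> are computed first, and the third
  only if they leave the answer open. If the first is 0, the other two must have opposite signs,
  hence the product.\<close>

definition straddle_check :: "point \<Rightarrow> point \<Rightarrow> point \<Rightarrow> point \<Rightarrow> point \<Rightarrow> bool" where
  "straddle_check A B C U W =
    (let a = diff A U; b = diff B U; c = diff C U; m = diff W U;
         x = scalar_prod (cross_prod a b) m; y = scalar_prod (cross_prod b c) m in
     if 0 < x then if y < 0 then True else scalar_prod (cross_prod c a) m < 0
     else if x < 0 then if 0 < y then True else 0 < scalar_prod (cross_prod c a) m
     else y * scalar_prod (cross_prod c a) m < 0)"

text \<open>All pairs of vertices on opposite sides are tried. A pair that fails the sign test is
  harmless as long as it is not an edge.\<close>

fun triangle_check :: "('v \<times> 'v \<times> 'v) list \<Rightarrow> ('v \<times> point) list \<Rightarrow> 'v \<times> 'v \<times> 'v \<Rightarrow> bool" where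
  "triangle_check ts ps (a, b, c) =
    (let A = lookup ps a; B = lookup ps b; C = lookup ps c in
     case split_sides (a, b, c) (cross_prod (diff B A) (diff C A)) A ps of None \<Rightarrow> False
     | Some (us, ws) \<Rightarrow> for_all (\<lambda>(u, U). for_all (\<lambda>(w, W).
         if straddle_check A B C U W then True else if exists (has_edge u w) ts then False else True) ws) us)"

fun mirror_check :: "('v \<times> 'v) list \<Rightarrow> ('v \<times> point) list \<Rightarrow> 'v \<times> point \<Rightarrow> bool" where
  "mirror_check ms ps (v, (x, y, z)) =
     (let w = lookup ms v in if lookup ms w = v then lookup ps w = (- x, - y, z) else False)"

fun mirror_triangle :: "('v \<times> 'v) list \<Rightarrow> 'v \<times> 'v \<times> 'v \<Rightarrow> 'v \<times> 'v \<times> 'v" where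
  "mirror_triangle ms (a, b, c) = (lookup ms a, lookup ms b, lookup ms c)"

fun has_corners :: "'v \<times> 'v \<times> 'v \<Rightarrow> 'v \<times> 'v \<times> 'v \<Rightarrow> bool" where
  "has_corners (a, b, c) t = has_triangle a b c t"

fun corners_within :: "('v \<times> 'b) list \<Rightarrow> 'v \<times> 'v \<times> 'v \<Rightarrow> bool" where
  "corners_within ps (a, b, c) = (if exists (\<lambda>(v, _). v = a) ps then if exists (\<lambda>(v, _). v = b) ps then
     exists (\<lambda>(v, _). v = c) ps else False else False)"

fun different :: "'v list \<Rightarrow> bool" where
  "different [] = True"
| "different (v # vs) = (if exists (\<lambda>w. w = v) vs then False else different vs)"

text \<open>Everything about one surface that is a property of its list and coordinates; the
  homeomorphism type is left to the sequences of moves.\<close>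

definition certificate :: "('v \<times> 'v \<times> 'v) list \<Rightarrow> ('v \<times> 'v \<times> int \<times> int \<times> int) list \<Rightarrow> 'v \<Rightarrow> nat \<Rightarrow> bool" where
  "certificate ts qs c n =
    (let ps = point_table qs c; ms = mirror_table qs c; vs = map fst ps in
     (if proper ts then if different vs then if for_all (corners_within ps) ts then
      if for_all (\<lambda>v. exists (has_corner v) ts) vs then if for_all (mirror_check ms ps) ps then
      if for_all (\<lambda>t. exists (has_corners (mirror_triangle ms t)) ts) ts then
      if for_all (triangle_check ts ps) ts then invariant ts vs = n
      else False else False else False else False else False else False else False))"

lemma for_all_iff: "for_all P xs \<longleftrightarrow> (\<forall>x\<in>set xs. P x)"
  by (induction xs) auto

lemma different_iff: "different vs \<longleftrightarrow> distinct vs"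
  by (induction vs) (auto simp: exists_iff)

lemma lookup_in_set: "v \<in> fst ` set xs \<Longrightarrow> (v, lookup xs v) \<in> set xs"
proof (induction xs)
  case (Cons q xs)
  obtain u x where q: "q = (u, x)" by (cases q)
  show ?case
  proof (cases "u = v")
    case False
    then have "v \<in> fst ` set xs" using Cons.prems q by auto
    then show ?thesis using Cons.IH False q by simp
  qed (simp add: q)
qed simp

lemma length_point_table: "length (point_table qs c) = 2 * length qs + 1"
  by (induction qs c rule: point_table.induct) auto

lemma straddle_check_iff: "straddle_check A B C U W \<longleftrightarrow> straddles A B C U W"
proof -
  have "(if 0 < x then if y < 0 then True else z < 0 else if x < 0 then if 0 < y then True else 0 < z else y * z < 0) \<longleftrightarrow>
    (0 < x \<or> 0 < y \<or> 0 < z) \<and> (x < 0 \<or> y < 0 \<or> z < 0)" for x y z :: int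
    by (auto simp: mult_less_0_iff)
  then show ?thesis unfolding straddle_check_def straddles_def orient_def Let_def by simp
qed

lemma split_sidesD:
  "split_sides t n A ps = Some (us, ws) \<Longrightarrow> (v, P) \<in> set ps \<Longrightarrow> v \<notin> corners t \<Longrightarrow>
    0 < scalar_prod n (diff P A) \<and> (v, P) \<in> set us \<or> scalar_prod n (diff P A) < 0 \<and> (v, P) \<in> set ws"
proof (induction ps arbitrary: us ws)
  case (Cons q ps)
  obtain u Q where q: "q = (u, Q)" by (cases q)
  obtain us' ws' where rec: "split_sides t n A ps = Some (us', ws')"
    using Cons.prems(1) unfolding q by (auto split: option.splits)
  show ?case
  proof (cases "(v, P) = q")
    case True
    then show ?thesis using Cons.prems q rec by (auto simp: has_corner_iff Let_def split: if_splits)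
  next
    case False
    then have "(v, P) \<in> set ps" using Cons.prems(2) by simp
    moreover have "set us' \<subseteq> set us" "set ws' \<subseteq> set ws"
      using Cons.prems(1) q rec by (auto simp: Let_def split: if_splits)
    ultimately show ?thesis using Cons.IH[OF rec] Cons.prems(3) by blast
  qed
qed simp

lemma corners_within_iff: "corners_within ps t \<longleftrightarrow> corners t \<subseteq> fst ` set ps"
  by (cases t) (force simp: exists_iff)

section \<open>The involution as a geometric symmetry\<close>

definition half_turn :: "real^3 \<Rightarrow> real^3" where
  "half_turn x = vector [- x $ 1, - x $ 2, x $ 3]"

lemma half_turn_nth [simp]: "half_turn x $ 1 = - x $ 1" "half_turn x $ 2 = - x $ 2" "half_turn x $ 3 = x $ 3"
  by (simp_all add: half_turn_def)

lemma half_turn_half_turn [simp]: "half_turn (half_turn x) = x"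
  by (simp add: vec_eq_iff forall_3)

lemma half_turn_sum: "half_turn (\<Sum>v\<in>S. a v *\<^sub>R f v) = (\<Sum>v\<in>S. a v *\<^sub>R half_turn (f v))"
  by (simp add: vec_eq_iff forall_3 sum_negf)

lemma half_turn_dist: "dist (half_turn x) (half_turn y) = dist x y"
  by (simp add: dist_vec_def L2_set_def sum_3 dist_real_def power2_commute[of "y $ _"])

context
  fixes ts :: "('v \<times> 'v \<times> 'v) list" and qs c n ps ms V
  assumes cert: "certificate ts qs c n"
    and ps_def: "ps = point_table qs c" and ms_def: "ms = mirror_table qs c" and V_def: "V = fst ` set ps"
begin

lemma cert_facts:
  shows "proper ts" and "distinct (map fst ps)" and "\<And>t. t \<in> set ts \<Longrightarrow> corners t \<subseteq> V"
    and "\<And>v. v \<in> V \<Longrightarrow> \<exists>t\<in>set ts. v \<in> corners t" and "\<And>q. q \<in> set ps \<Longrightarrow> mirror_check ms ps q"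
    and "\<And>t. t \<in> set ts \<Longrightarrow> \<exists>t'\<in>set ts. has_corners (mirror_triangle ms t) t'"
    and "\<And>t. t \<in> set ts \<Longrightarrow> triangle_check ts ps t" and "invariant ts (map fst ps) = n"
  using cert unfolding certificate_def Let_def ps_def[symmetric] ms_def[symmetric] V_def
    for_all_iff exists_iff corners_within_iff different_iff has_corner_iff
  by (auto simp del: mirror_check.simps triangle_check.simps has_corners.simps mirror_triangle.simps split: if_splits)

lemma vertices_eq: "vertices (list_complex ts) = V"
  using cert_facts(3,4) unfolding list_complex_def by auto

lemma card_V: "card V = 2 * length qs + 1"
  using distinct_card[OF cert_facts(2)] length_point_table[of qs c] by (simp add: V_def ps_def)

lemma total_weight_eq: "total_weight (list_complex ts) 3 = n"
proof -
  have "vertices (list_complex ts) = set (map fst ps)" unfolding vertices_eq V_def by simp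
  from invariant_correct[OF cert_facts(1) this] show ?thesis using cert_facts(8) by simp
qed

lemma in_table: "v \<in> V \<Longrightarrow> (v, lookup ps v) \<in> set ps"
  unfolding V_def by (rule lookup_in_set)

lemma generic:
  assumes "length qs \<ge> 2"
  shows "generic_position V (lookup ps) ts"
proof
  show "finite V" by (simp add: V_def)
  \<comment> \<open>Two mirror pairs and the vertex on the axis already give five vertices.\<close>
  show "card V \<ge> 4" using card_V assms by simp
  show "corners t \<subseteq> V" if "t \<in> set ts" for t using cert_facts(3)[OF that] .
  show "card (corners t) = 3" if "t \<in> set ts" for t using properD(1)[OF cert_facts(1) that] .
  fix a b c assume t: "(a, b, c) \<in> set ts"
  define A B C where "A = lookup ps a" and "B = lookup ps b" and "C = lookup ps c"
  obtain us ws where split: "split_sides (a, b, c) (cross_prod (diff B A) (diff C A)) A ps = Some (us, ws)"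
    and all: "for_all (\<lambda>(u, U). for_all (\<lambda>(w, W).
         if straddle_check A B C U W then True else if exists (has_edge u w) ts then False else True) ws) us"
    using cert_facts(7)[OF t] unfolding A_def B_def C_def
    by (auto simp: Let_def split: option.splits)
  have pairs: "\<not> {u, w} \<subseteq> corners s"
    if uw: "(u, U) \<in> set us" "(w, W) \<in> set ws" and "\<not> straddles A B C U W" "s \<in> set ts" for u U w W s
  proof -
    have "for_all (\<lambda>(w, W). if straddle_check A B C U W then True else if exists (has_edge u w) ts then False else True) ws"
      using bspec[OF all[unfolded for_all_iff[of _ us]] uw(1)] by simp
    from bspec[OF this[unfolded for_all_iff] uw(2)]
    have "straddle_check A B C U W \<or> \<not> exists (has_edge u w) ts" by (auto split: if_splits)
    then show ?thesis using that(3,4) unfolding straddle_check_iff exists_iff has_edge_iff by blast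
  qed
  have side: "0 < orient A B C (lookup ps v) \<and> (v, lookup ps v) \<in> set us \<or>
      orient A B C (lookup ps v) < 0 \<and> (v, lookup ps v) \<in> set ws" if "v \<in> V" "v \<notin> {a, b, c}" for v
    using split_sidesD[OF split in_table[OF that(1)]] that(2) by (simp add: orient_def)
  show "orient (lookup ps a) (lookup ps b) (lookup ps c) (lookup ps v) \<noteq> 0" if "v \<in> V" "v \<notin> {a, b, c}" for v
    using side[OF that] unfolding A_def B_def C_def by linarith
  show "straddles (lookup ps a) (lookup ps b) (lookup ps c) (lookup ps u) (lookup ps w)"
    if s: "s \<in> set ts" "{u, w} \<subseteq> corners s" and disj: "{u, w} \<inter> {a, b, c} = {}"
      and uw: "0 < orient (lookup ps a) (lookup ps b) (lookup ps c) (lookup ps u)"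
        "orient (lookup ps a) (lookup ps b) (lookup ps c) (lookup ps w) < 0" for s u w
  proof -
    have "u \<in> V" "w \<in> V" "u \<notin> {a, b, c}" "w \<notin> {a, b, c}" using s cert_facts(3)[OF s(1)] disj by auto
    then have "(u, lookup ps u) \<in> set us" "(w, lookup ps w) \<in> set ws"
      using side[of u] side[of w] uw unfolding A_def B_def C_def by auto
    then show ?thesis using pairs[OF _ _ _ s(1)] s(2) unfolding A_def B_def C_def by metis
  qed
qed

lemma mirror:
  assumes "v \<in> V"
  shows "lookup ms v \<in> V" and "lookup ms (lookup ms v) = v"
    and "lookup ps (lookup ms v) = (- fst (lookup ps v), - fst (snd (lookup ps v)), snd (snd (lookup ps v)))"
proof -
  obtain x y z where xyz: "lookup ps v = (x, y, z)" by (metis prod_cases3)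
  have "mirror_check ms ps (v, (x, y, z))" using cert_facts(5)[OF in_table[OF assms]] xyz by simp
  then show "lookup ms (lookup ms v) = v"
    and "lookup ps (lookup ms v) = (- fst (lookup ps v), - fst (snd (lookup ps v)), snd (snd (lookup ps v)))"
    by (simp_all add: Let_def xyz split: if_splits)
  \<comment> \<open>The involution maps a triangle at \<open>v\<close> into a triangle, so the image
    of \<open>v\<close> is again a vertex.\<close>
  obtain t where t: "t \<in> set ts" "v \<in> corners t" using cert_facts(4)[OF assms] by blast
  obtain t' where t': "t' \<in> set ts" "has_corners (mirror_triangle ms t) t'" using cert_facts(6)[OF t(1)] by blast
  have "lookup ms v \<in> corners t'" using t(2) t'(2) by (cases t) (auto simp: has_triangle_iff)
  then show "lookup ms v \<in> V" using cert_facts(3)[OF t'(1)] by blast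
qed

lemma mirror_face:
  assumes "\<sigma> \<in> list_complex ts"
  shows "lookup ms ` \<sigma> \<in> list_complex ts"
proof -
  obtain t where t: "t \<in> set ts" "\<sigma> \<subseteq> corners t" "\<sigma> \<noteq> {}"
    using assms by (auto simp: list_complex_def generated_complex_def)
  obtain t' where t': "t' \<in> set ts" "has_corners (mirror_triangle ms t) t'" using cert_facts(6)[OF t(1)] by blast
  have "lookup ms ` corners t \<subseteq> corners t'" using t'(2) by (cases t) (auto simp: has_triangle_iff)
  then have "lookup ms ` \<sigma> \<subseteq> corners t'" using t(2) by blast
  then show ?thesis using t(3) t'(1) unfolding list_complex_def generated_complex_def by blast
qed

lemma mirror_iso: "simplicial_iso (lookup ms) (list_complex ts) (list_complex ts)"
proof -
  have "bij_betw (lookup ms) V V"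
    using mirror by (intro bij_betw_byWitness[where f' = "lookup ms"]) auto
  moreover have "(`) (lookup ms) ` list_complex ts = list_complex ts"
  proof
    show "list_complex ts \<subseteq> (`) (lookup ms) ` list_complex ts"
    proof
      fix \<sigma> assume \<sigma>: "\<sigma> \<in> list_complex ts"
      then have "\<sigma> \<subseteq> V" using vertices_eq by blast
      then have "lookup ms ` lookup ms ` \<sigma> = \<sigma>" using mirror(2) by force
      then show "\<sigma> \<in> (`) (lookup ms) ` list_complex ts" using mirror_face[OF \<sigma>] by (metis imageI)
    qed
  qed (auto intro: mirror_face)
  ultimately show ?thesis by (simp add: simplicial_iso_def vertices_eq)
qed

text \<open>For an involution the fibre over a vertex \<open>w\<close> is the single vertex
  \<open>lookup ms w\<close>, so pushing coordinates forward means composing with the same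
  map.\<close>

lemma mirror_induced:
  "induced_map (list_complex ts) (lookup ms) x = (\<lambda>w. if w \<in> V then x (lookup ms w) else 0)"
proof
  fix w
  have "{v \<in> V. lookup ms v = w} = (if w \<in> V then {lookup ms w} else {})"
    using mirror(1,2) by auto
  then show "induced_map (list_complex ts) (lookup ms) x w = (if w \<in> V then x (lookup ms w) else 0)"
    unfolding induced_map_def vertices_eq by simp
qed

lemma sum_mirror: "(\<Sum>v\<in>V. h (lookup ms v)) = (\<Sum>v\<in>V. h v)" for h :: "'v \<Rightarrow> 'b::comm_monoid_add"
  by (rule sum.reindex_bij_witness[where i = "lookup ms" and j = "lookup ms"]) (auto simp: mirror)

lemma mirror_linear:
  "simplexwise_linear (list_complex ts) (\<lambda>v. vec_of (lookup ps v)) (induced_map (list_complex ts) (lookup ms) x) =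
   half_turn (simplexwise_linear (list_complex ts) (\<lambda>v. vec_of (lookup ps v)) x)"
proof -
  have turn: "half_turn (vec_of (lookup ps v)) = vec_of (lookup ps (lookup ms v))" if "v \<in> V" for v
    using mirror(3)[OF that] by (simp add: vec_eq_iff forall_3 vec_of_nth)
  have "simplexwise_linear (list_complex ts) (\<lambda>v. vec_of (lookup ps v)) (induced_map (list_complex ts) (lookup ms) x) =
      (\<Sum>v\<in>V. x (lookup ms v) *\<^sub>R vec_of (lookup ps v))"
    unfolding simplexwise_linear_def vertices_eq mirror_induced by (intro sum.cong) auto
  also have "\<dots> = (\<Sum>v\<in>V. x (lookup ms v) *\<^sub>R vec_of (lookup ps (lookup ms (lookup ms v))))"
    using mirror(2) by (intro sum.cong) auto
  also have "\<dots> = (\<Sum>v\<in>V. x v *\<^sub>R vec_of (lookup ps (lookup ms v)))"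
    by (rule sum_mirror[of "\<lambda>v. x v *\<^sub>R vec_of (lookup ps (lookup ms v))"])
  also have "\<dots> = (\<Sum>v\<in>V. x v *\<^sub>R half_turn (vec_of (lookup ps v)))"
    using turn by (intro sum.cong) auto
  finally show ?thesis by (simp add: half_turn_sum simplexwise_linear_def vertices_eq)
qed

lemma mirror_underlying:
  assumes "x \<in> underlying_space (list_complex ts)"
  shows "induced_map (list_complex ts) (lookup ms) x \<in> underlying_space (list_complex ts)"
proof -
  let ?y = "\<lambda>w. if w \<in> V then x (lookup ms w) else 0"
  have supp: "{v. x v \<noteq> 0} \<in> list_complex ts" using assms by (simp add: underlying_space_def)
  then have sub: "{v. x v \<noteq> 0} \<subseteq> V" using vertices_eq by blast
  have "{w. ?y w \<noteq> 0} = lookup ms ` {v. x v \<noteq> 0}"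
  proof
    show "{w. ?y w \<noteq> 0} \<subseteq> lookup ms ` {v. x v \<noteq> 0}"
    proof
      fix w assume "w \<in> {w. ?y w \<noteq> 0}"
      then have "w \<in> V" "x (lookup ms w) \<noteq> 0" by (auto split: if_splits)
      then show "w \<in> lookup ms ` {v. x v \<noteq> 0}"
        using mirror(2)[of w] by (intro image_eqI[of _ _ "lookup ms w"]) auto
    qed
    show "lookup ms ` {v. x v \<noteq> 0} \<subseteq> {w. ?y w \<noteq> 0}" using sub mirror by auto
  qed
  then have "{w. ?y w \<noteq> 0} \<in> list_complex ts" using mirror_face[OF supp] by simp
  moreover have "(\<Sum>w\<in>V. ?y w) = 1"
  proof -
    have "(\<Sum>w\<in>V. ?y w) = (\<Sum>w\<in>V. x (lookup ms w))" by (intro sum.cong) auto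
    also have "\<dots> = (\<Sum>w\<in>V. x w)" by (rule sum_mirror)
    also have "\<dots> = 1" using assms by (simp add: underlying_space_def vertices_eq)
    finally show ?thesis .
  qed
  ultimately show ?thesis
    using assms unfolding mirror_induced by (simp add: underlying_space_def vertices_eq)
qed

lemma symmetric: "has_2fold_rotational_symmetry (list_complex ts) (\<lambda>v. vec_of (lookup ps v))"
proof -
  let ?\<Delta> = "list_complex ts" and ?\<psi> = "\<lambda>v. vec_of (lookup ps v)"
  define Q :: "real^3^3" where "Q = vector [vector [-1, 0, 0], vector [0, -1, 0], vector [0, 0, 1]]"
  define u :: "real^3" where "u = vector [0, 0, 1]"
  have Q: "Q *v x = half_turn x" for x
    by (simp add: Q_def vec_eq_iff forall_3 matrix_vector_mult_def sum_3)
  have "rotation_matrix Q"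
    unfolding rotation_matrix_def orthogonal_matrix_def
    by (simp add: Q_def det_3 vec_eq_iff forall_3 matrix_matrix_mult_def transpose_def mat_def sum_3)
  moreover have "u \<noteq> 0" "Q *v u = u"
    unfolding Q by (simp_all add: u_def vec_eq_iff forall_3)
  ultimately have rot: "rotation_about_line 0 u half_turn"
    unfolding rotation_about_line_def using Q by auto
  have "half_turn (vector [1, 0, 0]) \<noteq> vector [1, 0, 0]" by (simp add: vec_eq_iff forall_3)
  then have nid: "half_turn \<noteq> id" by (metis id_apply)
  have inv: "half_turn \<circ> half_turn = id" by (rule ext) simp
  have sub: "half_turn ` simplexwise_linear ?\<Delta> ?\<psi> ` underlying_space ?\<Delta> \<subseteq> simplexwise_linear ?\<Delta> ?\<psi> ` underlying_space ?\<Delta>"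
    using mirror_underlying by (auto simp: mirror_linear[symmetric])
  have "simplexwise_linear ?\<Delta> ?\<psi> ` underlying_space ?\<Delta> \<subseteq> half_turn ` simplexwise_linear ?\<Delta> ?\<psi> ` underlying_space ?\<Delta>"
  proof
    fix q assume "q \<in> simplexwise_linear ?\<Delta> ?\<psi> ` underlying_space ?\<Delta>"
    then have "half_turn q \<in> simplexwise_linear ?\<Delta> ?\<psi> ` underlying_space ?\<Delta>" using sub by blast
    then show "q \<in> half_turn ` simplexwise_linear ?\<Delta> ?\<psi> ` underlying_space ?\<Delta>"
      by (intro image_eqI[of q half_turn "half_turn q"]) simp_all
  qed
  then have "geometric_symmetry ?\<Delta> ?\<psi> half_turn"
    unfolding geometric_symmetry_def
    using half_turn_dist sub mirror_iso mirror_linear by (intro conjI exI[of _ "lookup ms"]) auto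
  then show ?thesis using rot nid inv unfolding has_2fold_rotational_symmetry_def by blast
qed

end

section \<open>The triangulations\<close>

abbreviation genus4 :: "(nat \<times> nat \<times> nat) list \<Rightarrow> bool" where
  "genus4 ts \<equiv> polyhedron (list_complex ts) homeomorphic_space orientable_surface 4"

definition realized :: "(nat \<times> nat \<times> nat) list \<Rightarrow> nat \<Rightarrow> bool" where
  "realized ts n \<longleftrightarrow> triangulates (list_complex ts) (orientable_surface 4) \<and>
     card (vertices (list_complex ts)) = 11 \<and> total_weight (list_complex ts) 3 = n \<and>
     (\<exists>\<psi>. polyhedral_realization (list_complex ts) \<psi> \<and> has_2fold_rotational_symmetry (list_complex ts) \<psi>)"

lemma genus4_moves: "genus4 ts \<Longrightarrow> apply_moves ts ms = Some us \<Longrightarrow> genus4 us"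
  using apply_moves_homeomorphic[of ts ms us] by (meson homeomorphic_space_sym homeomorphic_space_trans infinite_UNIV_nat)

lemma certificate_realized:
  assumes cert: "certificate ts qs c n" and len: "length qs = 5" and gen: "genus4 ts"
  shows "realized ts n"
proof -
  note facts = cert_facts[OF cert refl refl refl]
  have V: "card (vertices (list_complex ts)) = 11"
    using card_V[OF cert refl refl refl] vertices_eq[OF cert refl refl refl] len by simp
  have "two_dimensional (list_complex ts)"
    unfolding two_dimensional_def
  proof
    show "\<forall>\<sigma>\<in>list_complex ts. card \<sigma> \<le> 3"
    proof
      fix \<sigma> assume "\<sigma> \<in> list_complex ts"
      then obtain t where "t \<in> set ts" "\<sigma> \<subseteq> corners t" by (auto simp: list_complex_def generated_complex_def)
      then show "card \<sigma> \<le> 3" using card_mono[OF finite_corners] properD(1)[OF facts(1)] by metis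
    qed
    have "vertices (list_complex ts) \<noteq> {}" using V by (metis card.empty zero_neq_numeral)
    then obtain t where "t \<in> set ts" by (auto simp: list_complex_def)
    then have "corners t \<in> facets (list_complex ts)" using facets_list_complex[OF facts(1)] by blast
    then show "\<exists>\<sigma>\<in>list_complex ts. card \<sigma> = 3" by (auto simp: facets_def)
  qed
  then have "triangulates (list_complex ts) (orientable_surface 4)"
    using gen finite_complex_list_complex by (simp add: triangulates_def)
  moreover have "polyhedral_realization (list_complex ts) (\<lambda>v. vec_of (lookup (point_table qs c) v))"
    by (rule generic_position.polyhedral[OF generic[OF cert refl refl refl]])
      (use len vertices_eq[OF cert refl refl refl] in auto)
  ultimately show ?thesis
    unfolding realized_def
    using V total_weight_eq[OF cert refl refl refl] symmetric[OF cert refl refl refl] by blast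
qed

lemma genus4_polygon: "genus4 polygon_triangles"
  by (rule polygon_complex_homeomorphic)

section \<open>Flip sequences and coordinates for the 28 triangulations\<close>

definition reduced_1 :: "(nat \<times> nat \<times> nat) list" where
  "reduced_1 =
   [(41,9,51),(48,9,51),(35,41,39),(33,41,35),(16,41,33),(5,33,29),(38,5,29),(16,38,29),(16,56,18),
   (65,56,18),(11,53,48),(44,53,48),(12,56,54),(17,56,54),(12,17,60),(15,12,17),(16,15,13),
   (60,15,13),(16,12,15),(13,12,56),(56,65,60),(65,17,15),(15,60,65),(51,11,53),(17,33,29),
   (18,27,24),(17,27,24),(16,18,27),(17,48,44),(16,53,44),(17,60,56),(18,24,21),(17,21,18),
   (16,24,21),(16,11,48),(16,51,41),(17,51,48),(5,38,35),(17,38,35),(16,35,5),(13,60,12),(16,5,33),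
   (17,35,33),(16,35,39),(2,23,21),(17,23,21),(27,23,2),(16,23,27),(17,41,39),(44,41,9),(17,44,41),
   (29,27,2),(17,29,27),(17,53,51),(21,16,2),(17,23,24),(23,24,16),(29,2,16),(17,38,39),(38,39,16),
   (44,9,16),(48,16,9),(51,16,11),(17,53,54),(53,54,16),(54,16,12),(56,13,16),(17,65,18)]"

text \<open>Flips lower the number of triangles at a vertex to three, after which it can be removed.
  Here 38 of the 66 vertices disappear.\<close>

lemma genus4_reduced_1: "genus4 reduced_1"
  by (rule genus4_moves[OF genus4_polygon, of
   "[Flip 17 45 46 44, Flip 16 45 44 10, Uncone 10 46 44 45, Flip 17 52 53 51, Flip 10 52 11 53, Uncone 11 53
   51 52, Flip 17 28 29 27, Flip 28 29 27 2, Uncone 2 27 3 28, Flip 16 42 41 8, Flip 17 42 43 41, Uncone 8 43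
   41 42, Flip 17 43 44 41, Flip 43 44 41 9, Uncone 8 9 41 43, Flip 17 40 41 39, Flip 7 40 39 6, Uncone 6 41
   39 40, Flip 17 19 20 18, Flip 0 19 18 1, Uncone 1 20 18 19, Flip 3 16 23 27, Flip 3 27 23 2, Uncone 2 23
   22 3, Flip 17 22 23 21, Uncone 2 23 21 22, Flip 17 49 50 48, Flip 9 49 48 8, Uncone 8 50 48 49, Flip 16 57
   56 14, Flip 17 57 58 56, Uncone 14 58 56 57, Flip 7 16 35 39, Flip 7 39 35 6, Uncone 6 35 34 7, Flip 17 34
   35 33, Uncone 6 35 33 34, Flip 16 32 5 33, Flip 17 32 33 31, Uncone 5 33 31 32, Flip 17 37 38 36, Flip 4
   37 5 38, Uncone 5 38 36 37, Flip 17 61 62 60, Flip 13 61 60 12, Uncone 12 62 60 61, Flip 16 59 15 60, Flip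
   17 59 60 58, Uncone 15 60 58 59, Flip 17 25 26 24, Flip 24 25 26 1, Uncone 0 26 1 25, Flip 0 16 26 18,
   Uncone 1 18 26 0, Flip 17 31 33 30, Flip 30 31 33 4, Uncone 4 5 33 31, Flip 16 36 35 5, Flip 17 36 38 35,
   Uncone 5 38 35 36, Flip 1 16 20 24, Flip 1 20 18 24, Uncone 18 26 24 1, Flip 16 50 8 51, Flip 17 50 51 48,
   Uncone 8 51 48 50, Flip 8 16 51 41, Flip 8 41 51 9, Uncone 9 51 48 8, Flip 16 47 11 48, Flip 17 47 48 46,
   Uncone 11 48 46 47, Flip 16 20 24 21, Flip 17 20 21 18, Uncone 18 24 21 20, Flip 17 58 60 56, Flip 56 58
   60 14, Uncone 14 15 60 58, Flip 10 16 53 44, Flip 10 53 11 44, Uncone 11 46 44 10, Flip 17 46 48 44,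
   Uncone 11 48 44 46, Flip 16 62 12 63, Flip 17 62 63 60, Uncone 12 63 60 62, Flip 16 26 18 27, Flip 17 26
   27 24, Uncone 18 27 24 26, Flip 17 30 33 29, Flip 16 30 29 4, Uncone 4 33 29 30, Flip 11 53 51 44, Flip 44
   51 11 53, Flip 17 64 65 63, Flip 14 64 15 65, Uncone 15 65 63 64, Flip 14 15 60 65, Flip 63 65 17 15, Flip
   14 16 65 56, Uncone 56 65 60 14, Flip 13 55 12 56, Flip 16 63 12 15, Flip 16 60 15 13, Flip 15 63 12 17,
   Uncone 12 17 60 63, Flip 17 55 56 54, Uncone 12 56 54 55, Flip 11 44 53 48, Flip 16 65 56 18, Flip 4 16 38
   29, Flip 9 51 48 41, Flip 4 38 5 29, Uncone 5 33 29 4, Flip 6 16 41 33, Flip 6 33 41 35, Uncone 35 41 39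
   6, Flip 41 48 9 51]"])
    code_simp

definition surface_1 :: "(nat \<times> nat \<times> nat) list" where
  "surface_1 =
   [(18,24,29),(33,24,29),(24,27,44),(29,27,44),(33,35,44),(54,35,44),(35,17,29),(44,17,29),
   (27,17,35),(18,24,54),(16,33,24),(27,16,33),(16,29,41),(33,29,41),(17,24,54),(18,29,27),
   (41,44,24),(18,41,27),(54,41,27),(17,18,41),(16,54,27),(16,54,17),(17,33,41),(41,35,54),
   (16,44,18),(54,44,18),(44,17,33),(17,16,18),(44,16,41),(16,29,35),(35,41,24),(33,35,27),
   (16,24,35),(17,27,24)]"

lemma genus4_surface_1: "genus4 surface_1"
  by (rule genus4_moves[OF genus4_reduced_1, of
   "[Flip 16 51 41 11, Flip 17 39 41 38, Flip 35 38 17 5, Flip 16 39 38 35, Uncone 35 41 38 39, Flip 2 16 29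
   21, Flip 2 21 29 23, Uncone 23 29 27 2, Flip 17 65 18 15, Flip 15 65 18 60, Uncone 18 60 56 65, Flip 13 16
   56 15, Flip 12 56 54 13, Flip 11 16 48 41, Flip 11 48 53 41, Uncone 41 53 51 11, Flip 13 54 12 56, Flip 12
   60 13 17, Flip 13 17 60 12, Flip 12 56 54 13, Flip 9 41 51 44, Flip 9 44 51 16, Uncone 16 51 48 9, Flip 12
   13 54 60, Flip 13 56 54 15, Uncone 15 54 60 13, Flip 12 15 17 16, Flip 12 17 60 16, Uncone 16 60 54 12,
   Flip 18 24 21 27, Flip 16 53 44 54, Flip 16 41 33 48, Flip 16 21 24 29, Flip 16 38 29 35, Flip 17 38 41 5,
   Flip 5 38 41 29, Uncone 29 35 41 38, Flip 17 21 23 18, Flip 21 23 18 29, Flip 21 29 18 24, Uncone 18 27 24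
   21, Flip 17 29 33 27, Flip 5 41 17 29, Flip 16 29 24 35, Flip 5 33 29 16, Flip 17 18 23 15, Flip 16 18 56
   27, Flip 17 41 44 29, Flip 17 33 35 27, Flip 17 35 5 27, Flip 44 51 16 41, Flip 5 27 35 17, Flip 17 35 5
   27, Flip 5 27 35 17, Flip 29 35 41 24, Flip 5 16 29 35, Uncone 17 35 29 5, Flip 51 53 17 41, Flip 16 41 51
   44, Flip 17 53 54 41, Flip 41 53 54 48, Uncone 44 54 48 53, Flip 44 51 16 41, Flip 17 41 54 51, Flip 51 54
   17 41, Flip 17 48 51 44, Flip 44 51 17 48, Flip 17 29 44 35, Flip 16 41 51 44, Flip 44 51 16 41, Flip 17
   35 44 27, Flip 41 48 54 33, Flip 16 51 48 41, Uncone 17 48 41 51, Flip 56 60 17 18, Flip 17 60 16 18, Flip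
   16 60 54 18, Uncone 15 54 18 60, Flip 48 54 33 44, Flip 44 48 17 33, Flip 17 54 56 41, Flip 16 54 44 18,
   Flip 33 41 35 54, Flip 16 48 33 41, Uncone 17 33 41 48, Flip 15 56 54 16, Flip 15 16 54 17, Flip 15 17 54
   23, Uncone 18 23 54 15, Flip 16 56 54 27, Flip 17 56 18 41, Flip 27 29 33 23, Flip 54 56 41 27, Uncone 18
   41 27 56, Flip 29 41 44 24, Flip 23 29 33 18, Flip 18 24 29 27, Flip 17 23 24 54, Flip 16 33 29 41, Flip
   23 27 16 33, Flip 16 23 33 24, Flip 23 33 24 18, Uncone 18 24 54 23, Flip 27 44 17 35, Flip 35 44 17 29,
   Flip 33 54 35 44, Flip 24 29 27 44, Flip 18 33 24 29]"])
    code_simp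

text \<open>The first number is the invariant of the complex after three rounds; the final argument
  33 of the certificate is the vertex on the axis.\<close>

lemma realized_surface_1: "realized surface_1 7975425019556121449072"
  by (rule certificate_realized[OF _ _ genus4_surface_1, of
   "[(27,41,-1,-5,-4), (16,17,2,2,-2), (24,44,4,-7,6), (29,35,0,-1,1), (54,18,-6,-7,-9)]" 33])
    code_simp+

definition auxiliary_1 :: "(nat \<times> nat \<times> nat) list" where
  "auxiliary_1 =
   [(44,35,18),(54,35,18),(18,54,29),(24,54,29),(33,24,29),(24,27,44),(29,27,44),(33,35,44),
   (35,17,29),(44,17,29),(27,17,35),(16,33,24),(27,16,33),(16,29,41),(33,29,41),(17,24,54),
   (18,29,27),(41,44,24),(18,41,27),(54,41,27),(17,18,41),(16,54,27),(16,54,17),(17,33,41),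
   (41,35,54),(16,44,18),(44,17,33),(17,16,18),(44,16,41),(16,29,35),(35,41,24),(33,35,27),
   (16,24,35),(17,27,24)]"

lemma genus4_auxiliary_1: "genus4 auxiliary_1"
  by (rule genus4_moves[OF genus4_surface_1, of
   "[Flip 18 24 54 29, Flip 44 54 35 18]"])
    code_simp

definition surface_2 :: "(nat \<times> nat \<times> nat) list" where
  "surface_2 =
   [(17,18,33),(41,18,33),(16,54,33),(27,54,33),(18,24,29),(33,24,29),(24,27,44),(29,27,44),
   (33,35,44),(54,35,44),(35,17,29),(44,17,29),(27,17,35),(18,24,54),(16,33,24),(16,29,41),
   (33,29,41),(17,24,54),(18,29,27),(41,44,24),(18,41,27),(54,41,27),(16,54,17),(41,35,54),
   (16,44,18),(54,44,18),(44,17,33),(17,16,18),(44,16,41),(16,29,35),(35,41,24),(33,35,27),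
   (16,24,35),(17,27,24)]"

text \<open>The two flips are mirror images under the involution of \<open>surface_1\<close>, so the
  result inherits that involution. Most of the later sequences consist of such pairs.\<close>

lemma genus4_surface_2: "genus4 surface_2"
  by (rule genus4_moves[OF genus4_surface_1, of
   "[Flip 16 27 54 33, Flip 17 41 18 33]"])
    code_simp

lemma realized_surface_2: "realized surface_2 7248586875533671382244"
  by (rule certificate_realized[OF _ _ genus4_surface_2, of
   "[(27,41,4,0,-1), (35,29,-7,4,2), (44,24,1,7,-7), (17,16,2,5,-5), (18,54,1,3,-4)]" 33])
    code_simp+

definition surface_3 :: "(nat \<times> nat \<times> nat) list" where
  "surface_3 =
   [(35,18,33),(44,18,33),(24,33,54),(29,33,54),(54,35,18),(18,54,29),(24,27,44),(29,27,44),
   (35,17,29),(44,17,29),(27,17,35),(16,33,24),(27,16,33),(16,29,41),(33,29,41),(17,24,54),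
   (18,29,27),(41,44,24),(18,41,27),(54,41,27),(17,18,41),(16,54,27),(16,54,17),(17,33,41),
   (41,35,54),(16,44,18),(44,17,33),(17,16,18),(44,16,41),(16,29,35),(35,41,24),(33,35,27),
   (16,24,35),(17,27,24)]"

lemma genus4_surface_3: "genus4 surface_3"
  by (rule genus4_moves[OF genus4_auxiliary_1, of
   "[Flip 24 29 33 54, Flip 35 44 18 33]"])
    code_simp

lemma realized_surface_3: "realized surface_3 7783652992580094583472"
  by (rule certificate_realized[OF _ _ genus4_surface_3, of
   "[(18,54,-5,-2,2), (44,24,-5,5,-4), (17,16,-2,3,-3), (41,27,-5,-5,4), (29,35,-2,-1,3)]" 33])
    code_simp+

definition auxiliary_2 :: "(nat \<times> nat \<times> nat) list" where
  "auxiliary_2 =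
   [(18,54,44),(29,54,44),(16,35,17),(18,35,17),(17,29,27),(35,29,27),(27,18,44),(44,16,35),
   (16,24,29),(35,24,29),(24,33,54),(29,33,54),(54,35,18),(24,27,44),(33,35,44),(44,17,29),
   (16,33,24),(27,16,33),(16,29,41),(33,29,41),(17,24,54),(41,44,24),(18,41,27),(54,41,27),
   (17,18,41),(16,54,27),(16,54,17),(17,33,41),(41,35,54),(44,17,33),(44,16,41),(35,41,24),
   (33,35,27),(17,27,24)]"

text \<open>This sequence does not respect the earlier involution. It leads towards surfaces such as
  \<open>surface_6\<close> and \<open>surface_7\<close>, whose half-turn fixes the vertex 18 instead
  of 33.\<close>

lemma genus4_auxiliary_2: "genus4 auxiliary_2"
  by (rule genus4_moves[OF genus4_auxiliary_1, of
   "[Flip 24 29 33 54, Flip 16 35 24 29, Flip 18 44 16 35, Flip 27 29 18 44, Flip 17 35 29 27, Flip 16 18 35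
   17, Flip 18 29 54 44]"])
    code_simp

definition surface_4 :: "(nat \<times> nat \<times> nat) list" where
  "surface_4 =
   [(44,35,18),(54,35,18),(24,33,54),(16,24,54),(24,18,17),(54,18,17),(17,16,33),(18,16,33),
   (41,18,33),(27,54,33),(18,24,29),(33,24,29),(24,27,44),(29,27,44),(33,35,44),(35,17,29),
   (44,17,29),(27,17,35),(16,29,41),(33,29,41),(18,29,27),(41,44,24),(18,41,27),(54,41,27),
   (16,54,17),(41,35,54),(16,44,18),(44,17,33),(44,16,41),(16,29,35),(35,41,24),(33,35,27),
   (16,24,35),(17,27,24)]"

text \<open>Three flips block one another cyclically: each would create an edge that exists until
  another flip removes it. The temporary vertex 0, a free name, breaks the cycle and is removed at
  the end.\<close>

lemma genus4_surface_4: "genus4 surface_4"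
  by (rule genus4_moves[OF genus4_surface_2, of
   "[Cone 16 24 33 0, Flip 16 33 54 0, Flip 17 18 16 33, Flip 24 54 18 17, Flip 0 16 24 54, Uncone 24 33 54 0,
   Flip 44 54 35 18]"])
    code_simp

lemma realized_surface_4: "realized surface_4 7509492278753520985350"
  by (rule certificate_realized[OF _ _ genus4_surface_4, of
   "[(24,35,4,4,5), (33,18,-1,0,1), (27,17,1,2,-4), (41,16,0,-1,3), (44,29,5,-5,-5)]" 54])
    code_simp+

definition surface_5 :: "(nat \<times> nat \<times> nat) list" where
  "surface_5 =
   [(27,29,24),(44,29,24),(24,44,35),(41,44,35),(35,18,33),(44,18,33),(24,33,54),(29,33,54),
   (54,35,18),(18,54,29),(35,17,29),(44,17,29),(27,17,35),(16,33,24),(27,16,33),(16,29,41),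
   (33,29,41),(17,24,54),(18,29,27),(18,41,27),(54,41,27),(17,18,41),(16,54,27),(16,54,17),
   (17,33,41),(41,35,54),(16,44,18),(44,17,33),(17,16,18),(44,16,41),(16,29,35),(33,35,27),
   (16,24,35),(17,27,24)]"

lemma genus4_surface_5: "genus4 surface_5"
  by (rule genus4_moves[OF genus4_surface_3, of
   "[Flip 24 41 44 35, Flip 27 44 29 24]"])
    code_simp

lemma realized_surface_5: "realized surface_5 7783683610151519704646"
  by (rule certificate_realized[OF _ _ genus4_surface_5, of
   "[(18,54,0,-2,4), (44,24,-5,-5,-4), (17,16,2,-5,5), (41,27,-1,1,1), (29,35,3,2,-3)]" 33])
    code_simp+

definition surface_6 :: "(nat \<times> nat \<times> nat) list" where
  "surface_6 =
   [(27,18,24),(44,18,24),(17,16,18),(35,16,18),(18,54,44),(29,54,44),(17,29,27),(35,29,27),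
   (44,16,35),(16,24,29),(35,24,29),(24,33,54),(29,33,54),(54,35,18),(33,35,44),(44,17,29),
   (16,33,24),(27,16,33),(16,29,41),(33,29,41),(17,24,54),(41,44,24),(18,41,27),(54,41,27),
   (17,18,41),(16,54,27),(16,54,17),(17,33,41),(41,35,54),(44,17,33),(44,16,41),(35,41,24),
   (33,35,27),(17,27,24)]"

lemma genus4_surface_6: "genus4 surface_6"
  by (rule genus4_moves[OF genus4_auxiliary_2, of
   "[Flip 17 35 16 18, Flip 27 44 18 24]"])
    code_simp

lemma realized_surface_6: "realized surface_6 7513187600030068155906"
  by (rule certificate_realized[OF _ _ genus4_surface_6, of
   "[(41,54,-1,-6,2), (17,44,5,-4,5), (16,24,0,1,1), (35,27,-1,3,3), (33,29,4,-2,6)]" 18])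
    code_simp+

definition surface_7 :: "(nat \<times> nat \<times> nat) list" where
  "surface_7 =
   [(27,35,54),(41,35,27),(27,29,33),(35,29,33),(29,54,41),(33,54,41),(18,54,44),(29,54,44),
   (16,35,17),(18,35,17),(17,29,27),(27,18,44),(44,16,35),(16,24,29),(35,24,29),(24,33,54),
   (54,35,18),(24,27,44),(33,35,44),(44,17,29),(16,33,24),(27,16,33),(16,29,41),(17,24,54),
   (41,44,24),(18,41,27),(17,18,41),(16,54,27),(16,54,17),(17,33,41),(44,17,33),(44,16,41),
   (35,41,24),(17,27,24)]"

text \<open>The edges \<open>{41, 54}\<close>, \<open>{29, 33}\<close> and \<open>{27, 35}\<close>
  each join a vertex to its mirror image and are exchanged cyclically. A temporary vertex is needed
  because no one of these flips can come first.\<close>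

lemma genus4_surface_7: "genus4 surface_7"
  by (rule genus4_moves[OF genus4_auxiliary_2, of
   "[Cone 27 41 54 0, Flip 41 54 0 35, Flip 29 33 54 41, Flip 27 35 29 33, Flip 0 41 35 27, Uncone 27 35 54 0]"])
    code_simp

lemma realized_surface_7: "realized surface_7 8967101449634503882002"
  by (rule certificate_realized[OF _ _ genus4_surface_7, of
   "[(27,35,-7,1,-1), (44,17,2,6,-3), (54,41,-6,5,-5), (16,24,6,-7,-7), (33,29,0,-2,-4)]" 18])
    code_simp+

definition surface_8 :: "(nat \<times> nat \<times> nat) list" where
  "surface_8 =
   [(33,17,29),(41,17,29),(27,35,16),(33,35,16),(17,44,35),(29,44,35),(16,24,29),(35,24,29),
   (35,54,33),(44,54,33),(24,33,18),(29,33,18),(24,27,44),(29,27,44),(27,17,35),(18,24,54),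
   (16,33,24),(16,29,41),(17,24,54),(18,29,27),(41,44,24),(18,41,27),(54,41,27),(17,18,41),
   (16,54,27),(16,54,17),(41,35,54),(16,44,18),(54,44,18),(44,17,33),(17,16,18),(44,16,41),
   (35,41,24),(17,27,24)]"

lemma genus4_surface_8: "genus4 surface_8"
  by (rule genus4_moves[OF genus4_surface_1, of
   "[Flip 24 29 33 18, Flip 35 44 54 33, Flip 16 35 24 29, Flip 17 29 44 35, Flip 27 33 35 16, Flip 33 41 17
   29]"])
    code_simp

lemma realized_surface_8: "realized surface_8 7509490526811396272226"
  by (rule certificate_realized[OF _ _ genus4_surface_8, of
   "[(18,54,-8,-5,1), (29,35,-6,-1,5), (17,16,1,10,-1), (44,24,-4,1,6), (27,41,9,-7,10)]" 33])
    code_simp+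

definition surface_9 :: "(nat \<times> nat \<times> nat) list" where
  "surface_9 =
   [(35,44,54),(41,44,54),(27,18,24),(29,18,24),(44,29,24),(24,44,35),(35,18,33),(44,18,33),
   (24,33,54),(29,33,54),(54,35,18),(18,54,29),(35,17,29),(44,17,29),(27,17,35),(16,33,24),
   (27,16,33),(16,29,41),(33,29,41),(17,24,54),(18,41,27),(54,41,27),(17,18,41),(16,54,27),
   (16,54,17),(17,33,41),(16,44,18),(44,17,33),(17,16,18),(44,16,41),(16,29,35),(33,35,27),
   (16,24,35),(17,27,24)]"

lemma genus4_surface_9: "genus4 surface_9"
  by (rule genus4_moves[OF genus4_surface_5, of
   "[Flip 27 29 18 24, Flip 35 41 44 54]"])
    code_simp

lemma realized_surface_9: "realized surface_9 7783656051231368158702"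
  by (rule certificate_realized[OF _ _ genus4_surface_9, of
   "[(18,54,-1,2,3), (44,24,5,4,-3), (17,16,-5,5,4), (41,27,2,-1,1), (29,35,-3,-2,-2)]" 33])
    code_simp+

definition surface_10 :: "(nat \<times> nat \<times> nat) list" where
  "surface_10 =
   [(44,18,29),(54,18,29),(17,18,33),(41,18,33),(27,18,24),(44,18,24),(17,16,18),(35,16,18),
   (17,29,27),(35,29,27),(44,16,35),(16,24,29),(35,24,29),(24,33,54),(29,33,54),(54,35,18),
   (33,35,44),(44,17,29),(16,33,24),(27,16,33),(16,29,41),(33,29,41),(17,24,54),(41,44,24),
   (18,41,27),(54,41,27),(16,54,27),(16,54,17),(41,35,54),(44,17,33),(44,16,41),(35,41,24),
   (33,35,27),(17,27,24)]"

lemma genus4_surface_10: "genus4 surface_10"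
  by (rule genus4_moves[OF genus4_surface_6, of
   "[Flip 17 41 18 33, Flip 44 54 18 29]"])
    code_simp

lemma realized_surface_10: "realized surface_10 7783701656691733424946"
  by (rule certificate_realized[OF _ _ genus4_surface_10, of
   "[(17,44,-1,-2,-4), (16,24,-10,2,10), (35,27,-2,4,-5), (54,41,8,-6,-1), (29,33,9,6,-9)]" 18])
    code_simp+

definition surface_11 :: "(nat \<times> nat \<times> nat) list" where
  "surface_11 =
   [(33,35,17),(44,35,17),(17,44,27),(29,44,27),(27,18,24),(44,18,24),(17,16,18),(35,16,18),
   (18,54,44),(29,54,44),(35,29,27),(44,16,35),(16,24,29),(35,24,29),(24,33,54),(29,33,54),
   (54,35,18),(16,33,24),(27,16,33),(16,29,41),(33,29,41),(17,24,54),(41,44,24),(18,41,27),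
   (54,41,27),(17,18,41),(16,54,27),(16,54,17),(17,33,41),(41,35,54),(44,16,41),(35,41,24),
   (33,35,27),(17,27,24)]"

lemma genus4_surface_11: "genus4 surface_11"
  by (rule genus4_moves[OF genus4_surface_6, of
   "[Flip 17 29 44 27, Flip 33 44 35 17]"])
    code_simp

lemma realized_surface_11: "realized surface_11 7975408106820878487892"
  by (rule certificate_realized[OF _ _ genus4_surface_11, of
   "[(41,54,-4,-4,1), (17,44,-3,1,3), (16,24,-4,-1,-4), (35,27,0,-3,4), (33,29,-2,5,5)]" 18])
    code_simp+

definition surface_12 :: "(nat \<times> nat \<times> nat) list" where
  "surface_12 =
   [(33,27,44),(35,27,44),(27,17,35),(29,17,35),(27,18,24),(44,18,24),(17,16,18),(35,16,18),
   (18,54,44),(29,54,44),(44,16,35),(16,24,29),(35,24,29),(24,33,54),(29,33,54),(54,35,18),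
   (44,17,29),(16,33,24),(27,16,33),(16,29,41),(33,29,41),(17,24,54),(41,44,24),(18,41,27),
   (54,41,27),(17,18,41),(16,54,27),(16,54,17),(17,33,41),(41,35,54),(44,17,33),(44,16,41),
   (35,41,24),(17,27,24)]"

lemma genus4_surface_12: "genus4 surface_12"
  by (rule genus4_moves[OF genus4_surface_6, of
   "[Flip 27 29 17 35, Flip 33 35 27 44]"])
    code_simp

lemma realized_surface_12: "realized surface_12 7975329059744172351832"
  by (rule certificate_realized[OF _ _ genus4_surface_12, of
   "[(41,54,5,-3,1), (17,44,-1,-4,3), (16,24,2,-5,-5), (35,27,4,-1,2), (33,29,-5,-5,5)]" 18])
    code_simp+

definition surface_13 :: "(nat \<times> nat \<times> nat) list" where
  "surface_13 =
   [(41,27,44),(54,27,44),(18,24,41),(27,24,41),(35,44,54),(29,18,24),(44,29,24),(24,44,35),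
   (35,18,33),(44,18,33),(24,33,54),(29,33,54),(54,35,18),(18,54,29),(35,17,29),(44,17,29),
   (27,17,35),(16,33,24),(27,16,33),(16,29,41),(33,29,41),(17,24,54),(17,18,41),(16,54,27),
   (16,54,17),(17,33,41),(16,44,18),(44,17,33),(17,16,18),(44,16,41),(16,29,35),(33,35,27),
   (16,24,35),(17,27,24)]"

lemma genus4_surface_13: "genus4 surface_13"
  by (rule genus4_moves[OF genus4_surface_9, of
   "[Flip 18 27 24 41, Flip 41 54 27 44]"])
    code_simp

lemma realized_surface_13: "realized surface_13 7783652715272863540524"
  by (rule certificate_realized[OF _ _ genus4_surface_13, of
   "[(18,54,1,4,2), (44,24,3,8,7), (17,16,8,2,-4), (41,27,-8,5,8), (29,35,0,1,3)]" 33])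
    code_simp+

definition surface_14 :: "(nat \<times> nat \<times> nat) list" where
  "surface_14 =
   [(33,27,44),(35,27,44),(27,17,35),(29,17,35),(44,18,29),(54,18,29),(17,18,33),(41,18,33),
   (27,18,24),(44,18,24),(17,16,18),(35,16,18),(44,16,35),(16,24,29),(35,24,29),(24,33,54),
   (29,33,54),(54,35,18),(44,17,29),(16,33,24),(27,16,33),(16,29,41),(33,29,41),(17,24,54),
   (41,44,24),(18,41,27),(54,41,27),(16,54,27),(16,54,17),(41,35,54),(44,17,33),(44,16,41),
   (35,41,24),(17,27,24)]"

lemma genus4_surface_14: "genus4 surface_14"
  by (rule genus4_moves[OF genus4_surface_10, of
   "[Flip 27 29 17 35, Flip 33 35 27 44]"])
    code_simp

lemma realized_surface_14: "realized surface_14 7248586747160790105296"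
  by (rule certificate_realized[OF _ _ genus4_surface_14, of
   "[(17,44,1,1,-2), (16,24,-2,5,-5), (35,27,-5,5,-3), (54,41,4,5,2), (29,33,-4,-3,1)]" 18])
    code_simp+

definition surface_15 :: "(nat \<times> nat \<times> nat) list" where
  "surface_15 =
   [(33,17,29),(41,17,29),(29,44,33),(54,44,33),(33,35,17),(44,35,17),(17,44,27),(29,44,27),
   (27,18,24),(44,18,24),(17,16,18),(35,16,18),(18,54,44),(35,29,27),(44,16,35),(16,24,29),
   (35,24,29),(24,33,54),(54,35,18),(16,33,24),(27,16,33),(16,29,41),(17,24,54),(41,44,24),
   (18,41,27),(54,41,27),(17,18,41),(16,54,27),(16,54,17),(41,35,54),(44,16,41),(35,41,24),
   (33,35,27),(17,27,24)]"

lemma genus4_surface_15: "genus4 surface_15"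
  by (rule genus4_moves[OF genus4_surface_11, of
   "[Flip 29 54 44 33, Flip 33 41 17 29]"])
    code_simp

lemma realized_surface_15: "realized surface_15 7975405933946104723308"
  by (rule certificate_realized[OF _ _ genus4_surface_15, of
   "[(41,54,0,3,1), (17,44,-4,3,2), (16,24,-2,2,-4), (35,27,1,3,3), (29,33,4,4,4)]" 18])
    code_simp+

definition surface_16 :: "(nat \<times> nat \<times> nat) list" where
  "surface_16 =
   [(44,18,29),(54,18,29),(17,18,33),(41,18,33),(33,35,17),(44,35,17),(17,44,27),(29,44,27),
   (27,18,24),(44,18,24),(17,16,18),(35,16,18),(35,29,27),(44,16,35),(16,24,29),(35,24,29),
   (24,33,54),(29,33,54),(54,35,18),(16,33,24),(27,16,33),(16,29,41),(33,29,41),(17,24,54),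
   (41,44,24),(18,41,27),(54,41,27),(16,54,27),(16,54,17),(41,35,54),(44,16,41),(35,41,24),
   (33,35,27),(17,27,24)]"

lemma genus4_surface_16: "genus4 surface_16"
  by (rule genus4_moves[OF genus4_surface_11, of
   "[Flip 17 41 18 33, Flip 44 54 18 29]"])
    code_simp

lemma realized_surface_16: "realized surface_16 7783652684471574486996"
  by (rule certificate_realized[OF _ _ genus4_surface_16, of
   "[(29,33,-4,4,3), (44,17,1,2,-3), (24,16,-1,0,2), (27,35,-3,-3,-4), (41,54,3,2,-1)]" 18])
    code_simp+

definition surface_17 :: "(nat \<times> nat \<times> nat) list" where
  "surface_17 =
   [(44,18,29),(54,18,29),(17,18,33),(41,18,33),(27,18,24),(44,18,24),(17,16,18),(35,16,18),
   (27,35,54),(41,35,27),(27,29,33),(35,29,33),(29,54,41),(33,54,41),(17,29,27),(44,16,35),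
   (16,24,29),(35,24,29),(24,33,54),(54,35,18),(33,35,44),(44,17,29),(16,33,24),(27,16,33),
   (16,29,41),(17,24,54),(41,44,24),(18,41,27),(16,54,27),(16,54,17),(44,17,33),(44,16,41),
   (35,41,24),(17,27,24)]"

lemma genus4_surface_17: "genus4 surface_17"
  by (rule genus4_moves[OF genus4_surface_7, of
   "[Flip 17 35 16 18, Flip 27 44 18 24, Flip 17 41 18 33, Flip 44 54 18 29]"])
    code_simp

lemma realized_surface_17: "realized surface_17 7783701613551349082070"
  by (rule certificate_realized[OF _ _ genus4_surface_17, of
   "[(27,35,-6,-5,6), (24,16,0,-1,3), (44,17,1,-1,-4), (29,33,2,-6,-6), (54,41,-1,4,-2)]" 18])
    code_simp+

definition surface_18 :: "(nat \<times> nat \<times> nat) list" where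
  "surface_18 =
   [(44,18,33),(54,18,33),(17,18,29),(41,18,29),(33,17,29),(29,44,33),(33,35,17),(44,35,17),
   (17,44,27),(29,44,27),(27,18,24),(44,18,24),(17,16,18),(35,16,18),(35,29,27),(44,16,35),
   (16,24,29),(35,24,29),(24,33,54),(54,35,18),(16,33,24),(27,16,33),(16,29,41),(17,24,54),
   (41,44,24),(18,41,27),(54,41,27),(16,54,27),(16,54,17),(41,35,54),(44,16,41),(35,41,24),
   (33,35,27),(17,27,24)]"

lemma genus4_surface_18: "genus4 surface_18"
  by (rule genus4_moves[OF genus4_surface_15, of
   "[Flip 17 41 18 29, Flip 44 54 18 33]"])
    code_simp

lemma realized_surface_18: "realized surface_18 7783631221793521264056"
  by (rule certificate_realized[OF _ _ genus4_surface_18, of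
   "[(29,33,-4,1,-1), (41,54,-5,3,2), (27,35,8,-5,-2), (24,16,4,-5,8), (44,17,-7,-8,-4)]" 18])
    code_simp+

definition surface_19 :: "(nat \<times> nat \<times> nat) list" where
  "surface_19 =
   [(27,44,35),(17,27,35),(27,29,33),(35,29,33),(29,44,17),(33,44,17),(41,17,29),(54,44,33),
   (33,35,17),(29,44,27),(27,18,24),(44,18,24),(17,16,18),(35,16,18),(18,54,44),(44,16,35),
   (16,24,29),(35,24,29),(24,33,54),(54,35,18),(16,33,24),(27,16,33),(16,29,41),(17,24,54),
   (41,44,24),(18,41,27),(54,41,27),(17,18,41),(16,54,27),(16,54,17),(41,35,54),(44,16,41),
   (35,41,24),(17,27,24)]"

text \<open>Again a cyclic exchange of three edges that the involution maps to themselves, opened by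
  the temporary vertex 0.\<close>

lemma genus4_surface_19: "genus4 surface_19"
  by (rule genus4_moves[OF genus4_surface_15, of
   "[Cone 17 27 44 0, Flip 17 44 35 0, Flip 29 33 44 17, Flip 27 35 29 33, Flip 0 17 27 35, Uncone 27 44 35 0]"])
    code_simp

lemma realized_surface_19: "realized surface_19 7975364004562837220596"
  by (rule certificate_realized[OF _ _ genus4_surface_19, of
   "[(41,54,0,3,1), (17,44,4,2,4), (16,24,2,2,-3), (35,27,-1,2,2), (29,33,-4,4,3)]" 18])
    code_simp+

definition surface_20 :: "(nat \<times> nat \<times> nat) list" where
  "surface_20 =
   [(33,35,17),(44,35,17),(17,44,27),(29,44,27),(44,18,29),(54,18,29),(17,18,33),(41,18,33),
   (27,18,24),(44,18,24),(17,16,18),(35,16,18),(27,35,54),(41,35,27),(27,29,33),(35,29,33),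
   (29,54,41),(33,54,41),(44,16,35),(16,24,29),(35,24,29),(24,33,54),(54,35,18),(16,33,24),
   (27,16,33),(16,29,41),(17,24,54),(41,44,24),(18,41,27),(16,54,27),(16,54,17),(44,16,41),
   (35,41,24),(17,27,24)]"

lemma genus4_surface_20: "genus4 surface_20"
  by (rule genus4_moves[OF genus4_surface_17, of
   "[Flip 17 29 44 27, Flip 33 44 35 17]"])
    code_simp

lemma realized_surface_20: "realized surface_20 7783653395261339135004"
  by (rule certificate_realized[OF _ _ genus4_surface_20, of
   "[(27,35,0,1,-3), (24,16,7,-3,-8), (44,17,4,-2,-6), (29,33,9,-8,-4), (54,41,-1,8,2)]" 18])
    code_simp+

definition surface_21 :: "(nat \<times> nat \<times> nat) list" where
  "surface_21 =
   [(44,18,33),(54,18,33),(17,18,29),(41,18,29),(27,44,35),(17,27,35),(27,29,33),(35,29,33),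
   (29,44,17),(33,44,17),(33,35,17),(29,44,27),(27,18,24),(44,18,24),(17,16,18),(35,16,18),
   (44,16,35),(16,24,29),(35,24,29),(24,33,54),(54,35,18),(16,33,24),(27,16,33),(16,29,41),
   (17,24,54),(41,44,24),(18,41,27),(54,41,27),(16,54,27),(16,54,17),(41,35,54),(44,16,41),
   (35,41,24),(17,27,24)]"

lemma genus4_surface_21: "genus4 surface_21"
  by (rule genus4_moves[OF genus4_surface_19, of
   "[Flip 17 41 18 29, Flip 44 54 18 33]"])
    code_simp

lemma realized_surface_21: "realized surface_21 7783631203137242301864"
  by (rule certificate_realized[OF _ _ genus4_surface_21, of
   "[(17,44,5,-5,-1), (16,24,0,-1,5), (35,27,-4,-5,-4), (54,41,1,1,3), (33,29,2,-1,-2)]" 18])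
    code_simp+

definition surface_22 :: "(nat \<times> nat \<times> nat) list" where
  "surface_22 =
   [(18,41,17),(33,41,17),(18,54,44),(29,54,44),(33,35,17),(44,35,17),(17,44,27),(29,44,27),
   (27,18,24),(44,18,24),(17,16,18),(35,16,18),(27,35,54),(41,35,27),(27,29,33),(35,29,33),
   (29,54,41),(33,54,41),(44,16,35),(16,24,29),(35,24,29),(24,33,54),(54,35,18),(16,33,24),
   (27,16,33),(16,29,41),(17,24,54),(41,44,24),(18,41,27),(16,54,27),(16,54,17),(44,16,41),
   (35,41,24),(17,27,24)]"

lemma genus4_surface_22: "genus4 surface_22"
  by (rule genus4_moves[OF genus4_surface_20, of
   "[Flip 18 29 54 44, Flip 18 33 41 17]"])
    code_simp

lemma realized_surface_22: "realized surface_22 7975374650237402594268"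
  by (rule certificate_realized[OF _ _ genus4_surface_22, of
   "[(27,35,5,-8,-9), (24,16,1,0,9), (44,17,-1,2,-4), (54,41,-8,-3,-2), (33,29,-3,-4,-5)]" 18])
    code_simp+

definition surface_23 :: "(nat \<times> nat \<times> nat) list" where
  "surface_23 =
   [(17,35,33),(44,35,33),(27,17,33),(17,18,29),(33,18,29),(41,18,33),(35,29,17),(29,44,33),
   (18,54,44),(29,54,44),(27,18,24),(44,18,24),(17,16,18),(35,16,18),(27,35,54),(41,35,27),
   (29,54,41),(33,54,41),(44,16,35),(16,24,29),(35,24,29),(24,33,54),(54,35,18),(16,33,24),
   (27,16,33),(16,29,41),(17,24,54),(41,44,24),(18,41,27),(16,54,27),(16,54,17),(44,16,41),
   (35,41,24),(17,27,24)]"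

text \<open>After the first mirror pair the flips leave the involution of \<open>surface_22\<close>:
  the vertex on the axis is 18 there and 44 here.\<close>

lemma genus4_surface_23: "genus4 surface_23"
  by (rule genus4_moves[OF genus4_surface_22, of
   "[Flip 27 29 44 33, Flip 33 35 29 17, Flip 17 41 18 33, Flip 17 33 18 29, Flip 27 44 17 33, Flip 17 44 35
   33]"])
    code_simp

lemma realized_surface_23: "realized surface_23 7975331383390802947136"
  by (rule certificate_realized[OF _ _ genus4_surface_23, of
   "[(29,41,-2,1,2), (33,24,2,4,3), (35,18,-4,-5,-1), (16,54,5,-3,5), (17,27,1,5,4)]" 44])
    code_simp+

definition surface_24 :: "(nat \<times> nat \<times> nat) list" where
  "surface_24 =
   [(33,17,54),(41,17,54),(27,18,16),(33,18,16),(17,24,16),(54,24,16),(16,44,17),(18,44,17),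
   (17,33,29),(44,33,29),(16,33,35),(24,33,35),(17,29,27),(35,29,27),(16,35,41),(29,35,41),
   (35,27,18),(29,54,41),(41,27,44),(54,27,44),(18,24,41),(27,24,41),(35,44,54),(29,18,24),
   (44,29,24),(24,44,35),(44,18,33),(24,33,54),(54,35,18),(18,54,29),(17,18,41),(16,54,27),
   (44,16,41),(17,27,24)]"

lemma genus4_surface_24: "genus4 surface_24"
  by (rule genus4_moves[OF genus4_surface_13, of
   "[Flip 29 33 54 41, Flip 33 35 27 18, Flip 16 29 35 41, Flip 17 35 29 27, Flip 16 24 33 35, Flip 17 44 33
   29, Flip 16 18 44 17, Flip 17 54 24 16, Flip 27 33 18 16, Flip 33 41 17 54]"])
    code_simp

lemma realized_surface_24: "realized surface_24 7509210298131175605588"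
  by (rule certificate_realized[OF _ _ genus4_surface_24, of
   "[(24,44,-3,1,5), (54,18,-7,-3,-1), (17,16,1,6,6), (29,35,8,5,-4), (41,27,-8,2,9)]" 33])
    code_simp+

definition surface_25 :: "(nat \<times> nat \<times> nat) list" where
  "surface_25 =
   [(33,17,44),(35,17,44),(18,44,27),(24,44,27),(27,17,33),(17,18,29),(33,18,29),(41,18,33),
   (35,29,17),(29,44,33),(18,54,44),(29,54,44),(17,16,18),(35,16,18),(27,35,54),(41,35,27),
   (29,54,41),(33,54,41),(44,16,35),(16,24,29),(35,24,29),(24,33,54),(54,35,18),(16,33,24),
   (27,16,33),(16,29,41),(17,24,54),(41,44,24),(18,41,27),(16,54,27),(16,54,17),(44,16,41),
   (35,41,24),(17,27,24)]"

lemma genus4_surface_25: "genus4 surface_25"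
  by (rule genus4_moves[OF genus4_surface_23, of
   "[Flip 18 24 44 27, Flip 33 35 17 44]"])
    code_simp

lemma realized_surface_25: "realized surface_25 7248586883157589363344"
  by (rule certificate_realized[OF _ _ genus4_surface_25, of
   "[(29,41,1,-1,-2), (33,24,-4,-6,-5), (17,27,7,-3,-7), (35,18,3,4,-4), (16,54,2,-1,-6)]" 44])
    code_simp+

definition surface_26 :: "(nat \<times> nat \<times> nat) list" where
  "surface_26 =
   [(24,27,33),(17,24,33),(24,16,54),(33,16,54),(16,17,27),(54,17,27),(17,35,33),(44,35,33),
   (17,18,29),(33,18,29),(41,18,33),(35,29,17),(29,44,33),(18,54,44),(29,54,44),(27,18,24),
   (44,18,24),(17,16,18),(35,16,18),(27,35,54),(41,35,27),(29,54,41),(33,54,41),(44,16,35),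
   (16,24,29),(35,24,29),(54,35,18),(27,16,33),(16,29,41),(17,24,54),(41,44,24),(18,41,27),
   (44,16,41),(35,41,24)]"

lemma genus4_surface_26: "genus4 surface_26"
  by (rule genus4_moves[OF genus4_surface_23, of
   "[Cone 17 24 27 0, Flip 17 27 33 0, Flip 16 54 17 27, Flip 24 33 16 54, Flip 0 17 24 33, Uncone 24 27 33 0]"])
    code_simp

lemma realized_surface_26: "realized surface_26 7975367075254717834956"
  by (rule certificate_realized[OF _ _ genus4_surface_26, of
   "[(29,41,-1,1,1), (33,24,-3,6,-5), (35,18,-5,2,-1), (16,54,1,-3,-4), (17,27,5,6,-3)]" 44])
    code_simp+

definition surface_27 :: "(nat \<times> nat \<times> nat) list" where
  "surface_27 =
   [(17,33,27),(29,33,27),(16,33,41),(35,33,41),(33,17,54),(41,17,54),(27,18,16),(33,18,16),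
   (17,24,16),(54,24,16),(16,44,17),(18,44,17),(44,33,29),(24,33,35),(35,29,27),(29,35,41),
   (35,27,18),(29,54,41),(41,27,44),(54,27,44),(18,24,41),(27,24,41),(35,44,54),(29,18,24),
   (44,29,24),(24,44,35),(44,18,33),(24,33,54),(54,35,18),(18,54,29),(17,18,41),(16,54,27),
   (44,16,41),(17,27,24)]"

lemma genus4_surface_27: "genus4 surface_27"
  by (rule genus4_moves[OF genus4_surface_24, of
   "[Flip 16 35 33 41, Flip 17 29 33 27]"])
    code_simp

lemma realized_surface_27: "realized surface_27 8174335882943271903232"
  by (rule certificate_realized[OF _ _ genus4_surface_27, of
   "[(24,44,2,-1,4), (54,18,5,5,-4), (17,16,4,-5,5), (27,41,-1,3,1), (29,35,-2,-5,-3)]" 33])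
    code_simp+

definition surface_28 :: "(nat \<times> nat \<times> nat) list" where
  "surface_28 =
   [(41,29,17),(54,29,17),(18,16,35),(27,16,35),(17,33,27),(29,33,27),(16,33,41),(35,33,41),
   (33,17,54),(33,18,16),(17,24,16),(54,24,16),(16,44,17),(18,44,17),(44,33,29),(24,33,35),
   (35,29,27),(29,35,41),(41,27,44),(54,27,44),(18,24,41),(27,24,41),(35,44,54),(29,18,24),
   (44,29,24),(24,44,35),(44,18,33),(24,33,54),(54,35,18),(18,54,29),(17,18,41),(16,54,27),
   (44,16,41),(17,27,24)]"

lemma genus4_surface_28: "genus4 surface_28"
  by (rule genus4_moves[OF genus4_surface_27, of
   "[Flip 18 27 16 35, Flip 41 54 29 17]"])
    code_simp

lemma realized_surface_28: "realized surface_28 7248604921019728157744"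
  by (rule certificate_realized[OF _ _ genus4_surface_28, of
   "[(24,44,-3,1,-6), (54,18,-7,-8,7), (17,16,-8,7,-8), (27,41,2,-3,-1), (29,35,2,5,5)]" 33])
    code_simp+

section \<open>Non-isomorphism and conclusion\<close>

lemma realized_distinct:
  assumes "realized ts m" "realized us n" "isomorphic_complexes (list_complex ts) (list_complex us)"
  shows "m = n"
  using assms total_weight_iso[of "list_complex ts" "list_complex us" 3] by (simp add: realized_def)

definition surfaces :: "((nat \<times> nat \<times> nat) list \<times> nat) list" where
  "surfaces = [
    (surface_1, 7975425019556121449072), (surface_2, 7248586875533671382244), (surface_3,
    7783652992580094583472), (surface_4, 7509492278753520985350), (surface_5, 7783683610151519704646),
    (surface_6, 7513187600030068155906), (surface_7, 8967101449634503882002), (surface_8,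
    7509490526811396272226), (surface_9, 7783656051231368158702), (surface_10, 7783701656691733424946),
    (surface_11, 7975408106820878487892), (surface_12, 7975329059744172351832), (surface_13,
    7783652715272863540524), (surface_14, 7248586747160790105296), (surface_15, 7975405933946104723308),
    (surface_16, 7783652684471574486996), (surface_17, 7783701613551349082070), (surface_18,
    7783631221793521264056), (surface_19, 7975364004562837220596), (surface_20, 7783653395261339135004),
    (surface_21, 7783631203137242301864), (surface_22, 7975374650237402594268), (surface_23,
    7975331383390802947136), (surface_24, 7509210298131175605588), (surface_25, 7248586883157589363344),
    (surface_26, 7975367075254717834956), (surface_27, 8174335882943271903232), (surface_28,
    7248604921019728157744)]"

lemma realized_surfaces: "\<forall>(ts, n)\<in>set surfaces. realized ts n"
  unfolding surfaces_def by (simp add: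
    realized_surface_1 realized_surface_2 realized_surface_3 realized_surface_4 realized_surface_5
    realized_surface_6 realized_surface_7 realized_surface_8 realized_surface_9 realized_surface_10
    realized_surface_11 realized_surface_12 realized_surface_13 realized_surface_14 realized_surface_15
    realized_surface_16 realized_surface_17 realized_surface_18 realized_surface_19 realized_surface_20
    realized_surface_21 realized_surface_22 realized_surface_23 realized_surface_24 realized_surface_25
    realized_surface_26 realized_surface_27 realized_surface_28)

lemma distinct_surfaces: "distinct (map snd surfaces)" "length surfaces = 28"
  unfolding surfaces_def by simp_all

theorem theorem6p3:
  shows "\<exists>\<F> :: nat set set set.
    card \<F> = 28 \<and>
    (\<forall>\<Delta>\<in>\<F>. triangulates \<Delta> (orientable_surface 4) \<and> card (vertices \<Delta>) = 11) \<and>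
    (\<forall>\<Delta>\<in>\<F>. \<forall>\<Gamma>\<in>\<F>. isomorphic_complexes \<Delta> \<Gamma> \<longrightarrow> \<Delta> = \<Gamma>) \<and>
    (\<forall>\<Delta>\<in>\<F>. \<exists>\<psi> :: nat \<Rightarrow> real^3.
       polyhedral_realization \<Delta> \<psi> \<and> has_2fold_rotational_symmetry \<Delta> \<psi>)"
proof -
  define \<F> where "\<F> = (\<lambda>(ts, n). list_complex ts) ` set surfaces"
  have real: "realized ts n" if "(ts, n) \<in> set surfaces" for ts n
    using realized_surfaces that by blast
  have weight: "total_weight (list_complex ts) 3 = n" if "(ts, n) \<in> set surfaces" for ts n
    using real[OF that] by (simp add: realized_def)
  have snd_inj: "p = q" if "p \<in> set surfaces" "q \<in> set surfaces" "snd p = snd q" for p q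
    using distinct_surfaces(1) that unfolding distinct_map by (blast dest: inj_onD)
  \<comment> \<open>Equal complexes have equal weights, and the weights in the list are different.
    The family therefore has as many members as the list.\<close>
  have "inj_on (\<lambda>(ts, n). list_complex ts) (set surfaces)"
  proof (rule inj_onI, clarify)
    fix ts m us n
    assume mem: "(ts, m) \<in> set surfaces" "(us, n) \<in> set surfaces" and "list_complex ts = list_complex us"
    then have "m = n" using weight by metis
    then show "ts = us \<and> m = n" using snd_inj[OF mem] by simp
  qed
  then have "card \<F> = 28"
    using distinct_surfaces distinct_card[of surfaces] unfolding \<F>_def by (simp add: card_image distinct_map)
  moreover have "\<Delta> = \<Gamma>" if mem: "\<Delta> \<in> \<F>" "\<Gamma> \<in> \<F>" and iso: "isomorphic_complexes \<Delta> \<Gamma>" for \<Delta> \<Gamma>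
  proof -
    obtain ts m us n where ts: "(ts, m) \<in> set surfaces" "\<Delta> = list_complex ts"
      and us: "(us, n) \<in> set surfaces" "\<Gamma> = list_complex us"
      using mem by (auto simp: \<F>_def)
    have "m = n" using realized_distinct[OF real[OF ts(1)] real[OF us(1)]] iso ts(2) us(2) by simp
    then have "ts = us" using snd_inj[OF ts(1) us(1)] by simp
    then show ?thesis using ts us by simp
  qed
  moreover have "triangulates \<Delta> (orientable_surface 4) \<and> card (vertices \<Delta>) = 11 \<and>
      (\<exists>\<psi>. polyhedral_realization \<Delta> \<psi> \<and> has_2fold_rotational_symmetry \<Delta> \<psi>)" if "\<Delta> \<in> \<F>" for \<Delta>
    using that real by (auto simp: \<F>_def realized_def)
  ultimately show ?thesis by blast
qed

end
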